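(* Let $c\ge1$ be an integer. The set $$\mathcal{B}_{c,1}=\big\{x_{m_1}(z,t)_{r_1}x_{m_2}(z,t)_{r_2}\cdots x_{m_k}(z,t)_{r_k}\mathbf 1\,:\, r_1,\dots,r_{k-1}\leq -2,\ r_k\leq -1,\ 1\leq m_j\leq c,\ j=1,\dots,k,\ k\in\mathbb{Z}_{\geq 0}\big\}$$ forms a basis for $V_{c,1}$.
   Context: Operators. Let $\mathbb F=\mathbb C(q^{1/2})$ and $\mathsf q=q^2$. For an $\mathbb F$-vector space $L$, $L((z_1,\dots,z_m))$ is the space of formal Laurent series with coefficients in $L$ and exponents bounded below in each variable; $\mathcal E(L)=\operatorname{Hom}(L,L((z)))$, $\mathcal E(L)_t=\mathcal E(L)\otimes\mathbb F[t]$; $a(z)\otimes t^\alpha$ is homogeneous of weight $\alpha$. $[r]_{\mathsf q}=(\mathsf q^r-1)/(\mathsf q-1)$, with corresponding factorials $[r]_{\mathsf q}!$ and binomials $\binom ml_{\mathsf q}=[m]_{\mathsf q}\cdots[m-l+1]_{\mathsf q}/[l]_{\mathsf q}!$. The $\mathsf q$-derivative is $a^{[1]}(z)=\frac{a(z\mathsf q)-a(z)}{z(\mathsf q-1)}$, $a^{[r]}$ its $r$-th iterate. $\mathbb F[z]_0=\{p\in\mathbb F[z]:p(1)=1,\ p(\mathsf q^n)\ne0\ \forall n\in\mathbb Z_{\ge0}\}$. A sequence $(a_1(z)\otimes t^{\alpha_1},\dots,a_m(z)\otimes t^{\alpha_m})$ is quasi-commutative if for some $p\in\mathbb F[z]_0$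 the series $\bigl(\prod_{i<j}p(z_j/z_i)\bigr)a_1(z_1)a_2(z_2\mathsf q^{\alpha_1})\cdots a_m(z_m\mathsf q^{\alpha_1+\cdots+\alpha_{m-1}})$ lies in $\operatorname{Hom}(L,L((z_1,\dots,z_m)))$; a sequence of general elements is quasi-commutative if all choices of homogeneous components are. For a quasi-commutative pair and $r\ge0$, $(a(z)\otimes t^\alpha)_{-r-1}(b(z)\otimes t^\beta)=\lim_{z_1\to z}\frac{p(z/z_1)}{[r]_{\mathsf q}!}a^{[r]}(z_1)b(z\mathsf q^{\alpha+r})\otimes t^{\alpha+\beta+r}$, with $p\in\mathbb F[z]_0$ any polynomial such that $p(z/z_1)a^{[r]}(z_1)b(z\mathsf q^{\alpha+r})\in\operatorname{Hom}(L,L((z_1,z)))$ (the limit means setting $z_1=z$; the result is independent of $p$); for $r<0$ the product is $0$; extend bilinearly. $Y(a,z_0)b=\sum_r(a_rb)z_0^{-r-1}$; $\mathbf 1=1\otimes1$ (identity operator tensor $1$). Iterated products are nested to the right. A graded nonlocal $\mathsf q$-vertex algebra is a $\mathbb Z$-graded space $V=\coprod_uV_{(u)}$ with a linear map $Y(\cdot,z_0):V\to(\operatorname{End}V)[[z_0^{\pm1}]]$, $Y(a,z_0)=\sum_ra_rz_0^{-r-1}$, and $\mathbf 1\in V$ such that: $a_rb=0$ for $r\gg0$; $Y(\mathbf 1,z_0)=1_V$; $Y(a,z_0)\mathbf 1\in V[[z_0]]$ has constant term $a$; $a_rV_{(s)}\subseteq V_{(s+u-r-1)}$ for $a\in V_{(u)}$;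 and for $a\in V_{(u)}$, $b,c\in V$, $r,s\in\mathbb Z$: $(a_rb)_sc=\sum_{l\ge0}\binom{l-r-1}{l}_{\mathsf q}\mathsf q^{(s+l+1)(r-u+1)}a_{r-l}(b_{s+l}c)$ (this is $Y(a,z_0+z_2)Y(b,z_2\mathsf q^u)c=Y(Y(a,z_0)b,z_2)c$ with $z_2z_0=\mathsf qz_0z_2$). A graded nonlocal $\mathsf q$-vertex algebra $V\subseteq\mathcal E(L)_t$ is a subspace whose pairs are quasi-commutative, containing $\mathbf 1$, closed under all products, satisfying these axioms with $Y(a,z_0)b=\sum_{r\in\mathbb Z}(a_rb)z_0^{-r-1}$ formed from the products $a_rb$ of quasi-commutative pairs in $\mathcal E(L)_t$, with $\mathbf 1=1\otimes1$ (identity operator of $L$ tensor $1$), and with $V_{(u)}=\{a(z)\otimes t^u\in V\}$. The module $L$ for $U_q(\widehat{\mathfrak{sl}}_2)$. Let $[r]=(q^r-q^{-r})/(q-q^{-1})$. $M(1)$ is the polynomial algebra over $\mathbb F$ in $a(-r)$, $r\ge1$; $a(-r)$ acts by multiplication and $a(r)$, $r\ge1$, as the derivation with $[a(r),a(-s)]=\delta_{rs}\frac{[2r][r]}{r}$. Let $Q=\mathbb Z\alpha_1$, $(\alpha_1,\alpha_1)=2$, $\mathbb C\{Q\}$ its group algebra (scalars extended to $\mathbb F$) with basis $e^\beta$, $z^{\partial_{\alpha_1}}e^\beta=z^{(\alpha_1,\beta)}e^\beta$, $Ke^\beta=q^{(\alpha_1,\beta)}e^\beta$. On $L_0=M(1)\otimes\mathbb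 C\{Q\}$ (the Frenkel–Jing module of highest weight $\Lambda_0$) put $$x^+(z)=\exp\Bigl(\sum_{r\ge1}\tfrac{q^{-r/2}}{[r]}a(-r)z^r\Bigr)\exp\Bigl(-\sum_{r\ge1}\tfrac{q^{-r/2}}{[r]}a(r)z^{-r}\Bigr)\otimes e^{\alpha_1}z^{\partial_{\alpha_1}},\quad \phi(z)=K^{-1}\exp\Bigl(-(q-q^{-1})\sum_{r\ge1}a(-r)z^r\Bigr).$$ On $L=(L_0)^{\otimes c}$ the current $x(z)=x_1^+(z)\in\mathcal E(L)$ acts (Drinfeld coproduct) by $$x(z)=\sum_{l=1}^c\phi(zq^{1/2})\otimes\phi(zq^{3/2})\otimes\cdots\otimes\phi(zq^{l-3/2})\otimes x^+(zq^{l-1})\otimes1^{\otimes(c-l)}.$$ $V_{c,1}\subseteq\mathcal E(L)_t$ is the smallest graded nonlocal $\mathsf q$-vertex algebra containing $x(z)\otimes t$ (it exists). For $m\ge1$, $x_m(z,t)=\underbrace{(x(z)\otimes t)_{-1}\cdots(x(z)\otimes t)_{-1}}_{m}\mathbf 1\in V_{c,1}$. For $k=0$ the monomial in $\mathcal B_{c,1}$ is $\mathbf 1$. *)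

theory Defs
  imports
    "HOL-Library.Poly_Mapping"
    "HOL-Library.Function_Algebras"
    "HOL-Library.Product_Plus"
    "HOL-Library.Cardinality"
    "HOL-Computational_Algebra.Fraction_Field"
    "HOL-Computational_Algebra.Formal_Laurent_Series"
begin

section \<open>The ground field and q-numbers\<close>

type_synonym F = "complex poly fract"

definition qh :: F  \<comment> \<open>the generator $q^{1/2}$ of the field\<close>
  where "qh = Fraction_Field.Fract [:0, 1:] 1"

definition q :: F where "q = qh ^ 2"

definition Q :: F where "Q = q ^ 2"

definition qint :: "nat \<Rightarrow> F"  \<comment> \<open>the symmetric q-number\<close>
  where "qint r = (q ^ r - inverse q ^ r) / (q - inverse q)"

definition Qnum :: "int \<Rightarrow> F"
  where "Qnum r = (Q powi r - 1) / (Q - 1)"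

definition Qfact :: "nat \<Rightarrow> F"
  where "Qfact r = (\<Prod>i=1..r. Qnum (int i))"

definition Qbinom :: "int \<Rightarrow> nat \<Rightarrow> F"
  where "Qbinom m l = (\<Prod>i<l. Qnum (m - int i)) / Qfact l"


section \<open>Vector spaces and Laurent series over the ground field\<close>

text \<open>
  A vector space over \<open>F\<close> is given by a basis, indexed by a type \<open>'k\<close>: its elements are the finitely
  supported functions from \<open>'k\<close> to \<open>F\<close>.
\<close>

type_synonym 'k vec = "'k \<Rightarrow>\<^sub>0 F"

definition smul :: "F \<Rightarrow> 'k vec \<Rightarrow> 'k vec"
  where "smul c = Poly_Mapping.map ((*) c)"

lemma lookup_smul [simp]: "Poly_Mapping.lookup (smul c v) k = c * Poly_Mapping.lookup v k"
  by (simp add: smul_def map.rep_eq when_def)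

lemma vector_space_smul: "vector_space (smul :: F \<Rightarrow> 'k vec \<Rightarrow> 'k vec)"
  by unfold_locales
     (auto intro!: poly_mapping_eqI simp: lookup_add algebra_simps)

lemma smul_zero [simp]: "smul c 0 = 0"
  by (rule poly_mapping_eqI) simp

lift_definition fls_smul :: "F \<Rightarrow> 'k vec fls \<Rightarrow> 'k vec fls"
  is "\<lambda>c f n. smul c (f n)"
  by (erule eventually_mono) simp

lemma vector_space_fls_smul: "vector_space (fls_smul :: F \<Rightarrow> 'k vec fls \<Rightarrow> 'k vec fls)"
proof -
  interpret vector_space "smul :: F \<Rightarrow> 'k vec \<Rightarrow> 'k vec" by (rule vector_space_smul)
  show ?thesis
    by unfold_locales
       (auto simp: fls_eq_iff fls_smul.rep_eq scale_right_distrib scale_left_distrib)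
qed

lift_definition dilate :: "F \<Rightarrow> 'k vec fls \<Rightarrow> 'k vec fls"  \<comment> \<open>$f(z) \mapsto f(zc)$\<close>
  is "\<lambda>c f n. smul (c powi n) (f n)"
  by (erule eventually_mono) simp

definition qderiv :: "'k vec fls \<Rightarrow> 'k vec fls"
  where "qderiv f = fls_smul (inverse (Q - 1)) (fls_shift 1 (dilate Q f - f))"

definition lin_ext :: "(F \<Rightarrow> 'v \<Rightarrow> 'v) \<Rightarrow> ('k \<Rightarrow> 'v) \<Rightarrow> 'k vec \<Rightarrow> 'v::comm_monoid_add"
  \<comment> \<open>the linear map with prescribed values on the basis\<close>
  where "lin_ext scale g v = (\<Sum>k\<in>Poly_Mapping.keys v. scale (Poly_Mapping.lookup v k) (g k))"


section \<open>Currents and quasi-commutativity\<close>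

type_synonym 'k cur = "'k vec \<Rightarrow> 'k vec fls"

definition currents :: "'k cur set"  \<comment> \<open>$\mathcal E(L) = \mathrm{Hom}(L, L((z)))$\<close>
  where "currents = {a. Vector_Spaces.linear smul fls_smul a}"

definition cur_smul :: "F \<Rightarrow> 'k cur \<Rightarrow> 'k cur"
  where "cur_smul c a = (\<lambda>v. fls_smul c (a v))"

lemma vector_space_cur_smul: "vector_space (cur_smul :: F \<Rightarrow> 'k cur \<Rightarrow> 'k cur)"
proof -
  interpret vector_space "fls_smul :: F \<Rightarrow> 'k vec fls \<Rightarrow> 'k vec fls"
    by (rule vector_space_fls_smul)
  show ?thesis
    by unfold_locales
       (auto simp: cur_smul_def fun_eq_iff scale_right_distrib scale_left_distrib)
qed

definition cur_dilate :: "F \<Rightarrow> 'k cur \<Rightarrow> 'k cur"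
  where "cur_dilate c a = (\<lambda>v. dilate c (a v))"

definition cur_qderiv :: "'k cur \<Rightarrow> 'k cur"
  where "cur_qderiv a = (\<lambda>v. qderiv (a v))"

text \<open>
  A series in two variables with coefficients in \<open>End L\<close> is a function \<open>A\<close> such that \<open>A v i j\<close> is
  the value at \<open>v\<close> of the coefficient of $z_1^i z_2^j$.
\<close>

type_synonym 'k cur2 = "'k vec \<Rightarrow> int \<Rightarrow> int \<Rightarrow> 'k vec"

definition currents2 :: "'k cur2 set"  \<comment> \<open>$\mathrm{Hom}(L, L((z_1, z_2)))$\<close>
  where "currents2 = {A. (\<forall>i j. Vector_Spaces.linear smul smul (\<lambda>v. A v i j)) \<and>
                         (\<forall>v. \<exists>N. \<forall>i j. i < N \<or> j < N \<longrightarrow> A v i j = 0)}"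

definition cur_prod :: "'k cur \<Rightarrow> 'k cur \<Rightarrow> 'k cur2"  \<comment> \<open>$a(z_1)b(z_2)$\<close>
  where "cur_prod a b = (\<lambda>v i j. fls_nth (a (fls_nth (b v) j)) i)"

definition poly_mult :: "F poly \<Rightarrow> 'k cur2 \<Rightarrow> 'k cur2"  \<comment> \<open>$p(z_2/z_1)A(z_1,z_2)$\<close>
  where "poly_mult p A = (\<lambda>v i j. \<Sum>k\<le>degree p. smul (coeff p k) (A v (i + int k) (j - int k)))"

definition diag :: "'k cur2 \<Rightarrow> 'k cur"  \<comment> \<open>$A(z,z)$, meaningful for \<open>A \<in> currents2\<close>\<close>
  where "diag A = (\<lambda>v. Abs_fls (\<lambda>n. Sum_any (\<lambda>i. A v i (n - i))))"

definition polys0 :: "F poly set"  \<comment> \<open>$\mathbb F[z]_0$\<close>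
  where "polys0 = {p. poly p 1 = 1 \<and> (\<forall>n::nat. poly p (Q ^ n) \<noteq> 0)}"

definition quasi_comm_hom :: "'k cur \<Rightarrow> nat \<Rightarrow> 'k cur \<Rightarrow> bool"
  \<comment> \<open>quasi-commutativity of a homogeneous pair $(a(z)\otimes t^\alpha, b(z)\otimes t^\beta)$, which
     does not involve $\beta$\<close>
  where "quasi_comm_hom a \<alpha> b \<longleftrightarrow>
    (\<exists>p\<in>polys0. poly_mult p (cur_prod a (cur_dilate (Q ^ \<alpha>) b)) \<in> currents2)"

definition prod_hom :: "nat \<Rightarrow> 'k cur \<Rightarrow> nat \<Rightarrow> 'k cur \<Rightarrow> 'k cur"
  \<comment> \<open>the current underlying $(a(z)\otimes t^\alpha)_{-r-1}(b(z)\otimes t^\beta)$\<close>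
  where "prod_hom r a \<alpha> b =
    (let A = cur_prod ((cur_qderiv ^^ r) a) (cur_dilate (Q ^ (\<alpha> + r)) b);
         p = (SOME p. p \<in> polys0 \<and> poly_mult p A \<in> currents2)
     in cur_smul (inverse (Qfact r)) (diag (poly_mult p A)))"

text \<open>
  The space $\mathcal E(L)\otimes\mathbb F[t]$: the coefficient of $t^\alpha$ of \<open>A\<close> is
  \<open>Poly_Mapping.lookup A \<alpha>\<close>.
\<close>

type_synonym 'k curt = "nat \<Rightarrow>\<^sub>0 'k cur"

definition currents_t :: "'k curt set"
  where "currents_t = {A. \<forall>\<alpha>. Poly_Mapping.lookup A \<alpha> \<in> currents}"

definition curt_smul :: "F \<Rightarrow> 'k curt \<Rightarrow> 'k curt"
  where "curt_smul c = Poly_Mapping.map (cur_smul c)"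

lemma lookup_curt_smul [simp]:
  "Poly_Mapping.lookup (curt_smul c A) \<alpha> = cur_smul c (Poly_Mapping.lookup A \<alpha>)"
proof -
  interpret vector_space "cur_smul :: F \<Rightarrow> 'a cur \<Rightarrow> 'a cur" by (rule vector_space_cur_smul)
  show ?thesis by (simp add: curt_smul_def Poly_Mapping.map.rep_eq when_def)
qed

lemma vector_space_curt_smul: "vector_space (curt_smul :: F \<Rightarrow> 'k curt \<Rightarrow> 'k curt)"
proof -
  interpret vector_space "cur_smul :: F \<Rightarrow> 'k cur \<Rightarrow> 'k cur" by (rule vector_space_cur_smul)
  show ?thesis
    by unfold_locales
       (auto intro!: poly_mapping_eqI simp: lookup_add scale_right_distrib scale_left_distrib)
qed

definition homog :: "'k cur \<Rightarrow> nat \<Rightarrow> 'k curt"  \<comment> \<open>$a(z)\otimes t^\alpha$\<close>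
  where "homog a \<alpha> = Poly_Mapping.single \<alpha> a"

definition curt_one :: "'k curt"
  where "curt_one = homog fls_const 0"

definition quasi_comm :: "'k curt \<Rightarrow> 'k curt \<Rightarrow> bool"
  where "quasi_comm A B \<longleftrightarrow>
    (\<forall>\<alpha> \<beta>. quasi_comm_hom (Poly_Mapping.lookup A \<alpha>) \<alpha> (Poly_Mapping.lookup B \<beta>))"

definition curt_prod :: "int \<Rightarrow> 'k curt \<Rightarrow> 'k curt \<Rightarrow> 'k curt"  \<comment> \<open>$A_nB$\<close>
  where "curt_prod n A B =
    (if n < 0
     then let r = nat (- n - 1)
          in \<Sum>\<alpha>\<in>Poly_Mapping.keys A. \<Sum>\<beta>\<in>Poly_Mapping.keys B.
               homog (prod_hom r (Poly_Mapping.lookup A \<alpha>) \<alpha> (Poly_Mapping.lookup B \<beta>)) (\<alpha> + \<beta> + r)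
     else 0)"


section \<open>Graded nonlocal q-vertex algebras\<close>

text \<open>
  \<open>V\<close> is the underlying space, as a subspace of an ambient vector space, \<open>gr u\<close> its component of
  degree \<open>u\<close>, and \<open>md n a b\<close> is $a_n b$.
\<close>

locale graded_nonlocal_q_vertex_algebra = vector_space scale
  for scale :: "F \<Rightarrow> 'v::ab_group_add \<Rightarrow> 'v" +
  fixes V :: "'v set"
    and gr :: "int \<Rightarrow> 'v set"
    and md :: "int \<Rightarrow> 'v \<Rightarrow> 'v \<Rightarrow> 'v"
    and vac :: 'v
  assumes V_subspace: "subspace V"
    and gr_subspace: "subspace (gr u)"
    and gr_subset: "gr u \<subseteq> V"
    and gr_direct_sum:
      "v \<in> V \<Longrightarrow> \<exists>!f :: int \<Rightarrow>\<^sub>0 'v.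
         (\<forall>u. Poly_Mapping.lookup f u \<in> gr u) \<and>
         v = (\<Sum>u\<in>Poly_Mapping.keys f. Poly_Mapping.lookup f u)"
    and vac_in: "vac \<in> V"
    and md_in: "a \<in> V \<Longrightarrow> b \<in> V \<Longrightarrow> md n a b \<in> V"
    and md_add_left: "a \<in> V \<Longrightarrow> a' \<in> V \<Longrightarrow> b \<in> V \<Longrightarrow> md n (a + a') b = md n a b + md n a' b"
    and md_add_right: "a \<in> V \<Longrightarrow> b \<in> V \<Longrightarrow> b' \<in> V \<Longrightarrow> md n a (b + b') = md n a b + md n a b'"
    and md_scale_left: "a \<in> V \<Longrightarrow> b \<in> V \<Longrightarrow> md n (scale x a) b = scale x (md n a b)"
    and md_scale_right: "a \<in> V \<Longrightarrow> b \<in> V \<Longrightarrow> md n a (scale x b) = scale x (md n a b)"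
    and truncation: "a \<in> V \<Longrightarrow> b \<in> V \<Longrightarrow> \<exists>N. \<forall>n\<ge>N. md n a b = 0"
    and vacuum: "b \<in> V \<Longrightarrow> md n vac b = (if n = -1 then b else 0)"
    and creation: "a \<in> V \<Longrightarrow> md (-1) a vac = a"
    and creation_reg: "a \<in> V \<Longrightarrow> n \<ge> 0 \<Longrightarrow> md n a vac = 0"
    and grading: "a \<in> gr u \<Longrightarrow> b \<in> gr s \<Longrightarrow> md n a b \<in> gr (s + u - n - 1)"
    and q_associativity:
      "a \<in> gr u \<Longrightarrow> b \<in> V \<Longrightarrow> c \<in> V \<Longrightarrow>
       md s (md r a b) c =
         Sum_any (\<lambda>l::nat. scale (Qbinom (int l - r - 1) l * Q powi ((s + int l + 1) * (r - u + 1)))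
                            (md (r - int l) a (md (s + int l) b c)))"

definition curt_gr :: "'k curt set \<Rightarrow> int \<Rightarrow> 'k curt set"
  \<comment> \<open>$V_{(u)} = \{a(z)\otimes t^u \in V\}$, which is zero for negative \<open>u\<close>\<close>
  where "curt_gr V u = (if u \<ge> 0 then {homog a (nat u) | a. homog a (nat u) \<in> V} else {0})"

definition q_vertex_algebra_of_currents :: "'k curt set \<Rightarrow> bool"
  where "q_vertex_algebra_of_currents V \<longleftrightarrow>
    V \<subseteq> currents_t \<and> (\<forall>A\<in>V. \<forall>B\<in>V. quasi_comm A B) \<and>
    graded_nonlocal_q_vertex_algebra curt_smul V (curt_gr V) curt_prod curt_one"


section \<open>The Frenkel--Jing module\<close>

text \<open>
  The pair \<open>(\<mu>, n)\<close> stands for the basis vector $\prod_{r\ge1} a(-r)^{\mu(r-1)} \otimes e^{n\alpha_1}$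
  of $M(1)\otimes\mathbb C\{Q\}$. Note the shift by one in the index of the variables. The product of
  the type \<open>fock vec\<close> is that of the algebra $M(1)\otimes\mathbb C\{Q\}$.
\<close>

type_synonym fock = "(nat \<Rightarrow>\<^sub>0 nat) \<times> int"

definition heis_minus :: "nat \<Rightarrow> fock vec \<Rightarrow> fock vec"  \<comment> \<open>$a(-r)$, for $r\ge1$\<close>
  where "heis_minus r v = Poly_Mapping.single (Poly_Mapping.single (r - 1) 1, 0) 1 * v"

definition heis_plus :: "nat \<Rightarrow> fock vec \<Rightarrow> fock vec"
  \<comment> \<open>$a(r) = \frac{[2r][r]}{r}\,\partial/\partial a(-r)$, for $r\ge1$\<close>
  where "heis_plus r = lin_ext smul (\<lambda>(\<mu>, n).
    Poly_Mapping.single (\<mu> - Poly_Mapping.single (r - 1) 1, n)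
      (of_nat (Poly_Mapping.lookup \<mu> (r - 1)) * (qint (2 * r) * qint r / of_nat r)))"

text \<open>
  For operators \<open>A r\<close>, $r\ge1$, the coefficient of $w^n$ in $\bigl(\sum_{r\ge1}A_rw^r\bigr)^k$ is
  \<open>op_pow A k n\<close>, and in $\exp\bigl(\sum_{r\ge1}A_rw^r\bigr)$ it is \<open>op_exp A n\<close>.
\<close>

primrec op_pow :: "(nat \<Rightarrow> 'k vec \<Rightarrow> 'k vec) \<Rightarrow> nat \<Rightarrow> nat \<Rightarrow> 'k vec \<Rightarrow> 'k vec" where
  "op_pow A 0 n v = (if n = 0 then v else 0)"
| "op_pow A (Suc k) n v = (\<Sum>r=1..n. A r (op_pow A k (n - r) v))"

definition op_exp :: "(nat \<Rightarrow> 'k vec \<Rightarrow> 'k vec) \<Rightarrow> nat \<Rightarrow> 'k vec \<Rightarrow> 'k vec"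
  where "op_exp A n v = (\<Sum>k\<le>n. smul (inverse (of_nat (fact k))) (op_pow A k n v))"

definition x_exp_minus :: "nat \<Rightarrow> fock vec \<Rightarrow> fock vec"
  where "x_exp_minus = op_exp (\<lambda>r v. smul (inverse qh ^ r / qint r) (heis_minus r v))"

definition x_exp_plus :: "nat \<Rightarrow> fock vec \<Rightarrow> fock vec"
  where "x_exp_plus = op_exp (\<lambda>r v. smul (- (inverse qh ^ r / qint r)) (heis_plus r v))"

text \<open>
  On the basis vector \<open>(\<mu>, n)\<close> the operator $e^{\alpha_1}z^{\partial_{\alpha_1}}$ gives
  $z^{2n}$ times the basis vector \<open>(\<mu>, n + 1)\<close>. Hence the coefficient of $z^N$ in $x^+(z)$ combines
  the coefficient of $z^{-j}$ of the second exponential with that of $z^{N+j-2n}$ of the first one;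
  only finitely many \<open>j\<close> contribute, as the second exponential lowers the degree of \<open>\<mu>\<close>.
\<close>

definition x_plus :: "fock cur"
  where "x_plus = lin_ext fls_smul (\<lambda>(\<mu>, n). Abs_fls (\<lambda>N. Sum_any (\<lambda>j::nat.
    if N + int j - 2 * n \<ge> 0
    then x_exp_minus (nat (N + int j - 2 * n))
           (x_exp_plus j (Poly_Mapping.single (\<mu>, n + 1) 1))
    else 0)))"

definition phi :: "fock cur"
  where "phi = lin_ext fls_smul (\<lambda>(\<mu>, n). Abs_fls (\<lambda>N.
    if N \<ge> 0
    then smul (q powi (- 2 * n))
           (op_exp (\<lambda>r v. smul (- (q - inverse q)) (heis_minus r v)) (nat N)
             (Poly_Mapping.single (\<mu>, n) 1))
    else 0))"


section \<open>The tensor power and its current\<close>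

text \<open>
  The \<open>c = CARD('c)\<close> tensor factors are indexed by a finite linearly ordered type \<open>'c\<close>;
  every $c\ge1$ is the cardinality of such a type. The tensor power of \<open>fock vec\<close>
  is \<open>('c \<Rightarrow> fock) vec\<close>, the basis vector \<open>b\<close> being the tensor product of the basis vectors
  \<open>b i\<close>. Its product is that of the tensor power of the algebra \<open>fock vec\<close>; hence the tensor
  product of vectors \<open>v i\<close> is the product of the vectors \<open>embed i (v i)\<close>, where
  \<open>embed i v\<close> has \<open>v\<close> in position \<open>i\<close> and 1 elsewhere. Likewise for Laurent series.
\<close>

definition embed :: "'c \<Rightarrow> fock vec \<Rightarrow> ('c \<Rightarrow> fock) vec"
  where "embed i = lin_ext smul (\<lambda>k. Poly_Mapping.single ((\<lambda>_. 0)(i := k)) 1)"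

lift_definition embed_fls :: "'c \<Rightarrow> fock vec fls \<Rightarrow> ('c \<Rightarrow> fock) vec fls"
  is "\<lambda>i f n. embed i (f n)"
  by (erule eventually_mono) (simp add: embed_def lin_ext_def)

definition tensor_cur :: "('c::finite \<Rightarrow> fock cur) \<Rightarrow> ('c \<Rightarrow> fock) cur"
  where "tensor_cur A =
    lin_ext fls_smul (\<lambda>b. \<Prod>i\<in>UNIV. embed_fls i (A i (Poly_Mapping.single (b i) 1)))"

definition pos :: "'c::{finite, linorder} \<Rightarrow> nat"  \<comment> \<open>position, counted from zero\<close>
  where "pos i = card {j. j < i}"

definition x_cur :: "('c::{finite, linorder} \<Rightarrow> fock) cur"
  where "x_cur = (\<Sum>l\<in>UNIV. tensor_cur (\<lambda>i.
    if i < l then cur_dilate (qh ^ (2 * pos i + 1)) phi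
    else if i = l then cur_dilate (q ^ pos l) x_plus
    else fls_const))"


section \<open>The algebra and the monomials\<close>

definition V_c1 :: "('c::{finite, linorder} \<Rightarrow> fock) curt set"
  where "V_c1 = (LEAST V. q_vertex_algebra_of_currents V \<and> homog x_cur 1 \<in> V)"

definition x_m :: "nat \<Rightarrow> ('c::{finite, linorder} \<Rightarrow> fock) curt"
  where "x_m m = (curt_prod (-1) (homog x_cur 1) ^^ m) curt_one"

definition monomial :: "(nat \<times> int) list \<Rightarrow> ('c::{finite, linorder} \<Rightarrow> fock) curt"
  where "monomial ps = foldr (\<lambda>(m, r). curt_prod r (x_m m)) ps curt_one"

definition B_c1 :: "('c::{finite, linorder} \<Rightarrow> fock) curt set"
  where "B_c1 = {monomial ps | ps.
    (\<forall>j<length ps. 1 \<le> fst (ps ! j) \<and> fst (ps ! j) \<le> CARD('c)) \<and>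
    (\<forall>j<length ps. snd (ps ! j) \<le> (if Suc j < length ps then -2 else -1))}"

definition is_basis_of :: "(F \<Rightarrow> 'v::ab_group_add \<Rightarrow> 'v) \<Rightarrow> 'v set \<Rightarrow> 'v set \<Rightarrow> bool"
  where "is_basis_of scale B V \<longleftrightarrow> \<not> module.dependent scale B \<and> module.span scale B = V"

end

theory Submission
  imports Defs "HOL-Computational_Algebra.Polynomial_FPS" "HOL-Library.Multiset"
begin

text \<open>
  The current $x(z)$ is a sum of $c$ vertex operators, each a ring homomorphism of $L$ followed by
  multiplication by an exponential. The contraction of two of them is a rational function of
  $z_2/z_1$ whose denominator lies in $\mathbb F[z]_0$, so the products of
  $x(z\mathsf q^a)$ with increasing \<open>a\<close> can be regularized and are indexed by the multiset of these
  points \<open>a\<close>. Monomials in these points and in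
  $z^{\pm1}$ form a commutative ring with an automorphism and a twisted derivation (the
  $\mathsf q$-derivative); there the product $a_{-r-1}b$ is $\frac{a^{[r]}}{[r]_{\mathsf q}!}$ times
  a shift of $b$, and $\mathsf q$-associativity is the $\mathsf q$-Leibniz rule.

  Spanning: $\mathsf q$-associativity writes $(x_{m+1})_r$ through products of $x$ and $x_m$, which
  straightens every word in the modes of $x(z)\otimes t$; moreover $x_m=0$ for $m>c$, because
  $x(z)x(z\mathsf q)$ only involves summands with strictly decreasing indices.

  Independence: among the sets of points occurring in a monomial, the one with the smallest sum
  consists of blocks of $m_1,m_2,\dots$ consecutive points, whose gaps are given by the $r_j$, and it
  determines the monomial. Regularized products for different sets of points are linearly
  independent over $\mathbb F((z))$ when a nonvanishing choice of summands exists, since their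
  exponentials yield distinct characters (Dedekind). For blocks of length at most \<open>c\<close>, numbering the
  points of each block by decreasing indices is such a choice.
\<close>

text \<open>The obstacle is that products of currents exist only after regularization, and
  \<open>prod_hom\<close> picks the regularizing polynomial by choice, so neither closure nor
  bilinearity is available on all of \<open>currents_t\<close>. The weight in \<open>t\<close> cures
  this. An element of weight \<open>\<alpha>\<close> is built from points below
  \<open>\<alpha>\<close>, its \<open>r\<close>-th q-derivative from points below
  \<open>\<alpha> + r\<close>, and the second factor of the product is shifted by exactly
  \<open>\<alpha> + r\<close>; so the two factors occupy separated points. There contractions are
  regular: for points \<open>a < b\<close> with \<open>n = b - a\<close> and
  \<open>u = z_2/z_1\<close>, the only denominator is \<open>1 - Q^(n+1) u\<close>, whose root is
  not a nonnegative power of \<open>Q\<close>. The relations sit in the numerators: unless the index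
  of the summand drops from \<open>a\<close> to \<open>b\<close>, there is a factor
  \<open>1 - Q^(n-1) u\<close>, which vanishes at \<open>u = 1\<close> for neighbouring points. The
  same separation keeps the multisets of points in a monomial free of repetitions, as the
  independence argument requires.\<close>

unbundle fps_syntax
notation fls_nth (infixl "$$" 75)

section \<open>Vectors and Laurent series as rings\<close>

text \<open>Scalars become elements of the monoid algebra \<open>'k vec\<close>; scaling is then
  ring multiplication, and linear identities are settled by commutative ring rewriting.\<close>

definition cst :: "F \<Rightarrow> 'k::comm_monoid_add vec" where
  "cst c = Poly_Mapping.single 0 c"

lemma smul_cst: "smul c v = cst c * v"
  by (simp add: smul_def cst_def mult_map_scale_conv_mult)

lemma cst_0 [simp]: "cst 0 = 0" and cst_1 [simp]: "cst 1 = 1"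
  and cst_add: "cst (a + b) = cst a + cst b" and cst_mult: "cst (a * b) = cst a * cst b"
  and cst_diff: "cst (a - b) = cst a - cst b" and cst_uminus: "cst (- a) = - cst a"
  by (simp_all add: cst_def single_add mult_single single_diff single_uminus)

lemma fls_smul_cst: "fls_smul c f = fls_const (cst c) * f"
proof (rule fls_eqI)
  fix n
  show "fls_nth (fls_smul c f) n = fls_nth (fls_const (cst c) * f) n"
    by (simp add: fls_smul.rep_eq smul_cst)
qed

locale rhom =
  fixes h :: "'a::comm_ring_1 \<Rightarrow> 'b::comm_ring_1"
  assumes add: "h (x + y) = h x + h y"
    and mult: "h (x * y) = h x * h y"
    and one: "h 1 = 1"
begin

lemma zero: "h 0 = 0"
  using add[of 0 0] by simp

lemma uminus: "h (- x) = - h x"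
  using add[of x "- x"] zero by (simp add: minus_unique)

lemma diff: "h (x - y) = h x - h y"
  using add[of x "- y"] uminus by simp

lemma sum: "h (sum f A) = (\<Sum>x\<in>A. h (f x))"
  by (induction A rule: infinite_finite_induct) (simp_all add: zero add)

lemma prod: "h (prod f A) = (\<Prod>x\<in>A. h (f x))"
  by (induction A rule: infinite_finite_induct) (simp_all add: one mult)

lemma power: "h (x ^ n) = h x ^ n"
  by (induction n) (simp_all add: one mult)

lemma of_nat: "h (of_nat n) = of_nat n"
  by (induction n) (simp_all add: zero one add)

end

lemma rhom_cst: "rhom (cst :: F \<Rightarrow> 'k::comm_monoid_add vec)"
  by unfold_locales (simp_all add: cst_add cst_mult)

lemma rhom_fls_const: "rhom (fls_const :: 'a::comm_ring_1 \<Rightarrow> 'a fls)"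
  by unfold_locales (simp_all add: fls_plus_const)

lemma rhom_comp: "rhom f \<Longrightarrow> rhom g \<Longrightarrow> rhom (\<lambda>x. g (f x))"
  by (simp add: rhom_def)

text \<open>Arbitrary lower bounds replace the subdegrees, because a coefficientwise map can raise
  the subdegree of a factor.\<close>

lemma fls_times_nth_lower:
  fixes f g :: "'a::semiring_0 fls"
  assumes "\<And>i. i < M \<Longrightarrow> f $$ i = 0" and "\<And>j. j < N \<Longrightarrow> g $$ j = 0"
  shows "(f * g) $$ n = (\<Sum>i=M..n - N. f $$ i * g $$ (n - i))"
proof -
  define df where "df = fls_subdegree f"
  define dg where "dg = fls_subdegree g"
  define A where "A = {min df M..max (n - dg) (n - N)}"
  have *: "f $$ i * g $$ (n - i) = 0" if "i < df \<or> n - dg < i \<or> i < M \<or> n - N < i" for i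
    using that assms(1)[of i] assms(2)[of "n - i"] by (auto simp: df_def dg_def)
  have "(f * g) $$ n = (\<Sum>i=df..n - dg. f $$ i * g $$ (n - i))"
    by (simp add: fls_times_nth(2) df_def dg_def)
  also have "\<dots> = (\<Sum>i\<in>A. f $$ i * g $$ (n - i))"
    by (rule sum.mono_neutral_left) (auto simp: A_def not_le intro!: *)
  also have "\<dots> = (\<Sum>i=M..n - N. f $$ i * g $$ (n - i))"
    by (rule sum.mono_neutral_right) (auto simp: A_def not_le intro!: *)
  finally show ?thesis .
qed

section \<open>Coefficientwise maps and powers of the variable\<close>

definition fls_map :: "('a::zero \<Rightarrow> 'b::zero) \<Rightarrow> 'a fls \<Rightarrow> 'b fls" where
  "fls_map h f = Abs_fls (\<lambda>n. h (f $$ n))"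

lemma fls_map_nth: "h 0 = 0 \<Longrightarrow> fls_map h f $$ n = h (f $$ n)"
  unfolding fls_map_def
  by (rule nth_Abs_fls_lower_bound[where N = "fls_subdegree f"]) simp

lemma fls_map_add:
  assumes "\<And>x y. h (x + y) = h x + h y" "h 0 = 0"
  shows "fls_map h (f + g) = fls_map h f + fls_map h g"
  by (rule fls_eqI) (simp add: fls_map_nth assms)

lemma fls_map_const: "h 0 = 0 \<Longrightarrow> fls_map h (fls_const c) = fls_const (h c)"
  by (rule fls_eqI) (simp add: fls_map_nth)

lemma rhom_fls_map:
  assumes "rhom h"
  shows "rhom (fls_map h)"
proof -
  interpret rhom h by fact
  show ?thesis
  proof
    fix f g :: "'a fls"
    show "fls_map h (f + g) = fls_map h f + fls_map h g"
      by (rule fls_map_add) (simp_all add: add zero)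
    show "fls_map h 1 = 1"
      by (rule fls_eqI) (simp add: fls_map_nth zero one)
    show "fls_map h (f * g) = fls_map h f * fls_map h g"
    proof (rule fls_eqI)
      fix n
      have "fls_map h (f * g) $$ n = h (\<Sum>i=fls_subdegree f..n - fls_subdegree g. f $$ i * g $$ (n - i))"
        by (subst fls_times_nth_lower[symmetric]) (simp_all add: fls_map_nth zero)
      also have "\<dots> = (\<Sum>i=fls_subdegree f..n - fls_subdegree g. fls_map h f $$ i * fls_map h g $$ (n - i))"
        by (simp add: sum mult fls_map_nth zero)
      also have "\<dots> = (fls_map h f * fls_map h g) $$ n"
        by (rule fls_times_nth_lower[symmetric]) (simp_all add: fls_map_nth zero)
      finally show "fls_map h (f * g) $$ n = (fls_map h f * fls_map h g) $$ n" .
    qed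
  qed
qed

abbreviation Zp :: "int \<Rightarrow> 'a::comm_ring_1 fls" where
  "Zp n \<equiv> fls_X_intpow n"

lemma Zp_add: "Zp (m + n) = (Zp m * Zp n :: 'a::comm_ring_1 fls)"
  by (simp add: fls_X_intpow_times_fls_X_intpow)

lemma Zp_times_nth: "(Zp k * f) $$ n = f $$ (n - k)" for f :: "'a::comm_ring_1 fls"
  by (simp add: fls_X_intpow_times_conv_shift)

lemma fls_map_Zp: "rhom h \<Longrightarrow> fls_map h (Zp n) = Zp n"
  by (rule fls_eqI) (simp add: fls_map_nth rhom.zero rhom.one)

section \<open>Series in two variables\<close>

text \<open>
  An element of \<open>'a fls fls\<close> is read as a series whose outer variable is $z_2$ and whose inner
  variable is $z_1$.
\<close>

definition bdd2 :: "'a::zero fls fls set" where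
  "bdd2 = {f. \<exists>N. \<forall>i j. i < N \<or> j < N \<longrightarrow> f $$ j $$ i = 0}"

definition diag2 :: "'a::comm_ring_1 fls fls \<Rightarrow> 'a fls" where
  "diag2 f = Abs_fls (\<lambda>n. Sum_any (\<lambda>i. f $$ (n - i) $$ i))"

lemma bdd2I: "(\<And>i j. i < N \<or> j < N \<Longrightarrow> f $$ j $$ i = 0) \<Longrightarrow> f \<in> bdd2"
  by (auto simp: bdd2_def)

lemma bdd2E:
  assumes "f \<in> bdd2"
  obtains N where "\<And>i j. i < N \<Longrightarrow> f $$ j $$ i = 0" "\<And>i j. j < N \<Longrightarrow> f $$ j $$ i = 0"
  using assms by (auto simp: bdd2_def)

lemma bdd2_0 [simp]: "0 \<in> bdd2"
  by (auto simp: bdd2_def)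

lemma bdd2_add:
  fixes f g :: "'a::comm_ring_1 fls fls"
  assumes "f \<in> bdd2" "g \<in> bdd2" shows "f + g \<in> bdd2"
proof -
  obtain M where M: "\<And>i j. i < M \<Longrightarrow> f $$ j $$ i = 0" "\<And>i j. j < M \<Longrightarrow> f $$ j $$ i = 0"
    using assms(1) by (rule bdd2E) blast
  obtain N where N: "\<And>i j. i < N \<Longrightarrow> g $$ j $$ i = 0" "\<And>i j. j < N \<Longrightarrow> g $$ j $$ i = 0"
    using assms(2) by (rule bdd2E) blast
  show ?thesis
    by (rule bdd2I[where N = "min M N"]) (auto simp: M N)
qed

lemma bdd2_sum: "(\<And>x. x \<in> A \<Longrightarrow> f x \<in> bdd2) \<Longrightarrow> sum f A \<in> (bdd2 :: 'a::comm_ring_1 fls fls set)"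
  by (induction A rule: infinite_finite_induct) (auto intro: bdd2_add)

lemma bdd2_mult_nth:
  fixes f g :: "'a::comm_ring_1 fls fls"
  assumes M: "\<And>i j. i < M \<Longrightarrow> f $$ j $$ i = 0" "\<And>i j. j < M \<Longrightarrow> f $$ j $$ i = 0"
    and N: "\<And>i j. i < N \<Longrightarrow> g $$ j $$ i = 0" "\<And>i j. j < N \<Longrightarrow> g $$ j $$ i = 0"
  shows "(f * g) $$ j $$ i =
    (\<Sum>k=M..j - N. \<Sum>l=M..i - N. f $$ k $$ l * g $$ (j - k) $$ (i - l))"
proof -
  have "(f * g) $$ j = (\<Sum>k=M..j - N. f $$ k * g $$ (j - k))"
    by (rule fls_times_nth_lower) (auto intro!: fls_eqI simp: M N)
  moreover have "(f $$ k * g $$ (j - k)) $$ i =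
      (\<Sum>l=M..i - N. f $$ k $$ l * g $$ (j - k) $$ (i - l))" for k
    by (rule fls_times_nth_lower) (auto simp: M N)
  ultimately show ?thesis
    by (simp add: fls_nth_sum)
qed

lemma bdd2_mult:
  fixes f g :: "'a::comm_ring_1 fls fls"
  assumes "f \<in> bdd2" "g \<in> bdd2" shows "f * g \<in> bdd2"
proof -
  obtain M where M: "\<And>i j. i < M \<Longrightarrow> f $$ j $$ i = 0" "\<And>i j. j < M \<Longrightarrow> f $$ j $$ i = 0"
    using assms(1) by (rule bdd2E) blast
  obtain N where N: "\<And>i j. i < N \<Longrightarrow> g $$ j $$ i = 0" "\<And>i j. j < N \<Longrightarrow> g $$ j $$ i = 0"
    using assms(2) by (rule bdd2E) blast
  show ?thesis
    by (rule bdd2I[where N = "M + N"]) (auto simp: bdd2_mult_nth[OF M N])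
qed

lemma bdd2_prod: "(\<And>x. x \<in> A \<Longrightarrow> f x \<in> bdd2) \<Longrightarrow> prod f A \<in> (bdd2 :: 'a::comm_ring_1 fls fls set)"
proof (induction A rule: infinite_finite_induct)
  case empty
  show ?case by (auto intro!: bdd2I[where N = 0])
next
  case infinite
  show ?case by (simp add: infinite) (auto intro!: bdd2I[where N = 0])
qed (auto intro: bdd2_mult)

lemma bdd2_power: "f \<in> bdd2 \<Longrightarrow> f ^ n \<in> (bdd2 :: 'a::comm_ring_1 fls fls set)"
  using bdd2_prod[of "{..<n}" "\<lambda>_. f"] by simp

text \<open>\<open>fls_const f\<close> is the series \<open>f(z_1)\<close> in the inner variable,
  \<open>fls_map fls_const f\<close> the series \<open>f(z_2)\<close> in the outer one.\<close>

lemma bdd2_const: "fls_const f \<in> (bdd2 :: 'a::comm_ring_1 fls fls set)"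
  by (rule bdd2I[where N = "min 0 (fls_subdegree f)"]) auto

lemma bdd2_iota: "fls_map fls_const f \<in> (bdd2 :: 'a::comm_ring_1 fls fls set)"
  by (rule bdd2I[where N = "min 0 (fls_subdegree f)"]) (auto simp: fls_map_nth)

text \<open>A uniform lower bound \<open>M\<close> on both exponents confines the terms of total
  exponent \<open>n\<close> to a finite range; the type \<open>'a fls fls\<close> alone bounds the
  inner exponent only separately for each outer one.\<close>

lemma diag2_nth:
  fixes f :: "'a::comm_ring_1 fls fls"
  assumes M: "\<And>i j. i < M \<Longrightarrow> f $$ j $$ i = 0" "\<And>i j. j < M \<Longrightarrow> f $$ j $$ i = 0"
  shows "diag2 f $$ n = (\<Sum>i=M..n - M. f $$ (n - i) $$ i)"
proof -
  have *: "Sum_any (\<lambda>i. f $$ (n - i) $$ i) = (\<Sum>i=M..n - M. f $$ (n - i) $$ i)" for n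
  proof (rule Sum_any.expand_superset)
    show "{i. f $$ (n - i) $$ i \<noteq> 0} \<subseteq> {M..n - M}"
    proof
      fix i assume "i \<in> {i. f $$ (n - i) $$ i \<noteq> 0}"
      then have "\<not> i < M" "\<not> n - i < M" using M by auto
      then show "i \<in> {M..n - M}" by simp
    qed
  qed simp
  show ?thesis
    unfolding diag2_def * by (rule nth_Abs_fls_lower_bound[where N = "2 * M"]) auto
qed

lemma diag2_0 [simp]: "diag2 0 = 0"
  by (rule fls_eqI) (simp add: diag2_nth[of 0])

lemma diag2_add:
  fixes f g :: "'a::comm_ring_1 fls fls"
  assumes "f \<in> bdd2" "g \<in> bdd2" shows "diag2 (f + g) = diag2 f + diag2 g"
proof -
  obtain M where M: "\<And>i j. i < M \<Longrightarrow> f $$ j $$ i = 0" "\<And>i j. j < M \<Longrightarrow> f $$ j $$ i = 0"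
    using assms(1) by (rule bdd2E) blast
  obtain N where N: "\<And>i j. i < N \<Longrightarrow> g $$ j $$ i = 0" "\<And>i j. j < N \<Longrightarrow> g $$ j $$ i = 0"
    using assms(2) by (rule bdd2E) blast
  define K where "K = min M N"
  have "diag2 (f + g) $$ n = (diag2 f + diag2 g) $$ n" for n
    by (subst diag2_nth[of K], auto simp: K_def M N, subst diag2_nth[of K], auto simp: K_def M N,
        subst diag2_nth[of K], auto simp: K_def M N sum.distrib)
  then show ?thesis by (rule fls_eqI)
qed

lemma diag2_sum:
  "(\<And>x. x \<in> A \<Longrightarrow> f x \<in> bdd2) \<Longrightarrow> diag2 (sum f A) = (\<Sum>x\<in>A. diag2 (f x :: 'a::comm_ring_1 fls fls))"
  by (induction A rule: infinite_finite_induct) (auto simp: diag2_add bdd2_sum)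

lemma diag2_mult:
  fixes f g :: "'a::comm_ring_1 fls fls"
  assumes "f \<in> bdd2" "g \<in> bdd2" shows "diag2 (f * g) = diag2 f * diag2 g"
proof -
  obtain M where M: "\<And>i j. i < M \<Longrightarrow> f $$ j $$ i = 0" "\<And>i j. j < M \<Longrightarrow> f $$ j $$ i = 0"
    using assms(1) by (rule bdd2E) blast
  obtain N where N: "\<And>i j. i < N \<Longrightarrow> g $$ j $$ i = 0" "\<And>i j. j < N \<Longrightarrow> g $$ j $$ i = 0"
    using assms(2) by (rule bdd2E) blast
  have fg: "i < M + N \<or> j < M + N \<Longrightarrow> (f * g) $$ j $$ i = 0" for i j
    by (auto simp: bdd2_mult_nth[OF M N])
  have f0: "k < 2 * M \<Longrightarrow> diag2 f $$ k = 0" for k by (simp add: diag2_nth[OF M])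
  have g0: "k < 2 * N \<Longrightarrow> diag2 g $$ k = 0" for k by (simp add: diag2_nth[OF N])
  have "diag2 (f * g) $$ n = (diag2 f * diag2 g) $$ n" for n
  proof -
    have "diag2 (f * g) $$ n = (\<Sum>i=M+N..n-(M+N). \<Sum>k=M..n-i-N. \<Sum>l=M..i-N.
        f $$ k $$ l * g $$ (n - i - k) $$ (i - l))"
      by (subst diag2_nth[of "M + N"]) (simp_all add: fg bdd2_mult_nth[OF M N])
    also have "\<dots> = (\<Sum>(i,k,l)\<in>Sigma {M+N..n-(M+N)} (\<lambda>i. {M..n-i-N} \<times> {M..i-N}).
        f $$ k $$ l * g $$ (n - i - k) $$ (i - l))"
      by (subst sum.Sigma[symmetric]) (auto simp: sum.Sigma[symmetric])
    \<comment> \<open>New indices: \<open>a\<close> is the total exponent of the term of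
      \<open>f\<close>, while \<open>l\<close> and \<open>i2\<close> are the inner exponents of the
      terms of \<open>f\<close> and \<open>g\<close>.\<close>
    also have "\<dots> = (\<Sum>(a,l,i2)\<in>Sigma {2*M..n-2*N} (\<lambda>a. {M..a-M} \<times> {N..n-a-N}).
        f $$ (a - l) $$ l * g $$ (n - a - i2) $$ i2)"
      by (rule sum.reindex_bij_witness[where i = "\<lambda>(a,l,i2). (l + i2, a - l, l)" and j = "\<lambda>(i,k,l). (k + l, l, i - l)"])
        (auto simp: algebra_simps)
    also have "\<dots> = (\<Sum>a=2*M..n-2*N. (\<Sum>l=M..a-M. f $$ (a - l) $$ l) * (\<Sum>i=N..n-a-N. g $$ (n - a - i) $$ i))"
      by (subst sum.Sigma[symmetric]) (auto simp: sum.Sigma[symmetric] sum_product)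
    also have "\<dots> = (\<Sum>a=2*M..n-2*N. diag2 f $$ a * diag2 g $$ (n - a))"
      by (simp add: diag2_nth[OF M] diag2_nth[OF N])
    also have "\<dots> = (diag2 f * diag2 g) $$ n"
      by (rule fls_times_nth_lower[symmetric]) (simp_all add: f0 g0)
    finally show ?thesis .
  qed
  then show ?thesis by (rule fls_eqI)
qed

lemma diag2_const [simp]: "diag2 (fls_const f) = (f :: 'a::comm_ring_1 fls)"
proof (rule fls_eqI)
  fix n
  define N where "N = min (min 0 (fls_subdegree f)) n"
  have *: "fls_const f $$ (n - i) $$ i = (if i = n then f $$ n else 0)" for i
    by auto
  have "diag2 (fls_const f) $$ n = (\<Sum>i=N..n - N. if i = n then f $$ n else 0)"
    by (subst diag2_nth[of N]) (auto simp: N_def *[symmetric])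
  then show "diag2 (fls_const f) $$ n = f $$ n"
    by (auto simp: N_def)
qed

lemma diag2_iota [simp]: "diag2 (fls_map fls_const f) = (f :: 'a::comm_ring_1 fls)"
proof (rule fls_eqI)
  fix n
  define N where "N = min (min 0 (fls_subdegree f)) n"
  have "diag2 (fls_map fls_const f) $$ n = (\<Sum>i=N..n - N. if i = 0 then f $$ n else 0)"
    by (subst diag2_nth[of N]) (auto simp: N_def fls_map_nth intro!: sum.cong)
  then show "diag2 (fls_map fls_const f) $$ n = f $$ n"
    by (auto simp: N_def)
qed

lemma diag2_prod:
  "(\<And>x. x \<in> A \<Longrightarrow> f x \<in> bdd2) \<Longrightarrow> diag2 (prod f A) = (\<Prod>x\<in>A. diag2 (f x :: 'a::comm_ring_1 fls fls))"
proof (induction A rule: infinite_finite_induct)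
  case empty
  show ?case using diag2_const[of 1] by simp
next
  case infinite
  then show ?case using diag2_const[of 1] by simp
qed (auto simp: diag2_mult bdd2_prod)

lemma diag2_power: "f \<in> bdd2 \<Longrightarrow> diag2 (f ^ n) = (diag2 f :: 'a::comm_ring_1 fls) ^ n"
  using diag2_prod[of "{..<n}" "\<lambda>_. f"] by simp

section \<open>Regularized products of currents\<close>

lemma currents_iff:
  "a \<in> currents \<longleftrightarrow> (\<forall>x y. a (x + y) = a x + a y) \<and> (\<forall>c x. a (smul c x) = fls_smul c (a x))"
  by (simp add: currents_def Vector_Spaces.linear_iff vector_space_smul vector_space_fls_smul)

lemma currentsD:
  assumes "a \<in> currents"
  shows "a (x + y) = a x + a y" "a (smul c x) = fls_smul c (a x)" "a 0 = 0"
    "a (sum f A) = (\<Sum>i\<in>A. a (f i))"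
proof -
  show add: "a (x + y) = a x + a y" for x y using assms by (simp add: currents_iff)
  show "a (smul c x) = fls_smul c (a x)" using assms by (simp add: currents_iff)
  show zero: "a 0 = 0" using add[of 0 0] by simp
  show "a (sum f A) = (\<Sum>i\<in>A. a (f i))"
    by (induction A rule: infinite_finite_induct) (simp_all add: zero add)
qed

lemma currents_0 [simp]: "0 \<in> currents"
  by (simp add: currents_iff fls_eq_iff fls_smul.rep_eq)

lemma currents_add: "a \<in> currents \<Longrightarrow> b \<in> currents \<Longrightarrow> a + b \<in> currents"
proof -
  interpret vector_space "fls_smul :: F \<Rightarrow> 'a vec fls \<Rightarrow> 'a vec fls"
    by (rule vector_space_fls_smul)
  show "a \<in> currents \<Longrightarrow> b \<in> currents \<Longrightarrow> a + b \<in> currents" for a b :: "'a cur"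
    by (auto simp: currents_iff scale_right_distrib)
qed

lemma currents_smul: "a \<in> currents \<Longrightarrow> cur_smul c a \<in> currents"
proof -
  interpret vector_space "fls_smul :: F \<Rightarrow> 'a vec fls \<Rightarrow> 'a vec fls"
    by (rule vector_space_fls_smul)
  show "a \<in> currents \<Longrightarrow> cur_smul c a \<in> currents" for a :: "'a cur"
    by (auto simp: currents_iff cur_smul_def scale_right_distrib mult.commute)
qed

lemma currents_sum: "(\<And>i. i \<in> A \<Longrightarrow> f i \<in> currents) \<Longrightarrow> sum f A \<in> currents"
  by (induction A rule: infinite_finite_induct) (simp_all add: currents_add)

definition cur_shift :: "int \<Rightarrow> 'k cur \<Rightarrow> 'k cur" where
  "cur_shift k a = (\<lambda>v. fls_shift (- k) (a v))"

lemma cur_shift_eq: "cur_shift k a v = Zp k * a v"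
  by (simp add: cur_shift_def fls_X_intpow_times_conv_shift)

lemma currents_shift: "a \<in> currents \<Longrightarrow> cur_shift k a \<in> currents"
  by (auto simp: currents_iff cur_shift_def fls_eq_iff fls_smul.rep_eq)

section \<open>Products of two currents as iterated Laurent series\<close>

definition cur2 :: "'k cur \<Rightarrow> 'k cur \<Rightarrow> 'k vec \<Rightarrow> 'k vec fls fls" where
  "cur2 a b v = fls_map a (b v)"

lemma cur2_nth: "a \<in> currents \<Longrightarrow> cur2 a b v $$ j = a (b v $$ j)"
  by (simp add: cur2_def fls_map_nth currentsD)

lemma cur2_nth_nth: "a \<in> currents \<Longrightarrow> cur2 a b v $$ j $$ i = cur_prod a b v i j"
  by (simp add: cur2_nth cur_prod_def)

definition quot_fps :: "F fps \<Rightarrow> 'k::comm_monoid_add vec fls fls"  \<comment> \<open>$\gamma(z_2/z_1)$\<close>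
  where "quot_fps g = fps_to_fls (Abs_fps (\<lambda>j. Zp (- int j) * fls_const (cst (g $ j))))"

lemma rhom_quot_fps: "rhom (quot_fps :: F fps \<Rightarrow> 'k::comm_monoid_add vec fls fls)"
proof
  fix f g :: "F fps"
  show "(quot_fps (f + g) :: 'k vec fls fls) = quot_fps f + quot_fps g"
    unfolding quot_fps_def fps_to_fls_plus[symmetric]
    by (rule arg_cong[where f = fps_to_fls]) (simp add: fps_eq_iff cst_add fls_plus_const[symmetric] algebra_simps)
  show "(quot_fps 1 :: 'k vec fls fls) = 1"
    unfolding quot_fps_def fps_one_to_fls[symmetric]
    by (rule arg_cong[where f = fps_to_fls]) (auto simp: fps_eq_iff)
  have *: "(Zp (- int n) * fls_const (cst ((f * g) $ n)) :: 'k vec fls) =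
     (\<Sum>i=0..n. (Zp (- int i) * fls_const (cst (f $ i))) *
       (Zp (- int (n - i)) * fls_const (cst (g $ (n - i)))))" for n
  proof -
    interpret rhom "\<lambda>c. fls_const (cst c :: 'k vec)"
      by (rule rhom_comp[OF rhom_cst rhom_fls_const])
    have "(Zp (- int i) * fls_const (cst (f $ i))) * (Zp (- int (n - i)) * fls_const (cst (g $ (n - i))))
       = (Zp (- int n) * fls_const (cst (f $ i * g $ (n - i))) :: 'k vec fls)" if "i \<le> n" for i
    proof -
      have "Zp (- int n) = (Zp (- int i) * Zp (- int (n - i)) :: 'k vec fls)"
        using that by (subst Zp_add[symmetric]) (simp add: of_nat_diff)
      then show ?thesis by (simp only: mult mult_ac)
    qed
    then show ?thesis
      unfolding fps_mult_nth sum sum_distrib_left by (intro sum.cong) auto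
  qed
  show "(quot_fps (f * g) :: 'k vec fls fls) = quot_fps f * quot_fps g"
    unfolding quot_fps_def fls_times_fps_to_fls[symmetric]
    by (rule arg_cong[where f = fps_to_fls], rule fps_ext) (simp only: fps_mult_nth[of "Abs_fps _"] fps_nth_Abs_fps *)
qed

definition quot_poly :: "F poly \<Rightarrow> 'k::comm_monoid_add vec fls fls" where
  "quot_poly p = quot_fps (fps_of_poly p)"

lemma quot_poly_mult: "quot_poly (p * p') = quot_poly p * quot_poly p'"
  by (simp add: quot_poly_def fps_of_poly_mult rhom.mult[OF rhom_quot_fps])

lemma quot_poly_sum:
  "(quot_poly p :: 'k::comm_monoid_add vec fls fls) =
    (\<Sum>k\<le>degree p. Zp (int k) * fls_const (Zp (- int k) * fls_const (cst (coeff p k))))"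
proof (rule fls_eqI)
  fix n
  have "(\<Sum>k\<le>degree p. Zp (int k) * fls_const (Zp (- int k) * fls_const (cst (coeff p k) :: 'k vec))) $$ n
     = (\<Sum>k\<le>degree p. if n = int k then Zp (- n) * fls_const (cst (coeff p k)) else 0)"
    unfolding fls_nth_sum Zp_times_nth by (intro sum.cong) auto
  also have "\<dots> = quot_poly p $$ n"
  proof (cases "n < 0")
    case True
    then show ?thesis by (auto simp: quot_poly_def quot_fps_def intro!: sum.neutral)
  next
    case False
    then have "(\<Sum>k\<le>degree p. if n = int k then Zp (- n) * fls_const (cst (coeff p k) :: 'k vec) else 0) =
      (\<Sum>k\<le>degree p. if nat n = k then Zp (- n) * fls_const (cst (coeff p k)) else 0)"
      by (intro sum.cong) auto
    with False show ?thesis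
      by (auto simp: quot_poly_def quot_fps_def not_le coeff_eq_0)
  qed
  finally show "quot_poly p $$ n = (\<Sum>k\<le>degree p. Zp (int k) * fls_const (Zp (- int k) * fls_const (cst (coeff p k) :: 'k vec))) $$ n" ..
qed

lemma fls_const_times_nth: "(fls_const c * f) $$ n = c * f $$ n" for f :: "'a::comm_ring_1 fls"
  by simp

lemma quot_poly_times_nth:
  "(quot_poly p * f) $$ j $$ i =
    (\<Sum>k\<le>degree p. cst (coeff p k) * f $$ (j - int k) $$ (i + int k))"
  unfolding quot_poly_sum sum_distrib_right fls_nth_sum
  by (simp only: mult.assoc Zp_times_nth fls_const_times_nth fls_nth_sum)
     (simp add: algebra_simps)

lemma poly_mult_cur_prod:
  "a \<in> currents \<Longrightarrow> poly_mult p (cur_prod a b) v i j = (quot_poly p * cur2 a b v) $$ j $$ i"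
  by (simp add: poly_mult_def quot_poly_times_nth cur2_nth_nth smul_cst)

lemma quot_poly_bdd2 [simp]: "quot_poly p \<in> bdd2"
  by (rule bdd2I[where N = "- int (degree p)"]) (auto simp: quot_poly_def quot_fps_def Zp_times_nth coeff_eq_0)

lemma diag2_quot_poly [simp]: "diag2 (quot_poly p) = fls_const (cst (poly p 1))"
proof -
  have 1: "Zp (int k) \<in> bdd2" for k
    by (rule bdd2I[where N = 0]) auto
  have "diag2 (Zp (int k) * fls_const (Zp (- int k) * fls_const c)) = fls_const c" for k and c :: "'a vec"
  proof -
    have "Zp (int k) = fls_map fls_const (Zp (int k) :: 'a vec fls)"
      by (rule fls_eqI) (simp add: fls_map_nth)
    then have "diag2 (Zp (int k) :: 'a vec fls fls) = Zp (int k)"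
      by (metis diag2_iota)
    then have "diag2 (Zp (int k) * fls_const (Zp (- int k) * fls_const c)) =
        Zp (int k) * (Zp (- int k) * fls_const c)"
      by (subst diag2_mult) (simp_all add: 1 bdd2_const)
    also have "\<dots> = fls_const c"
      by (simp only: mult.assoc[symmetric] Zp_add[symmetric]) simp
    finally show ?thesis .
  qed
  then show ?thesis
    by (simp add: quot_poly_sum diag2_sum bdd2_mult 1 bdd2_const poly_altdef rhom.sum[OF rhom_comp[OF rhom_cst rhom_fls_const]])
qed

lemma quot_bdd2:
  assumes "a \<in> currents" "b \<in> currents"
  shows "poly_mult p (cur_prod a b) \<in> currents2 \<longleftrightarrow> (\<forall>v. quot_poly p * cur2 a b v \<in> bdd2)"
proof -
  interpret vector_space "smul :: F \<Rightarrow> 'a vec \<Rightarrow> 'a vec" by (rule vector_space_smul)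
  have "Vector_Spaces.linear smul smul (\<lambda>v. poly_mult p (cur_prod a b) v i j)" for i j
    using assms
    by (auto simp: Vector_Spaces.linear_iff vector_space_smul poly_mult_def cur_prod_def currentsD
        fls_smul.rep_eq sum.distrib scale_sum_right scale_right_distrib mult.commute)
  then show ?thesis
    by (simp add: currents2_def bdd2_def poly_mult_cur_prod assms(1))
qed

lemma diag_poly_mult:
  "a \<in> currents \<Longrightarrow> diag (poly_mult p (cur_prod a b)) v = diag2 (quot_poly p * cur2 a b v)"
  by (simp add: diag_def diag2_def poly_mult_cur_prod)

text \<open>A relation that exhibits one regularizing polynomial together with the limit
  \<open>d\<close>, whereas \<open>prod_hom\<close> takes an unspecified polynomial;
  \<open>reg_prod_quasi_comm\<close> shows that the limits agree.\<close>

definition reg_prod :: "'k::comm_monoid_add cur \<Rightarrow> 'k cur \<Rightarrow> 'k cur \<Rightarrow> bool" where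
  "reg_prod a b d \<longleftrightarrow> a \<in> currents \<and> b \<in> currents \<and>
    (\<exists>p\<in>polys0. \<forall>v. quot_poly p * cur2 a b v \<in> bdd2 \<and> diag2 (quot_poly p * cur2 a b v) = d v)"

lemma reg_prodI:
  assumes "a \<in> currents" "b \<in> currents" "p \<in> polys0"
    and "\<And>v. quot_poly p * cur2 a b v \<in> bdd2" "\<And>v. diag2 (quot_poly p * cur2 a b v) = d v"
  shows "reg_prod a b d"
  using assms by (auto simp: reg_prod_def)

lemma reg_prodE:
  assumes "reg_prod a b d"
  obtains p where "p \<in> polys0" "\<And>v. quot_poly p * cur2 a b v \<in> bdd2"
    "\<And>v. diag2 (quot_poly p * cur2 a b v) = d v" "a \<in> currents" "b \<in> currents"
  using assms by (auto simp: reg_prod_def)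

lemma polys0_mult: "p \<in> polys0 \<Longrightarrow> p' \<in> polys0 \<Longrightarrow> p * p' \<in> polys0"
  by (simp add: polys0_def)

lemma polys0_1 [simp]: "1 \<in> polys0"
  by (simp add: polys0_def)

text \<open>
  Multiplying a regularization of a product by another element of $\mathbb F[z]_0$ does not change
  the limit, as the latter takes the value 1 at 1.
\<close>

lemma quot_poly_extra:
  assumes "p' \<in> polys0" "quot_poly p * f \<in> bdd2"
  shows "quot_poly (p' * p) * f \<in> bdd2" "diag2 (quot_poly (p' * p) * f) = diag2 (quot_poly p * f)"
  using assms by (simp_all add: quot_poly_mult mult.assoc bdd2_mult diag2_mult polys0_def)

text \<open>Both regularizations are compared with the one by \<open>p' * p\<close>: by
  \<open>quot_poly_extra\<close> neither limit changes when the other polynomial is multiplied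
  in.\<close>

lemma reg_prod_quasi_comm:
  assumes "reg_prod a b d" and "p \<in> polys0" and "poly_mult p (cur_prod a b) \<in> currents2"
  shows "diag (poly_mult p (cur_prod a b)) = d"
proof
  fix v
  obtain p' where p': "p' \<in> polys0" "\<And>v. quot_poly p' * cur2 a b v \<in> bdd2"
    "\<And>v. diag2 (quot_poly p' * cur2 a b v) = d v" "a \<in> currents" "b \<in> currents"
    using assms(1) by (rule reg_prodE) blast
  have *: "quot_poly p * cur2 a b v \<in> bdd2"
    using assms(3) p' quot_bdd2 by blast
  have "diag (poly_mult p (cur_prod a b)) v = diag2 (quot_poly p * cur2 a b v)"
    by (rule diag_poly_mult) fact
  also have "\<dots> = diag2 (quot_poly (p' * p) * cur2 a b v)"
    using quot_poly_extra(2)[OF p'(1) *] by simp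
  also have "\<dots> = d v"
    using quot_poly_extra(2)[OF assms(2) p'(2)] p'(3) by (simp add: mult.commute)
  finally show "diag (poly_mult p (cur_prod a b)) v = d v" .
qed

lemma reg_prod_imp_quasi_comm:
  assumes "reg_prod a b d"
  shows "\<exists>p\<in>polys0. poly_mult p (cur_prod a b) \<in> currents2"
  using assms quot_bdd2 unfolding reg_prod_def by blast

lemma prod_hom_eq:
  assumes "reg_prod ((cur_qderiv ^^ r) a) (cur_dilate (Q ^ (\<alpha> + r)) b) d"
  shows "prod_hom r a \<alpha> b = cur_smul (inverse (Qfact r)) d"
proof -
  define A where "A = cur_prod ((cur_qderiv ^^ r) a) (cur_dilate (Q ^ (\<alpha> + r)) b)"
  define p where "p = (SOME p. p \<in> polys0 \<and> poly_mult p A \<in> currents2)"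
  have "p \<in> polys0 \<and> poly_mult p A \<in> currents2"
    unfolding p_def by (rule someI_ex) (use reg_prod_imp_quasi_comm[OF assms] in \<open>auto simp: A_def\<close>)
  then have "diag (poly_mult p A) = d"
    using reg_prod_quasi_comm[OF assms] by (simp add: A_def)
  then show ?thesis
    by (simp add: prod_hom_def A_def p_def)
qed

text \<open>The two summands may come with different polynomials; the product of these regularizes
  both.\<close>

lemma reg_prod_add_left:
  assumes "reg_prod a b d" "reg_prod a' b d'"
  shows "reg_prod (a + a') b (d + d')"
proof -
  obtain p where p: "p \<in> polys0" "\<And>v. quot_poly p * cur2 a b v \<in> bdd2"
    "\<And>v. diag2 (quot_poly p * cur2 a b v) = d v" "a \<in> currents" "b \<in> currents"
    using assms(1) by (rule reg_prodE) blast
  obtain p' where p': "p' \<in> polys0" "\<And>v. quot_poly p' * cur2 a' b v \<in> bdd2"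
    "\<And>v. diag2 (quot_poly p' * cur2 a' b v) = d' v" "a' \<in> currents" "b \<in> currents"
    using assms(2) by (rule reg_prodE) blast
  have *: "cur2 (a + a') b v = cur2 a b v + cur2 a' b v" for v
    by (rule fls_eqI) (simp add: cur2_nth p p' currents_add)
  note e = quot_poly_extra[OF p'(1) p(2)] quot_poly_extra[OF p(1) p'(2), unfolded mult.commute[of p p']]
  show ?thesis
    by (rule reg_prodI[where p = "p' * p"])
      (simp_all add: currents_add p p' polys0_mult * distrib_left e bdd2_add diag2_add)
qed

lemma reg_prod_add_right:
  assumes "reg_prod a b d" "reg_prod a b' d'"
  shows "reg_prod a (b + b') (d + d')"
proof -
  obtain p where p: "p \<in> polys0" "\<And>v. quot_poly p * cur2 a b v \<in> bdd2"
    "\<And>v. diag2 (quot_poly p * cur2 a b v) = d v" "a \<in> currents" "b \<in> currents"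
    using assms(1) by (rule reg_prodE) blast
  obtain p' where p': "p' \<in> polys0" "\<And>v. quot_poly p' * cur2 a b' v \<in> bdd2"
    "\<And>v. diag2 (quot_poly p' * cur2 a b' v) = d' v" "a \<in> currents" "b' \<in> currents"
    using assms(2) by (rule reg_prodE) blast
  have *: "cur2 a (b + b') v = cur2 a b v + cur2 a b' v" for v
    by (rule fls_eqI) (simp add: cur2_nth p p' currentsD)
  note e = quot_poly_extra[OF p'(1) p(2)] quot_poly_extra[OF p(1) p'(2), unfolded mult.commute[of p p']]
  show ?thesis
    by (rule reg_prodI[where p = "p' * p"])
      (simp_all add: currents_add p p' polys0_mult * distrib_left e bdd2_add diag2_add)
qed

text \<open>The scalars and the powers of \<open>z_1\<close> and \<open>z_2\<close> collect in one
  bounded series \<open>g\<close>, and multiplicativity of \<open>diag2\<close> reduces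
  \<open>g\<close> to its diagonal.\<close>

lemma reg_prod_scale:
  assumes "reg_prod a b d"
  shows "reg_prod (cur_smul x (cur_shift k a)) (cur_smul y (cur_shift m b)) (cur_smul (x * y) (cur_shift (k + m) d))"
proof -
  obtain p where p: "p \<in> polys0" "\<And>v. quot_poly p * cur2 a b v \<in> bdd2"
    "\<And>v. diag2 (quot_poly p * cur2 a b v) = d v" "a \<in> currents" "b \<in> currents"
    using assms by (rule reg_prodE) blast
  define g :: "'a vec fls fls" where "g = fls_const (fls_const (cst x) * Zp k) * fls_map fls_const (fls_const (cst y) * Zp m)"
  have g: "g \<in> bdd2"
    unfolding g_def by (intro bdd2_mult bdd2_const bdd2_iota)
  have "diag2 g = (fls_const (cst x) * Zp k) * (fls_const (cst y) * Zp m)"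
    unfolding g_def by (subst diag2_mult[OF bdd2_const bdd2_iota]) (simp only: diag2_const diag2_iota)
  then have g': "diag2 g = fls_const (cst (x * y)) * Zp (k + m)"
    by (simp only: Zp_add cst_mult rhom.mult[OF rhom_fls_const] mult_ac)
  have "cur2 (cur_smul x (cur_shift k a)) (cur_smul y (cur_shift m b)) v = g * cur2 a b v" for v
  proof -
    have 1: "g = fls_const (fls_const (cst x) * Zp k) * (fls_const (fls_const (cst y)) * Zp m)"
      by (simp add: g_def rhom.mult[OF rhom_fls_map[OF rhom_fls_const]] fls_map_const
         fls_map_Zp[OF rhom_fls_const])
    have ca: "cur_smul x (cur_shift k a) \<in> currents" by (intro currents_smul currents_shift p)
    show ?thesis
    proof (rule fls_eqI)
      fix n
      have "cur2 (cur_smul x (cur_shift k a)) (cur_smul y (cur_shift m b)) v $$ n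
        = fls_const (cst x) * (Zp k * a (cst y * (b v $$ (n - m))))"
        unfolding cur2_nth[OF ca]
        by (simp only: cur_smul_def cur_shift_eq fls_smul_cst fls_const_times_nth Zp_times_nth)
      also have "a (cst y * (b v $$ (n - m))) = fls_const (cst y) * a (b v $$ (n - m))"
        using currentsD(2)[OF p(4), of y "b v $$ (n - m)"] by (simp only: smul_cst fls_smul_cst)
      also have "fls_const (cst x) * (Zp k * (fls_const (cst y) * a (b v $$ (n - m)))) = (g * cur2 a b v) $$ n"
        unfolding 1 by (simp only: mult.assoc fls_const_times_nth Zp_times_nth cur2_nth[OF p(4)])
      finally show "cur2 (cur_smul x (cur_shift k a)) (cur_smul y (cur_shift m b)) v $$ n = (g * cur2 a b v) $$ n" .
    qed
  qed
  then have *: "quot_poly p * cur2 (cur_smul x (cur_shift k a)) (cur_smul y (cur_shift m b)) v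
      = g * (quot_poly p * cur2 a b v)" for v
    by (simp only: mult_ac)
  have "diag2 (g * (quot_poly p * cur2 a b v)) = cur_smul (x * y) (cur_shift (k + m) d) v" for v
    unfolding diag2_mult[OF g p(2)] p(3) g' cur_smul_def cur_shift_eq fls_smul_cst by (rule mult.assoc)
  with p show ?thesis
    by (intro reg_prodI[where p = p]) (simp_all only: * bdd2_mult g currents_smul currents_shift)
qed

lemma reg_prod_0_left: "b \<in> currents \<Longrightarrow> reg_prod 0 b 0"
proof -
  have "cur2 0 b v = 0" for v
    by (rule fls_eqI) (simp add: cur2_nth)
  then show "b \<in> currents \<Longrightarrow> reg_prod 0 b 0"
    by (intro reg_prodI[where p = 1]) simp_all
qed

lemma reg_prod_0_right: "a \<in> currents \<Longrightarrow> reg_prod a 0 0"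
proof -
  assume a: "a \<in> currents"
  have "cur2 a 0 v = 0" for v
    by (rule fls_eqI) (simp add: a cur2_nth currentsD)
  then show "reg_prod a 0 0"
    by (intro reg_prodI[where p = 1]) (simp_all add: a)
qed

lemma reg_prod_sum:
  assumes "finite A" "finite B"
    "\<And>i. i \<in> A \<Longrightarrow> a i \<in> currents" "\<And>j. j \<in> B \<Longrightarrow> b j \<in> currents"
    "\<And>i j. i \<in> A \<Longrightarrow> j \<in> B \<Longrightarrow> reg_prod (a i) (b j) (d i j)"
  shows "reg_prod (sum a A) (sum b B) (\<Sum>i\<in>A. \<Sum>j\<in>B. d i j)"
proof -
  have "reg_prod (a i) (sum b B) (\<Sum>j\<in>B. d i j)" if i: "i \<in> A" for i
    using assms(2,4,5) i
    by (induction B) (auto intro!: reg_prod_0_right assms(3) reg_prod_add_right)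
  with assms(1) show ?thesis
    by (induction A) (auto intro!: reg_prod_0_left currents_sum assms(4) reg_prod_add_left)
qed

section \<open>Exponentials of power series\<close>

text \<open>The equation \<open>f' = h' f\<close> with \<open>f(0) = 1\<close> defines the
  exponential of \<open>h\<close> without composing series and regardless of the constant term of
  \<open>h\<close>. Identities between exponentials are reduced to the uniqueness of its
  solution.\<close>

definition is_exp :: "'a::comm_ring_1 fps \<Rightarrow> 'a fps \<Rightarrow> bool" where
  "is_exp h f \<longleftrightarrow> f $ 0 = 1 \<and> fps_deriv f = fps_deriv h * f"

lemma is_exp_add: "is_exp h f \<Longrightarrow> is_exp h' f' \<Longrightarrow> is_exp (h + h') (f * f')"
  by (simp add: is_exp_def algebra_simps)

text \<open>The equation determines \<open>(m+1) f_(m+1)\<close> from the coefficients up to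
  \<open>f_m\<close>. Torsion-freeness stands in for division, as the coefficient rings are not
  fields.\<close>

lemma is_exp_unique:
  fixes f g :: "'a::comm_ring_1 fps"
  assumes tf: "\<And>n (x::'a) y. of_nat (Suc n) * x = of_nat (Suc n) * y \<Longrightarrow> x = y"
    and "is_exp h f" "is_exp h' g" "fps_deriv h = fps_deriv h'"
  shows "f = g"
proof -
  have "f $ n = g $ n" for n
  proof (induction n rule: less_induct)
    case (less n)
    show ?case
    proof (cases n)
      case 0
      with assms show ?thesis by (simp add: is_exp_def)
    next
      case (Suc m)
      have "of_nat (Suc m) * f $ Suc m = fps_deriv f $ m" by simp
      also have "\<dots> = (fps_deriv h * f) $ m"
        using assms(2) by (simp only: is_exp_def)
      also have "\<dots> = (fps_deriv h' * g) $ m"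
        unfolding fps_mult_nth assms(4) by (intro sum.cong refl) (simp add: less Suc)
      also have "\<dots> = of_nat (Suc m) * g $ Suc m"
        using assms(3) unfolding is_exp_def by (metis fps_deriv_nth Suc_eq_plus1)
      finally show ?thesis using Suc tf by blast
    qed
  qed
  then show ?thesis by (simp add: fps_eq_iff)
qed

section \<open>Characteristic zero and absence of torsion\<close>

instance fract :: ("{idom, ring_char_0}") ring_char_0
proof
  have *: "of_nat n = Fraction_Field.Fract (of_nat n :: 'a) 1" for n
    by (induction n) (simp_all add: Zero_fract_def One_fract_def)
  show "inj (of_nat :: nat \<Rightarrow> 'a fract)"
    by (rule injI) (simp add: * eq_fract)
qed

instance fract :: ("{idom, ring_char_0}") field_char_0 ..

lemma vec_torsion_free:
  fixes x y :: "'k::comm_monoid_add vec"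
  assumes "of_nat (Suc n) * x = of_nat (Suc n) * y"
  shows "x = y"
proof -
  have "x = cst (inverse (of_nat (Suc n))) * (of_nat (Suc n) * x)" for x :: "'k vec"
    unfolding rhom.of_nat[OF rhom_cst, symmetric] mult.assoc[symmetric] cst_mult[symmetric]
    by (simp del: of_nat_Suc)
  with assms show ?thesis by metis
qed

lemma fls_torsion_free:
  fixes x y :: "'k::comm_monoid_add vec fls"
  assumes "of_nat (Suc n) * x = of_nat (Suc n) * y"
  shows "x = y"
proof (rule fls_eqI)
  fix m
  have "of_nat (Suc n) * x $$ m = of_nat (Suc n) * y $$ m"
    using arg_cong[OF assms, of "\<lambda>f. f $$ m"]
    by (simp only: rhom.of_nat[OF rhom_fls_const, symmetric] fls_const_times_nth)
  then show "x $$ m = y $$ m" by (rule vec_torsion_free)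
qed

definition fps_map :: "('a \<Rightarrow> 'b) \<Rightarrow> 'a fps \<Rightarrow> 'b fps" where
  "fps_map h f = Abs_fps (\<lambda>n. h (f $ n))"

lemma fps_map_nth [simp]: "fps_map h f $ n = h (f $ n)"
  by (simp add: fps_map_def)

lemma fls_map_fps_to_fls: "h 0 = 0 \<Longrightarrow> fls_map h (fps_to_fls f) = fps_to_fls (fps_map h f)"
  by (rule fls_eqI) (simp add: fls_map_nth)

lemma is_exp_map:
  assumes "rhom t" "is_exp h f"
  shows "is_exp (fps_map t h) (fps_map t f)"
proof -
  interpret rhom t by fact
  have d: "fps_deriv (fps_map t f) = fps_map t (fps_deriv f)" for f
    by (rule fps_ext) (simp add: mult of_nat add one)
  have m: "fps_map t (f * g) = fps_map t f * fps_map t g" for f g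
    by (rule fps_ext) (simp add: fps_mult_nth sum mult)
  show ?thesis
    using assms(2) by (simp add: is_exp_def d one flip: m)
qed

text \<open>The substitution $u \mapsto z_2/z_1$ turns a scalar series into one with coefficients in \<open>z\<^sub>1\<close>.\<close>

definition fps_twist :: "F fps \<Rightarrow> 'k::comm_monoid_add vec fls fps" where
  "fps_twist g = Abs_fps (\<lambda>j. Zp (- int j) * fls_const (cst (g $ j)))"

lemma fps_twist_mult: "fps_twist (f * g) = fps_twist f * (fps_twist g :: 'k::comm_monoid_add vec fls fps)"
proof -
  have "fps_to_fls (fps_twist (f * g)) = fps_to_fls (fps_twist f * (fps_twist g :: 'k vec fls fps))"
    unfolding fls_times_fps_to_fls fps_twist_def quot_fps_def[symmetric] by (rule rhom.mult[OF rhom_quot_fps])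
  then show ?thesis by (simp only: fps_to_fls_eq_iff)
qed

text \<open>Differentiation with respect to \<open>z_2\<close> brings the same factor
  \<open>z_1^-1\<close> out of both sides, so the exponential equation survives the
  substitution.\<close>

lemma is_exp_twist:
  assumes "is_exp h f"
  shows "is_exp (fps_twist h) (fps_twist f :: 'k::comm_monoid_add vec fls fps)"
proof -
  have 1: "fps_deriv (fps_twist f) = fps_const (Zp (- 1)) * (fps_twist (fps_deriv f) :: 'k vec fls fps)" for f
  proof (rule fps_ext)
    fix n
    have Zp_m: "Zp (- int (Suc n)) = (Zp (- 1) * Zp (- int n) :: 'k vec fls)"
      by (simp only: Zp_add[symmetric]) simp
    have "of_nat (Suc n) * (Zp (- int (Suc n)) * fls_const (cst (f $ Suc n))) =
       Zp (-1) * (Zp (- int n) * fls_const (cst (of_nat (Suc n) * f $ Suc n)) :: 'k vec fls)"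
      unfolding cst_mult rhom.mult[OF rhom_fls_const] rhom.of_nat[OF rhom_cst] rhom.of_nat[OF rhom_fls_const] Zp_m
      by (simp only: mult_ac)
    then show "fps_deriv (fps_twist f) $ n = (fps_const (Zp (- 1)) * (fps_twist (fps_deriv f) :: 'k vec fls fps)) $ n"
      by (simp add: fps_twist_def del: of_nat_Suc)
  qed
  show ?thesis
    using assms by (simp add: is_exp_def 1 fps_twist_mult mult.assoc) (simp add: fps_twist_def)
qed

text \<open>The operator exponential of multiplication operators, applied to 1. As
  \<open>op_pow\<close> sums from \<open>r = 1\<close>, the exponent is the series of
  \<open>h\<close> with its constant term replaced by zero.\<close>

definition exp_fps :: "(nat \<Rightarrow> 'k::comm_monoid_add vec) \<Rightarrow> 'k vec fps" where
  "exp_fps h = Abs_fps (\<lambda>n. op_exp (\<lambda>r v. h r * v) n 1)"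

lemma op_pow_mult:
  "op_pow (\<lambda>r v. h r * v) k n v = (Abs_fps (\<lambda>r. if r = 0 then 0 else h r) ^ k) $ n * v"
proof (induction k arbitrary: n)
  case 0
  show ?case by simp
next
  case (Suc k)
  let ?H = "Abs_fps (\<lambda>r. if r = 0 then 0 else h r)"
  have "(?H * ?H ^ k) $ n = (\<Sum>i=1..n. h i * (?H ^ k) $ (n - i))"
    unfolding fps_mult_nth by (rule sum.mono_neutral_cong_right) auto
  then show ?case by (simp add: Suc.IH sum_distrib_right mult.assoc)
qed

lemma op_exp_mult: "op_exp (\<lambda>r v. h r * v) n v = exp_fps h $ n * v"
  by (simp add: exp_fps_def op_exp_def op_pow_mult smul_cst sum_distrib_right mult.assoc)

lemma is_exp_exp_fps: "is_exp (Abs_fps h) (exp_fps h :: 'k::comm_monoid_add vec fps)"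
proof -
  define H where "H = Abs_fps (\<lambda>r. if r = 0 then 0 else h r)"
  define c :: "nat \<Rightarrow> 'k vec" where "c k = cst (inverse (of_nat (fact k)))" for k
  have c: "c (Suc k) * of_nat (Suc k) = c k" for k
    unfolding c_def rhom.of_nat[OF rhom_cst, symmetric] cst_mult[symmetric]
  proof (rule arg_cong[where f = cst])
    have *: "of_nat (fact (Suc k)) = of_nat (Suc k) * (of_nat (fact k) :: F)"
      by (simp only: fact_Suc of_nat_mult of_nat_id)
    show "inverse (of_nat (fact (Suc k))) * of_nat (Suc k) = (inverse (of_nat (fact k)) :: F)"
      unfolding * by (simp del: of_nat_Suc of_nat_fact)
  qed
  have H0: "(H ^ k) $ n = 0" if "n < k" for k n
    using that by (intro startsby_zero_power_prefix[rule_format]) (simp_all add: H_def)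
  \<comment> \<open>Since \<open>H\<close> starts in degree one, all coefficients up to degree
    \<open>N\<close> are given by one and the same finite sum over \<open>k \<le> N\<close>; this
    permits the interchange of sums below.\<close>
  have e: "exp_fps h $ n = (\<Sum>k\<le>N. c k * (H ^ k) $ n)" if "n \<le> N" for n N
  proof -
    have "exp_fps h $ n = (\<Sum>k\<le>n. c k * (H ^ k) $ n)"
      by (simp add: exp_fps_def op_exp_def op_pow_mult smul_cst H_def c_def)
    also have "\<dots> = (\<Sum>k\<le>N. c k * (H ^ k) $ n)"
      by (rule sum.mono_neutral_left) (use that H0 in auto)
    finally show ?thesis .
  qed
  have H': "fps_deriv H = fps_deriv (Abs_fps h)"
    by (rule fps_ext) (simp add: H_def)
  have "fps_deriv (exp_fps h) $ n = (fps_deriv H * exp_fps h) $ n" for n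
  proof -
    have "fps_deriv (exp_fps h) $ n = of_nat (Suc n) * (\<Sum>k\<le>Suc n. c k * (H ^ k) $ Suc n)"
      by (simp add: e[of "Suc n" "Suc n"] del: of_nat_Suc)
    also have "\<dots> = (\<Sum>k\<le>Suc n. c k * fps_deriv (H ^ k) $ n)"
      by (simp add: sum_distrib_left mult_ac del: of_nat_Suc sum.atMost_Suc)
    also have "\<dots> = (\<Sum>k\<le>n. c (Suc k) * fps_deriv (H ^ Suc k) $ n)"
      by (subst sum.atMost_Suc_shift) simp
    also have "\<dots> = (\<Sum>k\<le>n. c k * (fps_deriv H * H ^ k) $ n)"
    proof (rule sum.cong)
      fix k
      have "c (Suc k) * fps_deriv (H ^ Suc k) $ n = (c (Suc k) * of_nat (Suc k)) * (fps_deriv H * H ^ k) $ n"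
        unfolding fps_deriv_power by (simp add: mult.assoc del: of_nat_Suc fps_deriv_nth power_Suc)
      then show "c (Suc k) * fps_deriv (H ^ Suc k) $ n = c k * (fps_deriv H * H ^ k) $ n"
        unfolding c .
    qed simp
    also have "\<dots> = (\<Sum>i=0..n. fps_deriv H $ i * (\<Sum>k\<le>n. c k * (H ^ k) $ (n - i)))"
      unfolding fps_mult_nth sum_distrib_left
      by (subst sum.swap) (simp add: mult_ac del: fps_deriv_nth)
    also have "\<dots> = (fps_deriv H * exp_fps h) $ n"
      unfolding fps_mult_nth by (intro sum.cong refl) (simp add: e[of _ n])
    finally show ?thesis .
  qed
  moreover have "exp_fps h $ 0 = 1"
    by (simp add: e[of 0 0] c_def)
  ultimately show ?thesis
    by (simp add: is_exp_def fps_eq_iff flip: H' del: fps_deriv_nth)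
qed

lemma exp_fps_unique: "is_exp h' f \<Longrightarrow> fps_deriv h' = fps_deriv (Abs_fps h) \<Longrightarrow> f = exp_fps h"
  using vec_torsion_free by (rule is_exp_unique[OF _ _ is_exp_exp_fps])

section \<open>Linear extension of characters\<close>

lemma poly_mapping_sum_single:
  assumes "finite A" "Poly_Mapping.keys v \<subseteq> A"
  shows "v = (\<Sum>k\<in>A. Poly_Mapping.single k (Poly_Mapping.lookup v k))"
proof (rule poly_mapping_eqI)
  fix k
  show "Poly_Mapping.lookup v k = Poly_Mapping.lookup (\<Sum>k\<in>A. Poly_Mapping.single k (Poly_Mapping.lookup v k)) k"
    using assms by (auto simp: lookup_sum lookup_single when_def in_keys_iff)
qed

lemma lin_ext_superset:
  assumes "\<And>x. sc 0 x = 0" "finite A" "Poly_Mapping.keys v \<subseteq> A"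
  shows "lin_ext sc g v = (\<Sum>k\<in>A. sc (Poly_Mapping.lookup v k) (g k))"
  unfolding lin_ext_def by (rule sum.mono_neutral_left) (use assms in \<open>auto simp: in_keys_iff\<close>)

lemma lin_ext_single: "(\<And>x. sc 0 x = 0) \<Longrightarrow> lin_ext sc g (Poly_Mapping.single k c) = sc c (g k)"
  by (subst lin_ext_superset[of _ "{k}"]) auto

lemma lin_ext_add:
  assumes "\<And>x. sc 0 x = 0" "\<And>a b x. sc (a + b) x = sc a x + sc b x"
  shows "lin_ext sc g (v + w) = lin_ext sc g v + lin_ext sc g w"
proof -
  let ?A = "Poly_Mapping.keys v \<union> Poly_Mapping.keys w"
  show ?thesis
    using assms keys_add[of v w]
    by (simp add: lin_ext_superset[of sc ?A] lookup_add sum.distrib)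
qed

lemma lin_ext_eqI:
  assumes g: "\<And>k. f (Poly_Mapping.single k 1) = g k"
    and add: "\<And>v w. f (v + w) = f v + f w" and sc: "\<And>c v. f (smul c v) = sc c (f v)"
    and "f 0 = 0"
  shows "f = lin_ext sc g"
proof
  fix v
  have sum: "f (\<Sum>x\<in>A. h x) = (\<Sum>x\<in>A. f (h x))" for A :: "'a set" and h
    by (induction A rule: infinite_finite_induct) (simp_all add: assms)
  have s: "Poly_Mapping.single k c = smul c (Poly_Mapping.single k 1)" for k :: 'a and c
    by (rule poly_mapping_eqI) (simp add: lookup_single when_def)
  have "f v = f (\<Sum>k\<in>Poly_Mapping.keys v. Poly_Mapping.single k (Poly_Mapping.lookup v k))"
    using poly_mapping_sum_single[OF finite_keys subset_refl, of v] by (rule arg_cong)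
  then show "f v = lin_ext sc g v"
    by (simp add: sum s[of _ "Poly_Mapping.lookup v _"] sc g lin_ext_def)
qed

text \<open>As \<open>'k vec\<close> is the monoid algebra of \<open>'k\<close> over
  \<open>F\<close>, this is its universal property: a multiplicative map on the basis and a ring map
  on the scalars extend to a ring homomorphism. It yields \<open>tau\<close>, \<open>embed\<close>,
  \<open>evl\<close> and \<open>msigma\<close>.\<close>

locale monoid_char =
  fixes e :: "F \<Rightarrow> 'b::comm_ring_1" and sc :: "F \<Rightarrow> 'b \<Rightarrow> 'b" and g :: "'k::comm_monoid_add \<Rightarrow> 'b"
  assumes e: "rhom e" and sc: "sc c x = e c * x"
    and g_add: "g (k + l) = g k * g l" and g_0: "g 0 = 1"
begin

lemma ext_single: "lin_ext sc g (Poly_Mapping.single k c) = e c * g k"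
  by (subst lin_ext_single) (simp_all add: sc rhom.zero[OF e])

lemma ext_cst: "lin_ext sc g (cst c) = e c"
  by (simp add: cst_def ext_single g_0)

lemma ext_add: "lin_ext sc g (v + w) = lin_ext sc g v + lin_ext sc g w"
  by (rule lin_ext_add) (simp_all add: sc rhom.add[OF e] rhom.zero[OF e] distrib_right)

lemma ext_sum: "lin_ext sc g (sum f A) = (\<Sum>x\<in>A. lin_ext sc g (f x))"
  by (induction A rule: infinite_finite_induct) (simp_all add: ext_add lin_ext_def[of sc g 0])

lemma rhom_ext: "rhom (lin_ext sc g)"
proof
  fix v w :: "'k vec"
  show "lin_ext sc g (v + w) = lin_ext sc g v + lin_ext sc g w" by (rule ext_add)
  show "lin_ext sc g 1 = 1"
    using ext_cst[of 1] by (simp add: rhom.one[OF e])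
  note V = poly_mapping_sum_single[OF finite_keys subset_refl]
  have "v * w = (\<Sum>k\<in>Poly_Mapping.keys v. \<Sum>l\<in>Poly_Mapping.keys w.
      Poly_Mapping.single (k + l) (Poly_Mapping.lookup v k * Poly_Mapping.lookup w l))"
    by (subst V[of v], subst V[of w], unfold sum_product mult_single) (rule refl)
  then have "lin_ext sc g (v * w) = (\<Sum>k\<in>Poly_Mapping.keys v. \<Sum>l\<in>Poly_Mapping.keys w.
      e (Poly_Mapping.lookup v k * Poly_Mapping.lookup w l) * g (k + l))"
    by (simp only: ext_sum ext_single)
  also have "\<dots> = lin_ext sc g v * lin_ext sc g w"
    by (simp add: lin_ext_def sc sum_product rhom.mult[OF e] g_add mult_ac)
  finally show "lin_ext sc g (v * w) = lin_ext sc g v * lin_ext sc g w" .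
qed

end

section \<open>Vertex operators\<close>

definition mon :: "(nat \<Rightarrow>\<^sub>0 nat) \<Rightarrow> (nat \<Rightarrow> 'a::comm_ring_1) \<Rightarrow> 'a" where
  "mon \<mu> f = (\<Prod>r\<in>Poly_Mapping.keys \<mu>. f r ^ Poly_Mapping.lookup \<mu> r)"

lemma mon_superset:
  "finite A \<Longrightarrow> Poly_Mapping.keys \<mu> \<subseteq> A \<Longrightarrow> mon \<mu> f = (\<Prod>r\<in>A. f r ^ Poly_Mapping.lookup \<mu> r)"
  unfolding mon_def by (rule prod.mono_neutral_left) (auto simp: in_keys_iff)

lemma mon_0 [simp]: "mon 0 f = 1"
  by (simp add: mon_def)

lemma mon_single [simp]: "mon (Poly_Mapping.single r n) f = f r ^ n"
  by (subst mon_superset[of "{r}"]) auto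

lemma mon_add: "mon (\<mu> + \<nu>) f = mon \<mu> f * mon \<nu> f"
proof -
  let ?A = "Poly_Mapping.keys \<mu> \<union> Poly_Mapping.keys \<nu>"
  show ?thesis
    using keys_add[of \<mu> \<nu>] by (simp add: mon_superset[of ?A] lookup_add power_add prod.distrib)
qed

lemma rhom_mon: "rhom h \<Longrightarrow> h (mon \<mu> f) = mon \<mu> (\<lambda>r. h (f r))"
  by (simp add: mon_def rhom.prod rhom.power)

lemma mon_bdd2:
  "(\<And>r. f r \<in> bdd2) \<Longrightarrow> mon \<mu> f \<in> (bdd2 :: 'a::comm_ring_1 fls fls set)"
  by (simp add: mon_def bdd2_prod bdd2_power)

lemma diag2_mon:
  "(\<And>r. f r \<in> bdd2) \<Longrightarrow> diag2 (mon \<mu> f :: 'a::comm_ring_1 fls fls) = mon \<mu> (\<lambda>r. diag2 (f r))"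
  by (simp add: mon_def diag2_prod bdd2_power diag2_power)

text \<open>
  The vertex operator with data \<open>D\<close> is $\prod_i e_i^{c_i}\exp(\sum_r \lambda_{i,r}a_i(-r)z^r)$
  (with \<open>\<lambda> = lam\<close>, \<open>c = chg\<close>) after the algebra homomorphism
  $a_i(-r)\mapsto a_i(-r)+\kappa_{i,r}z^{-r}$, $e_i\mapsto \rho_iz^{w_i}e_i$
  (with \<open>\<kappa> = kap\<close>, \<open>\<rho> = scl\<close>, \<open>w = wt\<close>).
\<close>

record 'c vdata =
  lam :: "'c \<Rightarrow> nat \<Rightarrow> F"
  kap :: "'c \<Rightarrow> nat \<Rightarrow> F"
  chg :: "'c \<Rightarrow> int"
  scl :: "'c \<Rightarrow> F"
  wt :: "'c \<Rightarrow> int"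

definition gen :: "'c \<Rightarrow> nat \<Rightarrow> ('c \<Rightarrow> fock) vec"  \<comment> \<open>$a_i(-(r+1))$\<close>
  where "gen i r = Poly_Mapping.single ((\<lambda>_. 0)(i := (Poly_Mapping.single r 1, 0))) 1"

definition lat :: "('c \<Rightarrow> int) \<Rightarrow> ('c \<Rightarrow> fock) vec" where
  "lat n = Poly_Mapping.single (\<lambda>i. (0, n i)) 1"

lemma lat_add: "lat (\<lambda>i. m i + n i) = lat m * lat n"
  by (simp add: lat_def mult_single plus_fun_def)

lemma lat_0: "lat (\<lambda>i. 0) = 1"
  by (simp add: lat_def single_one[symmetric] zero_fun_def zero_prod_def del: single_one)

definition valid :: "'c vdata \<Rightarrow> bool" where
  "valid D \<longleftrightarrow> (\<forall>i. scl D i \<noteq> 0)"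

definition creat :: "'c::finite vdata \<Rightarrow> ('c \<Rightarrow> fock) vec fls" where
  "creat D = fls_const (lat (chg D)) *
    fps_to_fls (exp_fps (\<lambda>r. \<Sum>i\<in>UNIV. cst (lam D i r) * gen i (r - 1)))"

text \<open>The image of the basis vector in position \<open>i\<close> up to its lattice element,
  which \<open>chi\<close> supplies for all positions at once.\<close>

definition chi1 :: "'c vdata \<Rightarrow> 'c \<Rightarrow> fock \<Rightarrow> ('c \<Rightarrow> fock) vec fls" where
  "chi1 D i k = fls_const (cst (scl D i powi snd k)) * Zp (wt D i * snd k) *
    mon (fst k) (\<lambda>r. fls_const (gen i r) + fls_const (cst (kap D i (Suc r))) * Zp (- int (Suc r)))"

definition chi :: "'c::finite vdata \<Rightarrow> ('c \<Rightarrow> fock) \<Rightarrow> ('c \<Rightarrow> fock) vec fls" where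
  "chi D b = fls_const (lat (\<lambda>i. snd (b i))) * (\<Prod>i\<in>UNIV. chi1 D i (b i))"

definition tau :: "'c::finite vdata \<Rightarrow> ('c \<Rightarrow> fock) vec \<Rightarrow> ('c \<Rightarrow> fock) vec fls" where
  "tau D = lin_ext fls_smul (chi D)"

definition vop :: "'c::finite vdata \<Rightarrow> ('c \<Rightarrow> fock) cur" where
  "vop D = (\<lambda>v. creat D * tau D v)"

abbreviation fcst :: "F \<Rightarrow> 'k::comm_monoid_add vec fls" where
  "fcst c \<equiv> fls_const (cst c)"

lemmas rhom_fcst = rhom_comp[OF rhom_cst rhom_fls_const]

lemma chi1_0: "chi1 D i 0 = 1"
  by (simp add: chi1_def)

lemma chi1_add: "valid D \<Longrightarrow> chi1 D i (k + l) = chi1 D i k * chi1 D i l"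
proof -
  assume "valid D"
  then have 1: "scl D i powi (snd k + snd l) = scl D i powi snd k * scl D i powi snd l"
    by (simp add: valid_def power_int_add)
  show ?thesis
    unfolding chi1_def fst_add snd_add 1 distrib_left Zp_add mon_add rhom.mult[OF rhom_fcst] by (simp only: mult_ac)
qed

lemma monoid_char_chi: "valid D \<Longrightarrow> monoid_char fcst fls_smul (chi D)"
proof
  assume D: "valid D"
  show "chi D (k + l) = chi D k * chi D l" for k l
    unfolding chi_def plus_fun_def snd_add lat_add chi1_add[OF D] prod.distrib rhom.mult[OF rhom_fls_const]
    by (simp only: mult_ac)
  show "chi D 0 = 1"
    by (simp add: chi_def lat_0 chi1_0 zero_fun_def)
qed (use rhom_fcst in \<open>auto simp: fls_smul_cst rhom_def\<close>)

lemma rhom_tau: "valid D \<Longrightarrow> rhom (tau D)"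
  unfolding tau_def by (rule monoid_char.rhom_ext[OF monoid_char_chi])

lemma tau_cst: "valid D \<Longrightarrow> tau D (cst c) = fcst c"
  unfolding tau_def by (rule monoid_char.ext_cst[OF monoid_char_chi])

lemma tau_single: "valid D \<Longrightarrow> tau D (Poly_Mapping.single b c) = fcst c * chi D b"
  unfolding tau_def by (rule monoid_char.ext_single[OF monoid_char_chi])

lemma tau_gen:
  "valid D \<Longrightarrow> tau D (gen i r) = fls_const (gen i r) + fcst (kap D i (Suc r)) * Zp (- int (Suc r))"
proof -
  assume D: "valid D"
  define b :: "'a \<Rightarrow> fock" where "b = (\<lambda>_. 0)(i := (Poly_Mapping.single r 1, 0))"
  have "(\<Prod>j\<in>UNIV. chi1 D j (b j)) = (\<Prod>j\<in>UNIV. if j = i then chi1 D i (b i) else 1)"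
    by (rule prod.cong) (auto simp: b_def chi1_0)
  then have 1: "(\<Prod>j\<in>UNIV. chi1 D j (b j)) = chi1 D i (b i)"
    by simp
  have 2: "(\<lambda>j. snd (b j)) = (\<lambda>_. 0)"
    by (auto simp: b_def)
  have "tau D (gen i r) = chi1 D i (b i)"
    unfolding gen_def b_def[symmetric] tau_single[OF D] chi_def 1 2 lat_0 by simp
  also have "b i = (Poly_Mapping.single r 1, 0)"
    by (simp add: b_def)
  finally show ?thesis
    by (simp add: chi1_def)
qed

definition pair_scl :: "'c::finite vdata \<Rightarrow> ('c \<Rightarrow> int) \<Rightarrow> F" where
  "pair_scl D n = (\<Prod>i\<in>UNIV. scl D i powi n i)"

definition pair_wt :: "'c::finite vdata \<Rightarrow> ('c \<Rightarrow> int) \<Rightarrow> int" where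
  "pair_wt D n = (\<Sum>i\<in>UNIV. wt D i * n i)"

lemma Zp_sum: "Zp (sum f A) = (\<Prod>i\<in>A. Zp (f i) :: 'a::comm_ring_1 fls)"
proof (induction A rule: infinite_finite_induct)
  case (insert x A)
  show ?case
    unfolding sum.insert[OF insert(1,2)] prod.insert[OF insert(1,2)] Zp_add insert.IH ..
qed simp_all

lemma tau_lat:
  "valid D \<Longrightarrow> tau D (lat n) = fls_const (lat n) * (fcst (pair_scl D n) * Zp (pair_wt D n))"
  unfolding lat_def[of n]
  by (subst tau_single)
    (simp_all only: chi_def chi1_def mon_0 fst_conv snd_conv prod.distrib pair_scl_def pair_wt_def
      Zp_sum rhom.prod[OF rhom_fcst] cst_1 fls_const_1 mult_1_left mult_1_right lat_def[symmetric])

lemma currents_vop: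
  assumes "valid D"
  shows "vop D \<in> currents"
proof -
  interpret rhom "tau D" by (rule rhom_tau) fact
  show ?thesis
    by (auto simp: currents_iff vop_def add distrib_left smul_cst fls_smul_cst mult tau_cst assms mult_ac)
qed

subsection \<open>Products of vertex operators\<close>

definition vadd :: "'c vdata \<Rightarrow> 'c vdata \<Rightarrow> 'c vdata" where
  "vadd D D' = \<lparr>lam = (\<lambda>i r. lam D i r + lam D' i r), kap = (\<lambda>i r. kap D i r + kap D' i r),
    chg = (\<lambda>i. chg D i + chg D' i), scl = (\<lambda>i. scl D i * scl D' i), wt = (\<lambda>i. wt D i + wt D' i)\<rparr>"

lemma vadd_sel [simp]:
  "lam (vadd D D') i r = lam D i r + lam D' i r" "kap (vadd D D') i r = kap D i r + kap D' i r"
  "chg (vadd D D') i = chg D i + chg D' i" "scl (vadd D D') i = scl D i * scl D' i"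
  "wt (vadd D D') i = wt D i + wt D' i"
  by (simp_all add: vadd_def)

lemma valid_vadd [simp]: "valid D \<Longrightarrow> valid D' \<Longrightarrow> valid (vadd D D')"
  by (simp add: valid_def)

lemma creat_vadd: "creat (vadd D D') = creat D * creat D'"
proof -
  define h where "h D = (\<lambda>r. \<Sum>i\<in>UNIV. cst (lam D i r) * gen i (r - 1))" for D :: "'a vdata"
  have "exp_fps (h D) * exp_fps (h D') = exp_fps (h (vadd D D'))"
    by (rule exp_fps_unique[OF is_exp_add[OF is_exp_exp_fps is_exp_exp_fps]])
      (rule arg_cong[where f = fps_deriv], rule fps_ext,
       simp add: h_def sum.distrib cst_add distrib_right)
  then have e: "fps_to_fls (exp_fps (h (vadd D D'))) = fps_to_fls (exp_fps (h D)) * fps_to_fls (exp_fps (h D'))"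
    by (simp only: fls_times_fps_to_fls[symmetric])
  have l: "lat (chg (vadd D D')) = lat (chg D) * lat (chg D')"
    by (simp add: vadd_def lat_add)
  show ?thesis
    unfolding creat_def h_def[symmetric] e l rhom.mult[OF rhom_fls_const] by (simp only: mult_ac)
qed

text \<open>The homomorphism adds \<open>kap z_1^-r\<close> to each generator, hence the scalar
  series with terms \<open>kap lam (z_2/z_1)^r\<close> to the exponent of \<open>creat D'\<close>;
  by uniqueness of exponentials this splits off the factor \<open>g\<close>. The lattice element of
  \<open>D'\<close> accounts for the other scalar and the power of \<open>z_1\<close>.\<close>

lemma tau_creat:
  assumes D: "valid D" and g: "is_exp (Abs_fps (\<lambda>r. \<Sum>i\<in>UNIV. kap D i r * lam D' i r)) g"
  shows "fls_map (tau D) (creat D') =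
    fls_const (fcst (pair_scl D (chg D')) * Zp (pair_wt D (chg D'))) * quot_fps g * fls_map fls_const (creat D')"
proof -
  interpret t: rhom "tau D" by (rule rhom_tau) fact
  interpret tm: rhom "fls_map (tau D)" by (rule rhom_fls_map) (rule rhom_tau[OF D])
  interpret c: rhom "fls_const :: ('a \<Rightarrow> fock) vec \<Rightarrow> _" by (rule rhom_fls_const)
  interpret cm: rhom "fls_map (fls_const :: ('a \<Rightarrow> fock) vec \<Rightarrow> _)" by (rule rhom_fls_map) (rule rhom_fls_const)
  define h where "h = (\<lambda>r. \<Sum>i\<in>UNIV. cst (lam D' i r) * gen i (r - 1))"
  define s where "s = Abs_fps (\<lambda>r. \<Sum>i\<in>UNIV. kap D i r * lam D' i r)"
  have "fps_map (tau D) (exp_fps h) = fps_twist g * fps_map fls_const (exp_fps h)"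
  proof (rule is_exp_unique[OF fls_torsion_free])
    show "is_exp (fps_map (tau D) (Abs_fps h)) (fps_map (tau D) (exp_fps h))"
      by (rule is_exp_map[OF t.rhom_axioms is_exp_exp_fps])
    show "is_exp (fps_twist s + fps_map fls_const (Abs_fps h)) (fps_twist g * fps_map fls_const (exp_fps h))"
      using is_exp_add[OF is_exp_twist[OF g] is_exp_map[OF c.rhom_axioms is_exp_exp_fps]] by (simp add: s_def)
    show "fps_deriv (fps_map (tau D) (Abs_fps h)) = fps_deriv (fps_twist s + fps_map fls_const (Abs_fps h))"
    proof (rule fps_ext)
      fix n
      have "tau D (h (Suc n)) = Zp (- int (Suc n)) * fcst (s $ Suc n) + fls_const (h (Suc n))"
        unfolding h_def s_def fps_nth_Abs_fps t.sum t.mult tau_cst[OF D] tau_gen[OF D] c.sum c.mult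
          rhom.sum[OF rhom_fcst] rhom.mult[OF rhom_fcst] diff_Suc_1
        by (simp only: distrib_left sum.distrib sum_distrib_left mult_ac add_ac)
      then show "fps_deriv (fps_map (tau D) (Abs_fps h)) $ n = fps_deriv (fps_twist s + fps_map fls_const (Abs_fps h)) $ n"
        by (simp only: fps_twist_def fps_deriv_nth fps_add_nth fps_map_nth fps_nth_Abs_fps Suc_eq_plus1[symmetric])
    qed
  qed
  then have "fls_map (tau D) (fps_to_fls (exp_fps h)) = quot_fps g * fls_map fls_const (fps_to_fls (exp_fps h))"
    by (simp add: fls_map_fps_to_fls t.zero fls_times_fps_to_fls quot_fps_def fps_twist_def)
  then show ?thesis
    unfolding creat_def h_def[symmetric] tm.mult cm.mult fls_map_const[of "tau D", OF t.zero] fls_map_const[of fls_const, OF c.zero]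
      tau_lat[OF D] rhom.mult[OF rhom_fls_const]
    by (simp only: mult_ac)
qed

lemma Zp_bdd2: "Zp n \<in> (bdd2 :: 'a::comm_ring_1 fls fls set)"
  and diag2_Zp: "diag2 (Zp n) = (Zp n :: 'a::comm_ring_1 fls)"
proof -
  have "Zp n = fls_map fls_const (Zp n :: 'a fls)"
    by (rule fls_map_Zp[OF rhom_fls_const, symmetric])
  then show "Zp n \<in> (bdd2 :: 'a fls fls set)" "diag2 (Zp n) = (Zp n :: 'a fls)"
    by (metis bdd2_iota, metis diag2_iota)
qed

text \<open>A generator becomes itself plus \<open>kap z_1^-r + kap' z_2^-r\<close>, which is
  bounded in both variables. On the diagonal the shifts add and the scalings multiply, as in the
  homomorphism of \<open>vadd D D'\<close>.\<close>

lemma bdd2_tau_chi: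
  assumes D: "valid D" and D': "valid D'"
  shows "fls_map (tau D) (chi D' b) \<in> bdd2"
    and "diag2 (fls_map (tau D) (chi D' b)) = chi (vadd D D') b"
proof -
  interpret t: rhom "tau D" by (rule rhom_tau) fact
  interpret tm: rhom "fls_map (tau D)" by (rule rhom_fls_map) (rule rhom_tau[OF D])
  define n where "n i = snd (b i)" for i
  define A where "A i r = fls_const (fls_const (gen i r) + fcst (kap D i (Suc r)) * Zp (- int (Suc r)))
     + fls_const (fcst (kap D' i (Suc r))) * Zp (- int (Suc r))" for i :: 'a and r
  define B where "B i = fls_const (fcst (scl D' i powi n i)) * Zp (wt D' i * n i) * mon (fst (b i)) (A i)" for i
  have chi1: "fls_map (tau D) (chi1 D' i (b i)) = B i" for i
    unfolding chi1_def tm.mult rhom_mon[OF tm.rhom_axioms] tm.add fls_map_const[of "tau D", OF t.zero]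
      tau_cst[OF D] tau_gen[OF D] fls_map_Zp[OF t.rhom_axioms] B_def A_def n_def ..
  have eq: "fls_map (tau D) (chi D' b) = fls_const (tau D (lat n)) * (\<Prod>i\<in>UNIV. B i)"
    unfolding chi_def tm.mult tm.prod chi1 fls_map_const[of "tau D", OF t.zero] n_def[symmetric] ..
  have A: "A i r \<in> bdd2" for i r
    unfolding A_def by (intro bdd2_add bdd2_const bdd2_mult Zp_bdd2)
  have B: "B i \<in> bdd2" for i
    unfolding B_def by (intro bdd2_mult bdd2_const Zp_bdd2 mon_bdd2 A)
  show "fls_map (tau D) (chi D' b) \<in> bdd2"
    unfolding eq by (intro bdd2_mult bdd2_const bdd2_prod B)
  have dA: "diag2 (A i r) = fls_const (gen i r) + fcst (kap (vadd D D') i (Suc r)) * Zp (- int (Suc r))" for i r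
  proof -
    have "diag2 (A i r) = (fls_const (gen i r) + fcst (kap D i (Suc r)) * Zp (- int (Suc r)))
        + fcst (kap D' i (Suc r)) * Zp (- int (Suc r))"
      unfolding A_def
      by (subst diag2_add[OF bdd2_const bdd2_mult[OF bdd2_const Zp_bdd2]], subst diag2_mult[OF bdd2_const Zp_bdd2])
        (simp only: diag2_const diag2_Zp)
    then show ?thesis
      by (simp only: vadd_sel rhom.add[OF rhom_fcst] distrib_right add.assoc)
  qed
  have dB: "diag2 (B i) = fcst (scl D' i powi n i) * Zp (wt D' i * n i) *
      mon (fst (b i)) (\<lambda>r. fls_const (gen i r) + fcst (kap (vadd D D') i (Suc r)) * Zp (- int (Suc r)))" for i
    unfolding B_def
    by (subst diag2_mult[OF bdd2_mult[OF bdd2_const Zp_bdd2] mon_bdd2[OF A]], subst diag2_mult[OF bdd2_const Zp_bdd2],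
        subst diag2_mon[OF A]) (simp only: diag2_const diag2_Zp dA)
  have "diag2 (fls_map (tau D) (chi D' b)) = tau D (lat n) * (\<Prod>i\<in>UNIV. diag2 (B i))"
    unfolding eq by (subst diag2_mult[OF bdd2_const bdd2_prod[OF B]], subst diag2_prod[OF B]) (simp only: diag2_const)
  also have "\<dots> = chi (vadd D D') b"
    unfolding tau_lat[OF D] dB chi_def chi1_def prod.distrib pair_scl_def pair_wt_def Zp_sum rhom.prod[OF rhom_fcst] n_def
      vadd_sel power_int_mult_distrib distrib_right Zp_add rhom.mult[OF rhom_fcst]
    by (simp only: mult_ac)
  finally show "diag2 (fls_map (tau D) (chi D' b)) = chi (vadd D D') b" .
qed

lemma bdd2_tau_tau:
  assumes D: "valid D" and D': "valid D'"
  shows "fls_map (tau D) (tau D' v) \<in> bdd2"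
    and "diag2 (fls_map (tau D) (tau D' v)) = tau (vadd D D') v"
proof -
  interpret t: rhom "tau D" by (rule rhom_tau) fact
  interpret tm: rhom "fls_map (tau D)" by (rule rhom_fls_map) (rule rhom_tau[OF D])
  have eq: "fls_map (tau D) (tau D' v) = (\<Sum>b\<in>Poly_Mapping.keys v.
      fls_const (fcst (Poly_Mapping.lookup v b)) * fls_map (tau D) (chi D' b))"
    unfolding tau_def[of D'] lin_ext_def fls_smul_cst tm.sum tm.mult fls_map_const[of "tau D", OF t.zero] tau_cst[OF D] ..
  note b = bdd2_tau_chi[OF D D']
  show "fls_map (tau D) (tau D' v) \<in> bdd2"
    unfolding eq by (intro bdd2_sum bdd2_mult bdd2_const b)
  show "diag2 (fls_map (tau D) (tau D' v)) = tau (vadd D D') v"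
    unfolding eq
    by (subst diag2_sum[OF bdd2_mult[OF bdd2_const b(1)]])
      (simp only: diag2_mult[OF bdd2_const b(1)] diag2_const b(2) tau_def[of "vadd D D'"] lin_ext_def fls_smul_cst)
qed

text \<open>Moving the homomorphism of \<open>D\<close> past the exponential of \<open>D'\<close>
  leaves the contraction \<open>g\<close> as the only possibly unbounded factor. The polynomial
  \<open>p\<close> turns it into \<open>p'\<close>, and the remaining factors are restricted to the
  diagonal one by one.\<close>

theorem reg_prod_vop:
  assumes D: "valid D" and D': "valid D'"
    and g: "is_exp (Abs_fps (\<lambda>r. \<Sum>i\<in>UNIV. kap D i r * lam D' i r)) g"
    and p: "p \<in> polys0" "fps_of_poly p * g = fps_of_poly p'"
  shows "reg_prod (vop D) (vop D')
    (cur_smul (pair_scl D (chg D') * poly p' 1) (cur_shift (pair_wt D (chg D')) (vop (vadd D D'))))"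
proof (rule reg_prodI[OF currents_vop[OF D] currents_vop[OF D'] p(1)])
  fix v
  interpret t: rhom "tau D" by (rule rhom_tau) fact
  interpret tm: rhom "fls_map (tau D)" by (rule rhom_fls_map) (rule rhom_tau[OF D])
  define C where "C = fls_const (creat D) * (fls_const (fcst (pair_scl D (chg D')) * Zp (pair_wt D (chg D'))) *
    (fls_map fls_const (creat D') * fls_map (tau D) (tau D' v)))"
  have "cur2 (vop D) (vop D') v = fls_const (creat D) * fls_map (tau D) (vop D' v)"
    by (rule fls_eqI, subst cur2_nth[OF currents_vop[OF D]])
      (simp only: fls_const_times_nth fls_map_nth[of "tau D", OF t.zero] vop_def)
  also have "\<dots> = quot_fps g * C"
    unfolding C_def vop_def tm.mult tau_creat[OF D g] by (simp only: mult_ac)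
  finally have eq: "quot_poly p * cur2 (vop D) (vop D') v = quot_poly p' * C"
    by (simp only: quot_poly_def p(2)[symmetric] rhom.mult[OF rhom_quot_fps] mult.assoc)
  note b = bdd2_tau_tau[OF D D']
  have C: "C \<in> bdd2"
    unfolding C_def by (intro bdd2_mult bdd2_const bdd2_iota b)
  have dC: "diag2 C = creat D * ((fcst (pair_scl D (chg D')) * Zp (pair_wt D (chg D'))) * (creat D' * tau (vadd D D') v))"
    unfolding C_def
    by (subst diag2_mult, intro bdd2_const, intro bdd2_mult bdd2_const bdd2_iota b,
        subst diag2_mult, intro bdd2_const, intro bdd2_mult bdd2_iota b,
        subst diag2_mult, intro bdd2_iota, intro b) (simp only: diag2_const diag2_iota b(2))
  show "quot_poly p * cur2 (vop D) (vop D') v \<in> bdd2"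
    unfolding eq by (intro bdd2_mult C quot_poly_bdd2)
  show "diag2 (quot_poly p * cur2 (vop D) (vop D') v) = cur_smul (pair_scl D (chg D') * poly p' 1)
      (cur_shift (pair_wt D (chg D')) (vop (vadd D D'))) v"
    unfolding eq
    unfolding diag2_mult[OF quot_poly_bdd2 C] dC diag2_quot_poly cur_smul_def cur_shift_eq fls_smul_cst vop_def
      creat_vadd rhom.mult[OF rhom_fcst]
    by (simp only: mult_ac)
qed

subsection \<open>Dilations\<close>

lemma rhom_dilate: "c \<noteq> 0 \<Longrightarrow> rhom (dilate c :: 'k::comm_monoid_add vec fls \<Rightarrow> _)"
proof
  assume c: "c \<noteq> 0"
  fix f g :: "'k vec fls"
  show "dilate c (f + g) = dilate c f + dilate c g"
    by (rule fls_eqI) (simp add: dilate.rep_eq smul_cst distrib_left)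
  show "dilate c 1 = (1 :: 'k vec fls)"
    by (rule fls_eqI) (simp add: dilate.rep_eq smul_cst)
  show "dilate c (f * g) = dilate c f * dilate c g"
  proof (rule fls_eqI)
    fix n
    have *: "dilate c f $$ i * dilate c g $$ (n - i) = cst (c powi n) * (f $$ i * g $$ (n - i))" for i
    proof -
      have "c powi n = c powi i * c powi (n - i)"
        using c by (simp add: power_int_add[symmetric])
      then show ?thesis
        by (simp only: dilate.rep_eq smul_cst cst_mult mult_ac)
    qed
    have "(dilate c f * dilate c g) $$ n =
      (\<Sum>i=fls_subdegree f..n - fls_subdegree g. dilate c f $$ i * dilate c g $$ (n - i))"
      by (rule fls_times_nth_lower) (simp_all add: dilate.rep_eq)
    also have "\<dots> = cst (c powi n) * (f * g) $$ n"
      unfolding * sum_distrib_left[symmetric] fls_times_nth(2)[of f g] ..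
    finally show "dilate c (f * g) $$ n = (dilate c f * dilate c g) $$ n"
      by (simp only: dilate.rep_eq smul_cst)
  qed
qed

lemma dilate_const: "dilate c (fls_const v) = fls_const (v :: 'k::comm_monoid_add vec)"
  by (rule fls_eqI) (simp add: dilate.rep_eq smul_cst)

lemma dilate_Zp: "dilate c (Zp n) = fcst (c powi n) * (Zp n :: 'k::comm_monoid_add vec fls)"
  by (rule fls_eqI) (simp add: dilate.rep_eq smul_cst)

text \<open>The data of the vertex operator with \<open>z\<close> replaced by \<open>c z\<close>; a
  lattice element of weight \<open>wt\<close> picks up \<open>c\<close> to that power.\<close>

definition vdil :: "F \<Rightarrow> 'c vdata \<Rightarrow> 'c vdata" where
  "vdil c D = \<lparr>lam = (\<lambda>i r. lam D i r * c ^ r), kap = (\<lambda>i r. kap D i r * inverse c ^ r),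
    chg = chg D, scl = (\<lambda>i. scl D i * c powi wt D i), wt = wt D\<rparr>"

lemma vdil_sel [simp]:
  "lam (vdil c D) i r = lam D i r * c ^ r" "kap (vdil c D) i r = kap D i r * inverse c ^ r"
  "chg (vdil c D) = chg D" "scl (vdil c D) i = scl D i * c powi wt D i" "wt (vdil c D) = wt D"
  by (simp_all add: vdil_def)

lemma valid_vdil [simp]: "c \<noteq> 0 \<Longrightarrow> valid D \<Longrightarrow> valid (vdil c D)"
  by (simp add: valid_def)

lemma dilate_exp_fps:
  "dilate c (fps_to_fls (exp_fps h)) = fps_to_fls (exp_fps (\<lambda>r. cst (c ^ r) * h r :: 'k::comm_monoid_add vec))"
proof -
  define f where "f = Abs_fps (\<lambda>n. cst (c ^ n) * exp_fps h $ n)"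
  have "is_exp (Abs_fps (\<lambda>r. cst (c ^ r) * h r)) f"
    unfolding is_exp_def
  proof
    show "f $ 0 = 1" using is_exp_exp_fps[of h] by (simp add: f_def is_exp_def)
    show "fps_deriv f = fps_deriv (Abs_fps (\<lambda>r. cst (c ^ r) * h r)) * f"
    proof (rule fps_ext)
      fix n
      have "fps_deriv f $ n = cst (c ^ Suc n) * fps_deriv (exp_fps h) $ n"
        by (simp add: f_def mult_ac)
      also have "\<dots> = (\<Sum>i=0..n. cst (c ^ Suc n) * (fps_deriv (Abs_fps h) $ i * exp_fps h $ (n - i)))"
        using is_exp_exp_fps[of h] unfolding is_exp_def by (simp only: fps_mult_nth sum_distrib_left)
      also have "\<dots> = (fps_deriv (Abs_fps (\<lambda>r. cst (c ^ r) * h r)) * f) $ n"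
        unfolding fps_mult_nth
      proof (rule sum.cong)
        fix i assume "i \<in> {0..n}"
        then have "c ^ Suc n = c ^ Suc i * c ^ (n - i)"
          by (simp flip: power_add)
        then show "cst (c ^ Suc n) * (fps_deriv (Abs_fps h) $ i * exp_fps h $ (n - i)) =
            fps_deriv (Abs_fps (\<lambda>r. cst (c ^ r) * h r)) $ i * f $ (n - i)"
          by (simp only: f_def fps_deriv_nth fps_nth_Abs_fps cst_mult mult_ac Suc_eq_plus1)
      qed simp
      finally show "fps_deriv f $ n = (fps_deriv (Abs_fps (\<lambda>r. cst (c ^ r) * h r)) * f) $ n" .
    qed
  qed
  then have "f = exp_fps (\<lambda>r. cst (c ^ r) * h r)"
    by (rule exp_fps_unique) simp
  moreover have "dilate c (fps_to_fls (exp_fps h)) = fps_to_fls f"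
    by (rule fls_eqI) (simp add: dilate.rep_eq smul_cst f_def power_int_def)
  ultimately show ?thesis by simp
qed

lemma creat_vdil: "c \<noteq> 0 \<Longrightarrow> creat (vdil c D) = dilate c (creat D)"
  unfolding creat_def rhom.mult[OF rhom_dilate] dilate_const dilate_exp_fps vdil_sel
  by (simp add: sum_distrib_left cst_mult mult_ac)

lemma chi_vdil:
  assumes "c \<noteq> 0"
  shows "chi (vdil c D) b = dilate c (chi D b)"
proof -
  interpret d: rhom "dilate c :: ('a \<Rightarrow> fock) vec fls \<Rightarrow> _" by (rule rhom_dilate) fact
  have "chi1 (vdil c D) i k = dilate c (chi1 D i k)" for i k
  proof -
    have "c powi (- int (Suc r)) = inverse c ^ Suc r" for r
      by (simp add: power_int_minus power_inverse del: power_Suc of_nat_Suc)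
    then show ?thesis
      unfolding chi1_def d.mult d.add rhom_mon[OF d.rhom_axioms] dilate_const dilate_Zp vdil_sel
        power_int_mult_distrib rhom.mult[OF rhom_fcst] power_int_mult
      by (simp only: mult_ac)
  qed
  then show ?thesis
    by (simp add: chi_def d.mult d.prod dilate_const)
qed

lemma cur_dilate_vop:
  assumes "c \<noteq> 0"
  shows "cur_dilate c (vop D) = vop (vdil c D)"
proof
  fix v
  interpret d: rhom "dilate c :: ('a \<Rightarrow> fock) vec fls \<Rightarrow> _" by (rule rhom_dilate) fact
  show "cur_dilate c (vop D) v = vop (vdil c D) v"
    by (simp add: cur_dilate_def vop_def d.mult creat_vdil assms tau_def lin_ext_def d.sum chi_vdil fls_smul_cst dilate_const)
qed

section \<open>The current of the tensor power as a sum of vertex operators\<close>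

definition gen1 :: "nat \<Rightarrow> fock vec" where
  "gen1 r = Poly_Mapping.single (Poly_Mapping.single r 1, 0) 1"

definition lat1 :: "int \<Rightarrow> fock vec" where
  "lat1 n = Poly_Mapping.single (0, n) 1"

lemma lat1_add: "lat1 (m + n) = lat1 m * lat1 n"
  by (simp add: lat1_def mult_single)

lemma heis_minus_eq: "heis_minus r v = gen1 (r - 1) * v"
  by (simp add: heis_minus_def gen1_def)

lemma single_mon: "Poly_Mapping.single (\<mu>, 0) 1 = mon \<mu> gen1"
proof (induction \<mu> rule: update_induct)
  case const
  show ?case by (simp add: zero_prod_def[symmetric])
next
  case (update f a b)
  have 1: "Poly_Mapping.update a b f = Poly_Mapping.single a b + f"
    using update(1) by (auto intro!: poly_mapping_eqI simp: lookup_update lookup_add lookup_single when_def in_keys_iff)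
  have 2: "Poly_Mapping.single (Poly_Mapping.single a b, 0) 1 = gen1 a ^ b" for b
  proof (induction b)
    case 0
    show ?case by (simp add: zero_prod_def[symmetric])
  next
    case (Suc b)
    show ?case
      unfolding power_Suc Suc.IH[symmetric] by (simp add: gen1_def mult_single single_add[symmetric])
  qed
  show ?case
    unfolding 1 mon_add mon_single 2[symmetric] update(3)[symmetric] by (simp add: mult_single)
qed

lemma single_fock: "Poly_Mapping.single (\<mu>, n) 1 = lat1 n * mon \<mu> gen1"
  unfolding single_mon[symmetric] by (simp add: lat1_def mult_single)

lemma heis_plus_single:
  "heis_plus r (Poly_Mapping.single (\<mu>, n) c) = Poly_Mapping.single (\<mu> - Poly_Mapping.single (r - 1) 1, n)
      (c * (of_nat (Poly_Mapping.lookup \<mu> (r - 1)) * (qint (2 * r) * qint r / of_nat r)))"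
  unfolding heis_plus_def
  by (subst lin_ext_single) (simp_all add: smul_cst cst_def mult_single)

lemma heis_plus_add: "heis_plus r (v + w) = heis_plus r v + heis_plus r w"
  unfolding heis_plus_def by (rule lin_ext_add) (simp_all add: smul_cst cst_add distrib_right)

lemma heis_plus_smul: "heis_plus r (smul c v) = smul c (heis_plus r v)"
proof -
  interpret vector_space "smul :: F \<Rightarrow> fock vec \<Rightarrow> fock vec" by (rule vector_space_smul)
  have "lin_ext smul g (smul c v) = smul c (lin_ext smul g v)" for g :: "fock \<Rightarrow> fock vec"
    by (subst lin_ext_superset[of smul "Poly_Mapping.keys v"])
      (auto simp: in_keys_iff lin_ext_def scale_sum_right)
  then show ?thesis by (simp add: heis_plus_def)
qed

lemma additive_sum:
  fixes f :: "'a::comm_monoid_add \<Rightarrow> 'b::cancel_comm_monoid_add"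
  assumes "\<And>x y. f (x + y) = f x + f y"
  shows "f (sum g A) = (\<Sum>x\<in>A. f (g x))"
proof -
  have "f 0 = 0" using assms[of 0 0] by simp
  then show ?thesis
    by (induction A rule: infinite_finite_induct) (simp_all add: assms)
qed

lemmas heis_plus_sum = additive_sum[where f = "heis_plus r" for r, OF heis_plus_add]

text \<open>The Heisenberg relation: \<open>a(s)\<close> is a derivation with scalar values on the
  generators. If the exponent of the variable is zero, truncated subtraction leaves the monomial
  unchanged, but the coefficient vanishes.\<close>

lemma heis_plus_gen1:
  assumes "s \<ge> 1"
  shows "heis_plus s (gen1 r * v) = gen1 r * heis_plus s v +
    (if s = Suc r then smul (qint (2 * s) * qint s / of_nat s) v else 0)"
proof -
  have *: "heis_plus s (gen1 r * Poly_Mapping.single k c) = gen1 r * heis_plus s (Poly_Mapping.single k c) +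
    (if s = Suc r then smul (qint (2 * s) * qint s / of_nat s) (Poly_Mapping.single k c) else 0)" for k c
  proof -
    obtain \<mu> n where k: "k = (\<mu>, n)" by (cases k)
    obtain s' where s: "s = Suc s'" using assms by (cases s) auto
    show ?thesis
    proof (cases "s' = r")
      case True
      have 1: "Poly_Mapping.single r (Suc 0) + \<mu> - Poly_Mapping.single r (Suc 0) = \<mu>"
        by simp
      have 2: "Poly_Mapping.single r (Suc 0) + (\<mu> - Poly_Mapping.single r (Suc 0)) = \<mu>" if "Poly_Mapping.lookup \<mu> r \<noteq> 0"
        using that by (intro poly_mapping_eqI) (auto simp: lookup_add lookup_minus lookup_single when_def)
      show ?thesis
        unfolding k gen1_def mult_single heis_plus_single plus_prod_def fst_conv snd_conv
        using True s 1 2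
        by (cases "Poly_Mapping.lookup \<mu> r = 0")
          (auto simp: heis_plus_single mult_single smul_cst cst_def lookup_add algebra_simps add_divide_distrib single_add[symmetric])
    next
      case False
      have "Poly_Mapping.single r (Suc 0) + \<mu> - Poly_Mapping.single s' (Suc 0) =
         Poly_Mapping.single r (Suc 0) + (\<mu> - Poly_Mapping.single s' (Suc 0))"
        using False by (intro poly_mapping_eqI) (auto simp: lookup_add lookup_minus lookup_single when_def)
      then show ?thesis
        using False s by (simp add: k gen1_def mult_single heis_plus_single lookup_add lookup_single)
    qed
  qed
  note V = poly_mapping_sum_single[OF finite_keys subset_refl, of v]
  have "heis_plus s (gen1 r * v) = (\<Sum>k\<in>Poly_Mapping.keys v. heis_plus s (gen1 r * Poly_Mapping.single k (Poly_Mapping.lookup v k)))"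
    by (subst V) (simp only: sum_distrib_left heis_plus_sum)
  also have "\<dots> = (\<Sum>k\<in>Poly_Mapping.keys v. gen1 r * heis_plus s (Poly_Mapping.single k (Poly_Mapping.lookup v k)) +
    (if s = Suc r then smul (qint (2 * s) * qint s / of_nat s) (Poly_Mapping.single k (Poly_Mapping.lookup v k)) else 0))"
    by (simp only: *)
  also have "\<dots> = gen1 r * heis_plus s (\<Sum>k\<in>Poly_Mapping.keys v. Poly_Mapping.single k (Poly_Mapping.lookup v k)) +
    (if s = Suc r then smul (qint (2 * s) * qint s / of_nat s)
      (\<Sum>k\<in>Poly_Mapping.keys v. Poly_Mapping.single k (Poly_Mapping.lookup v k)) else 0)"
    by (cases "s = Suc r")
      (simp_all only: simp_thms if_True if_False add_0_right sum.distrib sum_distrib_left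
        heis_plus_sum smul_cst sum.neutral_const)
  finally show ?thesis
    unfolding V[symmetric] .
qed

lemma heis_plus_lat1: "s \<ge> 1 \<Longrightarrow> heis_plus s (lat1 n) = 0"
  by (simp add: lat1_def heis_plus_single)

section \<open>Exponentials of derivations as substitutions\<close>

definition op_pow_fps :: "(nat \<Rightarrow> 'k vec \<Rightarrow> 'k vec) \<Rightarrow> nat \<Rightarrow> 'k vec \<Rightarrow> 'k vec fps" where
  "op_pow_fps A k v = Abs_fps (\<lambda>n. op_pow A k n v)"

definition op_exp_fps :: "(nat \<Rightarrow> 'k vec \<Rightarrow> 'k vec) \<Rightarrow> 'k vec \<Rightarrow> 'k vec fps" where
  "op_exp_fps A v = Abs_fps (\<lambda>n. op_exp A n v)"

text \<open>With \<open>A(w)\<close> the sum of the \<open>A_s w^s\<close>, the hypothesis says that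
  the commutator of \<open>A(w)\<close> and \<open>g\<close> is the scalar \<open>x w^m\<close>; so
  that of \<open>A(w)^k\<close> and \<open>g\<close> is \<open>k x w^m A(w)^(k-1)\<close>.\<close>

lemma op_pow_fps_commute:
  fixes A :: "nat \<Rightarrow> 'k::comm_monoid_add vec \<Rightarrow> 'k vec"
  assumes add: "\<And>s v w. A s (v + w) = A s v + A s w" and sc: "\<And>s c v. A s (cst c * v) = cst c * A s v"
    and comm: "\<And>s v. s \<ge> 1 \<Longrightarrow> A s (g * v) = g * A s v + (if s = m then cst x * v else 0)" and m: "m \<ge> 1"
  shows "op_pow A k n (g * v) = g * op_pow A k n v +
    (if k = 0 \<or> n < m then 0 else cst (of_nat k * x) * op_pow A (k - 1) (n - m) v)"
proof (induction k arbitrary: n)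
  case 0
  show ?case by simp
next
  case (Suc k)
  let ?P = "\<lambda>k n. op_pow A k n v"
  have A0: "A s 0 = 0" for s
    using sc[of s 0 0] by simp
  have "op_pow A (Suc k) n (g * v) = (\<Sum>s=1..n. A s (g * ?P k (n - s) +
      (if k = 0 \<or> n - s < m then 0 else cst (of_nat k * x) * ?P (k - 1) (n - s - m))))"
    by (simp add: Suc.IH)
  also have "\<dots> = (\<Sum>s=1..n. g * A s (?P k (n - s)) + (if s = m then cst x * ?P k (n - s) else 0) +
      (if k = 0 \<or> n - s < m then 0 else cst (of_nat k * x) * A s (?P (k - 1) (n - s - m))))"
    by (rule sum.cong) (auto simp: add comm sc A0)
  also have "\<dots> = g * ?P (Suc k) n + (if n < m then 0 else cst x * ?P k (n - m)) +
      (\<Sum>s=1..n. if k = 0 \<or> n - s < m then 0 else cst (of_nat k * x) * A s (?P (k - 1) (n - s - m)))"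
    using m by (simp add: sum.distrib sum_distrib_left)
  also have "(\<Sum>s=1..n. if k = 0 \<or> n - s < m then 0 else cst (of_nat k * x) * A s (?P (k - 1) (n - s - m))) =
      (if k = 0 \<or> n < m then 0 else cst (of_nat k * x) * ?P k (n - m))"
  proof (cases "k = 0 \<or> n < m")
    case True
    then show ?thesis by (auto intro!: sum.neutral)
  next
    case False
    then obtain k' where k: "k = Suc k'" by (cases k) auto
    have "(\<Sum>s=1..n. if k = 0 \<or> n - s < m then 0 else cst (of_nat k * x) * A s (?P (k - 1) (n - s - m))) =
        (\<Sum>s=1..n - m. cst (of_nat k * x) * A s (?P k' (n - m - s)))"
      using False m by (intro sum.mono_neutral_cong_right) (auto simp: k add.commute)
    with False show ?thesis by (simp add: k sum_distrib_left)
  qed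
  also have "g * ?P (Suc k) n + (if n < m then 0 else cst x * ?P k (n - m)) +
      (if k = 0 \<or> n < m then 0 else cst (of_nat k * x) * ?P k (n - m)) =
      g * ?P (Suc k) n + (if n < m then 0 else cst (of_nat (Suc k) * x) * ?P k (n - m))"
    by (simp add: cst_add distrib_right)
  finally show ?case by simp
qed

lemma op_pow_gt:
  assumes "\<And>s. A s 0 = 0"
  shows "n < k \<Longrightarrow> op_pow A k n v = 0"
  using assms by (induction k arbitrary: n) (auto intro!: sum.neutral)

text \<open>Summing the commutators of the powers with weights \<open>1/k!\<close> cancels the
  factor \<open>k\<close>, and \<open>g\<close> turns into \<open>g + x w^m\<close> on passing the
  exponential. Over a whole monomial the annihilation exponential thus becomes a
  substitution.\<close>

lemma op_exp_fps_commute: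
  fixes A :: "nat \<Rightarrow> 'k::comm_monoid_add vec \<Rightarrow> 'k vec"
  assumes add: "\<And>s v w. A s (v + w) = A s v + A s w" and sc: "\<And>s c v. A s (cst c * v) = cst c * A s v"
    and comm: "\<And>s v. s \<ge> 1 \<Longrightarrow> A s (g * v) = g * A s v + (if s = m then cst x * v else 0)" and m: "m \<ge> 1"
  shows "op_exp_fps A (g * v) = (fps_const g + fps_const (cst x) * fps_X ^ m) * op_exp_fps A v"
proof (rule fps_ext)
  fix n
  have A0: "A s 0 = 0" for s
    using sc[of s 0 0] by simp
  define c :: "nat \<Rightarrow> F" where "c k = inverse (of_nat (fact k))" for k
  have c: "c (Suc k) * of_nat (Suc k) = c k" for k
  proof -
    have *: "of_nat (fact (Suc k)) = of_nat (Suc k) * (of_nat (fact k) :: F)"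
      by (simp only: fact_Suc of_nat_mult of_nat_id)
    show ?thesis
      unfolding c_def * by (simp del: of_nat_Suc of_nat_fact)
  qed
  have E: "op_exp A n v = (\<Sum>k\<le>N. cst (c k) * op_pow A k n v)" if "n \<le> N" for n N v
    unfolding op_exp_def smul_cst c_def
    by (rule sum.mono_neutral_left) (use that op_pow_gt[of A, OF A0] in auto)
  \<comment> \<open>The sum gets one more term than the coefficient of \<open>w^n\<close> has, so
    that the term \<open>k = 0\<close> can be split off and the rest re-indexed over
    \<open>k \<le> n\<close>.\<close>
  note E1 = E[of n "Suc n", OF le_SucI[OF le_refl]]
  have P: "op_pow A k n (g * v) = g * op_pow A k n v +
    (if k = 0 \<or> n < m then 0 else cst (of_nat k * x) * op_pow A (k - 1) (n - m) v)" for k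
    by (rule op_pow_fps_commute[OF assms])
  have "op_exp A n (g * v) = (\<Sum>k\<le>Suc n. cst (c k) * (g * op_pow A k n v)) +
     (\<Sum>k\<le>Suc n. if k = 0 \<or> n < m then 0 else cst (c k * (of_nat k * x)) * op_pow A (k - 1) (n - m) v)"
    unfolding E1 P sum.distrib[symmetric]
    by (intro sum.cong refl) (auto simp: distrib_left cst_mult mult_ac)
  also have "(\<Sum>k\<le>Suc n. cst (c k) * (g * op_pow A k n v)) = g * op_exp A n v"
    unfolding E1[of v] sum_distrib_left by (simp only: mult_ac)
  also have "(\<Sum>k\<le>Suc n. if k = 0 \<or> n < m then 0 else cst (c k * (of_nat k * x)) * op_pow A (k - 1) (n - m) v) =
     (if n < m then 0 else cst x * op_exp A (n - m) v)"
  proof (cases "n < m")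
    case False
    have "c (Suc k) * (of_nat (Suc k) * x) = x * c k" for k
      using c[of k] by (metis mult.assoc mult.commute)
    then have "(\<Sum>k\<le>n. cst (c (Suc k) * (of_nat (Suc k) * x)) * op_pow A k (n - m) v) = cst x * op_exp A (n - m) v"
      unfolding E[OF diff_le_self, of n m v] sum_distrib_left by (simp only: cst_mult mult.assoc)
    with False show ?thesis
      by (subst sum.atMost_Suc_shift) (simp del: of_nat_Suc)
  qed (simp add: sum.neutral)
  finally show "op_exp_fps A (g * v) $ n = ((fps_const g + fps_const (cst x) * fps_X ^ m) * op_exp_fps A v) $ n"
    by (simp add: op_exp_fps_def distrib_right mult.assoc fps_X_power_mult_nth)
qed

lemma op_exp_fps_mon:
  fixes A :: "nat \<Rightarrow> 'k::comm_monoid_add vec \<Rightarrow> 'k vec"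
  assumes "\<And>s v w. A s (v + w) = A s v + A s w" "\<And>s c v. A s (cst c * v) = cst c * A s v"
    and "\<And>r s v. s \<ge> 1 \<Longrightarrow> A s (g r * v) = g r * A s v + (if s = Suc r then cst (x s) * v else 0)"
  shows "op_exp_fps A (mon \<mu> g * v) =
    mon \<mu> (\<lambda>r. fps_const (g r) + fps_const (cst (x (Suc r))) * fps_X ^ Suc r) * op_exp_fps A v"
proof -
  let ?y = "\<lambda>r. fps_const (g r) + fps_const (cst (x (Suc r))) * fps_X ^ Suc r"
  have 1: "op_exp_fps A (g r * v) = ?y r * op_exp_fps A v" for r v
    by (rule op_exp_fps_commute) (auto simp: assms)
  have 2: "op_exp_fps A (g r ^ n * v) = ?y r ^ n * op_exp_fps A v" for r n v
    by (induction n) (simp_all only: power_0 mult_1_left power_Suc mult.assoc 1)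
  have 3: "finite R \<Longrightarrow> op_exp_fps A ((\<Prod>r\<in>R. g r ^ e r) * v) = (\<Prod>r\<in>R. ?y r ^ e r) * op_exp_fps A v" for R e v
    by (induction R rule: finite_induct) (simp_all only: prod.empty prod.insert mult_1_left mult.assoc 2 simp_thms)
  show ?thesis
    unfolding mon_def by (rule 3) simp
qed

text \<open>The coefficient of \<open>a(r)\<close> in the annihilation exponent times the Heisenberg
  bracket of \<open>a(r)\<close> and \<open>a(-r)\<close>.\<close>

definition plus_kap :: "nat \<Rightarrow> F" where
  "plus_kap r = - (inverse qh ^ r / qint r) * (qint (2 * r) * qint r / of_nat r)"

lemma x_exp_plus_fps:
  "Abs_fps (\<lambda>j. x_exp_plus j (Poly_Mapping.single (\<mu>, n) 1)) =
    fps_const (lat1 n) * mon \<mu> (\<lambda>r. fps_const (gen1 r) + fps_const (cst (plus_kap (Suc r))) * fps_X ^ Suc r)"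
proof -
  define A :: "nat \<Rightarrow> fock vec \<Rightarrow> fock vec" where "A = (\<lambda>r v. smul (- (inverse qh ^ r / qint r)) (heis_plus r v))"
  have 1: "A s (v + w) = A s v + A s w" for s v w
    by (simp add: A_def heis_plus_add smul_cst distrib_left)
  have 2: "A s (cst c * v) = cst c * A s v" for s c v
    unfolding A_def heis_plus_smul[unfolded smul_cst] smul_cst by (simp only: mult_ac)
  have 3: "A s (gen1 r * v) = gen1 r * A s v + (if s = Suc r then cst (plus_kap s) * v else 0)" if "s \<ge> 1" for r s v
    unfolding A_def heis_plus_gen1[OF that]
    by (cases "s = Suc r")
      (simp_all only: simp_thms if_True if_False add_0_right smul_cst distrib_left plus_kap_def cst_mult mult_ac mult_zero_right)
  have A0: "A s 0 = 0" for s
    using 2[of s 0 0] by simp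
  have "op_pow A k m (lat1 n) = 0" if "k > 0" for k m
    using that
  proof (induction k arbitrary: m)
    case (Suc k)
    show ?case
    proof (cases "k = 0")
      case True
      have "A r (lat1 n) = 0" if "r \<ge> 1" for r
        by (simp add: A_def heis_plus_lat1[OF that])
      then show ?thesis by (auto simp: True A0 intro!: sum.neutral)
    next
      case False
      then show ?thesis by (simp add: Suc.IH A0)
    qed
  qed simp
  then have "op_exp A m (lat1 n) = (\<Sum>k\<le>m. if k = 0 then (if m = 0 then lat1 n else 0) else 0)" for m
    unfolding op_exp_def by (intro sum.cong) (auto simp: smul_cst)
  then have "op_exp_fps A (lat1 n) = fps_const (lat1 n)"
    by (intro fps_ext) (simp add: op_exp_fps_def)
  then show ?thesis
    using op_exp_fps_mon[where A = A and g = gen1 and x = plus_kap and \<mu> = \<mu> and v = "lat1 n", OF 1 2 3]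
    by (simp add: single_fock mult.commute op_exp_fps_def x_exp_plus_def A_def)
qed

text \<open>The Laurent series \<open>f\<close> arises from the power series \<open>p\<close> by $w\mapsto z^{-1}$.\<close>

definition flips :: "'a::zero fps \<Rightarrow> 'a fls \<Rightarrow> bool" where
  "flips p f \<longleftrightarrow> (\<forall>j. f $$ (- int j) = p $ j) \<and> (\<forall>n>0. f $$ n = 0)"

lemma flips_const: "flips (fps_const c) (fls_const c)"
  by (auto simp: flips_def)

lemma flips_add: "flips p f \<Longrightarrow> flips p' f' \<Longrightarrow> flips (p + p') (f + f' :: 'a::comm_monoid_add fls)"
  by (auto simp: flips_def)

lemma flips_mult:
  fixes f f' :: "'a::comm_ring_1 fls"
  assumes "flips p f" "flips p' f'"
  shows "flips (p * p') (f * f')"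
  unfolding flips_def
proof (intro conjI allI impI)
  define M where "M = min 0 (min (fls_subdegree f) (fls_subdegree f'))"
  have 0: "f $$ i = 0" "f' $$ i = 0" if "i < M" for i
    using that by (auto simp: M_def)
  have pos: "f $$ i = 0" "f' $$ i = 0" if "i > 0" for i
    using that assms by (auto simp: flips_def)
  have neg: "f $$ (- int i) = p $ i" "f' $$ (- int i) = p' $ i" for i
    using assms by (auto simp: flips_def)
  show "(f * f') $$ n = 0" if "n > 0" for n
  proof -
    have "f $$ i * f' $$ (n - i) = 0" for i
      using that pos(1)[of i] pos(2)[of "n - i"] by (cases "i > 0") auto
    then show ?thesis
      by (subst fls_times_nth_lower[of M _ M]) (simp_all add: 0)
  qed
  fix j
  have "(f * f') $$ (- int j) = (\<Sum>i=M..- int j - M. f $$ i * f' $$ (- int j - i))"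
    by (rule fls_times_nth_lower) (simp_all add: 0)
  also have "\<dots> = (\<Sum>i=- int j..0. f $$ i * f' $$ (- int j - i))"
  proof (rule sum.mono_neutral_cong)
    fix i assume "i \<in> {M..- int j - M} - {- int j..0}"
    then show "f $$ i * f' $$ (- int j - i) = 0"
      using pos(1)[of i] pos(2)[of "- int j - i"] by (cases "i > 0") auto
  next
    fix i assume "i \<in> {- int j..0} - {M..- int j - M}"
    then show "f $$ i * f' $$ (- int j - i) = 0"
      using 0(1)[of i] 0(2)[of "- int j - i"] by (cases "i < M") auto
  qed auto
  also have "\<dots> = (\<Sum>i=0..j. p $ i * p' $ (j - i))"
  proof (rule sum.reindex_bij_witness[where i = "\<lambda>i. - int i" and j = "\<lambda>i. nat (- i)"])
    fix i assume i: "i \<in> {- int j..0}"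
    define k where "k = nat (- i)"
    have k: "i = - int k" "k \<le> j" using i by (auto simp: k_def)
    then have e: "- int j - i = - int (j - k)" by simp
    show "p $ nat (- i) * p' $ (j - nat (- i)) = f $$ i * f' $$ (- int j - i)"
      unfolding k_def[symmetric] e neg unfolding k(1) neg ..
  qed auto
  finally show "(f * f') $$ (- int j) = (p * p') $ j"
    by (simp add: fps_mult_nth)
qed

lemma flips_power:
  fixes f :: "'a::comm_ring_1 fls"
  assumes "flips p f" shows "flips (p ^ n) (f ^ n)"
proof (induction n)
  case 0
  show ?case using flips_const[of 1] by simp
qed (simp add: flips_mult assms)

lemma flips_mon:
  fixes f :: "nat \<Rightarrow> 'a::comm_ring_1 fls"
  assumes "\<And>r. flips (p r) (f r)" shows "flips (mon \<mu> p) (mon \<mu> f)"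
proof -
  have "flips (\<Prod>r\<in>R. p r ^ e r) (\<Prod>r\<in>R. f r ^ e r)" for R e
  proof (induction R rule: infinite_finite_induct)
    case (insert x F)
    then show ?case by (simp add: flips_mult flips_power assms)
  qed (use flips_const[of "1::'a"] in simp_all)
  then show ?thesis by (simp add: mon_def)
qed

lemma flips_X: "flips (fps_X ^ n) (Zp (- int n) :: 'a::comm_ring_1 fls)"
  by (auto simp: flips_def fps_X_power_iff)

text \<open>The right-hand side has the form of the sum over \<open>j\<close> that defines
  \<open>x_plus\<close>: the annihilation part contributes \<open>z^-j\<close> and the creation part
  \<open>z^(N+j)\<close>.\<close>

lemma times_flips_nth:
  fixes f :: "'a::comm_ring_1 fls"
  assumes "flips p f"
  shows "(fps_to_fls e * f) $$ N =
    Sum_any (\<lambda>j. if N + int j \<ge> 0 then e $ nat (N + int j) * p $ j else 0)"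
proof -
  define M where "M = min 0 (fls_subdegree f)"
  have M0: "M \<le> 0" by (simp add: M_def)
  have 0: "f $$ i = 0" if "i < M" for i using that by (auto simp: M_def)
  have pos: "f $$ i = 0" if "i > 0" for i using that assms by (auto simp: flips_def)
  have neg: "f $$ (- int i) = p $ i" for i using assms by (auto simp: flips_def)
  have e0: "fps_to_fls e $$ i = 0" if "i < 0" for i using that by simp
  have "(fps_to_fls e * f) $$ N = (f * fps_to_fls e) $$ N" by (simp only: mult.commute)
  also have "\<dots> = (\<Sum>i=M..N - 0. f $$ i * fps_to_fls e $$ (N - i))"
    by (rule fls_times_nth_lower) (simp_all add: 0)
  also have "\<dots> = (\<Sum>i=M..0. f $$ i * fps_to_fls e $$ (N - i))"
    by (rule sum.mono_neutral_cong) (auto simp: pos)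
  also have "\<dots> = (\<Sum>j=0..nat (- M). if N + int j \<ge> 0 then e $ nat (N + int j) * p $ j else 0)"
  proof (rule sum.reindex_bij_witness[where i = "\<lambda>j. - int j" and j = "\<lambda>i. nat (- i)"])
    fix i assume i: "i \<in> {M..0}"
    define k where "k = nat (- i)"
    have k: "i = - int k" using i by (auto simp: k_def)
    show "(if 0 \<le> N + int (nat (- i)) then e $ nat (N + int (nat (- i))) * p $ nat (- i) else 0) =
         f $$ i * fps_to_fls e $$ (N - i)"
      unfolding k_def[symmetric] by (simp add: k neg mult.commute)
  qed (use M0 in auto)
  also have "\<dots> = Sum_any (\<lambda>j. if N + int j \<ge> 0 then e $ nat (N + int j) * p $ j else 0)"
  proof (rule Sum_any.expand_superset[symmetric])
    show "{j. (if N + int j \<ge> 0 then e $ nat (N + int j) * p $ j else 0) \<noteq> 0} \<subseteq> {0..nat (- M)}"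
    proof
      fix j assume "j \<in> {j. (if N + int j \<ge> 0 then e $ nat (N + int j) * p $ j else 0) \<noteq> 0}"
      then have "f $$ (- int j) \<noteq> 0" by (auto simp: neg split: if_splits)
      then have "\<not> - int j < M" using 0 by blast
      then show "j \<in> {0..nat (- M)}" by auto
    qed
  qed simp
  finally show ?thesis .
qed

section \<open>The Frenkel-Jing currents on basis vectors\<close>

definition plus_lam :: "nat \<Rightarrow> F" where
  "plus_lam r = inverse qh ^ r / qint r"

lemma x_exp_minus_eq: "x_exp_minus n v = exp_fps (\<lambda>r. cst (plus_lam r) * gen1 (r - 1)) $ n * v"
proof -
  have "x_exp_minus = op_exp (\<lambda>r v. (cst (plus_lam r) * gen1 (r - 1)) * v)"
    unfolding x_exp_minus_def heis_minus_eq smul_cst plus_lam_def mult.assoc ..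
  show ?thesis
    unfolding \<open>x_exp_minus = _\<close> by (rule op_exp_mult)
qed

lemma x_plus_single:
  "x_plus (Poly_Mapping.single (\<mu>, n) 1) =
    fls_const (lat1 1) * fps_to_fls (exp_fps (\<lambda>r. cst (plus_lam r) * gen1 (r - 1))) *
    (fls_const (lat1 n) * (Zp (2 * n) * mon \<mu> (\<lambda>r. fls_const (gen1 r) + fcst (plus_kap (Suc r)) * Zp (- int (Suc r)))))"
proof -
  define E where "E = exp_fps (\<lambda>r. cst (plus_lam r) * gen1 (r - 1))"
  define p where "p = Abs_fps (\<lambda>j. x_exp_plus j (Poly_Mapping.single (\<mu>, n + 1) 1))"
  define f where "f = fls_const (lat1 (n + 1)) * mon \<mu> (\<lambda>r. fls_const (gen1 r) + fcst (plus_kap (Suc r)) * Zp (- int (Suc r)))"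
  have "flips p f"
    unfolding p_def f_def x_exp_plus_fps
    by (intro flips_mult flips_const flips_mon flips_add flips_X)
  note * = times_flips_nth[OF this, of E]
  have "x_plus (Poly_Mapping.single (\<mu>, n) 1) = Abs_fls (\<lambda>N. Sum_any (\<lambda>j::nat.
    if N + int j - 2 * n \<ge> 0 then x_exp_minus (nat (N + int j - 2 * n))
           (x_exp_plus j (Poly_Mapping.single (\<mu>, n + 1) 1)) else 0))"
    unfolding x_plus_def by (subst lin_ext_single) (simp_all add: fls_smul_cst)
  also have "\<dots> = Abs_fls (\<lambda>N. (Zp (2 * n) * (fps_to_fls E * f)) $$ N)"
  proof -
    have "(if N + int j - 2 * n \<ge> 0 then x_exp_minus (nat (N + int j - 2 * n))
           (x_exp_plus j (Poly_Mapping.single (\<mu>, n + 1) 1)) else 0) =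
        (if N - 2 * n + int j \<ge> 0 then E $ nat (N - 2 * n + int j) * p $ j else 0)" for N j
    proof -
      have eq: "N + int j - 2 * n = N - 2 * n + int j" by simp
      show ?thesis unfolding eq x_exp_minus_eq E_def p_def fps_nth_Abs_fps ..
    qed
    then show ?thesis unfolding Zp_times_nth * by (simp only:)
  qed
  also have "\<dots> = Zp (2 * n) * (fps_to_fls E * f)"
    by (rule fls_nth_inverse)
  finally show ?thesis
    unfolding f_def E_def[symmetric] add.commute[of n 1] lat1_add rhom.mult[OF rhom_fls_const] by (simp only: mult_ac)
qed

definition phi_lam :: "nat \<Rightarrow> F" where
  "phi_lam r = - (q - inverse q)"

lemma phi_single:
  "phi (Poly_Mapping.single (\<mu>, n) 1) =
    fps_to_fls (exp_fps (\<lambda>r. cst (phi_lam r) * gen1 (r - 1))) *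
    (fls_const (lat1 n) * (fcst (q powi (- 2 * n)) * mon \<mu> (\<lambda>r. fls_const (gen1 r))))"
proof -
  define E where "E = exp_fps (\<lambda>r. cst (phi_lam r) * gen1 (r - 1))"
  define w where "w = Poly_Mapping.single (\<mu>, n) (1::F)"
  have *: "op_exp (\<lambda>r v. smul (- (q - inverse q)) (heis_minus r v)) k v = E $ k * v" for k v
    unfolding E_def op_exp_mult[symmetric] heis_minus_eq smul_cst phi_lam_def mult.assoc ..
  have "phi w = Abs_fls (\<lambda>N. if N \<ge> 0 then smul (q powi (- 2 * n)) (E $ nat N * w) else 0)"
    unfolding phi_def w_def * by (subst lin_ext_single) (simp_all add: fls_smul_cst)
  also have "\<dots> = Abs_fls (\<lambda>N. (fps_to_fls E * (fls_const w * fcst (q powi (- 2 * n)))) $$ N)"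
  proof (rule arg_cong[where f = Abs_fls], rule ext)
    fix N
    have "(fps_to_fls E * (fls_const w * fcst (q powi (- 2 * n)))) $$ N = (fcst (q powi (- 2 * n)) * (fls_const w * fps_to_fls E)) $$ N"
      by (simp only: mult_ac)
    then show "(if N \<ge> 0 then smul (q powi (- 2 * n)) (E $ nat N * w) else 0) =
        (fps_to_fls E * (fls_const w * fcst (q powi (- 2 * n)))) $$ N"
      by (simp only: fls_const_times_nth) (simp add: smul_cst mult_ac)
  qed
  also have "\<dots> = fps_to_fls E * (fls_const w * fcst (q powi (- 2 * n)))"
    by (rule fls_nth_inverse)
  finally show ?thesis
    unfolding w_def single_fock[of \<mu> n] E_def[symmetric] rhom.mult[OF rhom_fls_const] rhom_mon[OF rhom_fls_const]
    by (simp only: mult_ac)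
qed

section \<open>Embedding of one tensor factor\<close>

lemma monoid_char_embed:
  "monoid_char cst smul (\<lambda>k. Poly_Mapping.single ((\<lambda>_. 0)(i := k)) 1 :: ('c \<Rightarrow> fock) vec)"
proof
  fix k l :: fock
  have "(\<lambda>_. 0)(i := k + l) = (\<lambda>_. 0)(i := k) + (\<lambda>_::'c. 0)(i := l)"
    by (auto simp: fun_eq_iff)
  then show "(Poly_Mapping.single ((\<lambda>_. 0)(i := k + l)) 1 :: ('c \<Rightarrow> fock) vec) =
     Poly_Mapping.single ((\<lambda>_. 0)(i := k)) 1 * Poly_Mapping.single ((\<lambda>_. 0)(i := l)) 1"
    by (simp add: mult_single)
  have "(\<lambda>_. 0)(i := 0) = (0 :: 'c \<Rightarrow> fock)" by (auto simp: zero_fun_def)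
  then show "(Poly_Mapping.single ((\<lambda>_. 0)(i := 0)) 1 :: ('c \<Rightarrow> fock) vec) = 1" by simp
qed (use rhom_cst in \<open>auto simp: smul_cst rhom_def\<close>)

lemma rhom_embed: "rhom (embed i)"
  unfolding embed_def by (rule monoid_char.rhom_ext[OF monoid_char_embed])

lemma embed_cst: "embed i (cst c) = cst c"
  unfolding embed_def by (rule monoid_char.ext_cst[OF monoid_char_embed])

lemma embed_single: "embed i (Poly_Mapping.single k 1) = Poly_Mapping.single ((\<lambda>_. 0)(i := k)) 1"
  unfolding embed_def by (simp add: monoid_char.ext_single[OF monoid_char_embed])

lemma embed_gen1: "embed i (gen1 r) = gen i r"
  by (simp add: gen1_def gen_def embed_single)

definition site :: "'c \<Rightarrow> int \<Rightarrow> 'c \<Rightarrow> int" where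
  "site i n = (\<lambda>j. if j = i then n else 0)"

lemma embed_lat1: "embed i (lat1 n) = lat (site i n)"
proof -
  have "(\<lambda>_. 0)(i := (0, n)) = (\<lambda>j. (0::nat \<Rightarrow>\<^sub>0 nat, site i n j))"
    by (auto simp: site_def zero_prod_def)
  then show ?thesis
    by (simp add: lat1_def lat_def embed_single)
qed

lemma embed_fls_eq: "embed_fls i = fls_map (embed i)"
  by (rule ext, rule fls_eqI) (simp add: embed_fls.rep_eq fls_map_nth rhom.zero[OF rhom_embed])

lemma rhom_embed_fls: "rhom (embed_fls i)"
  unfolding embed_fls_eq by (rule rhom_fls_map[OF rhom_embed])

lemma embed_fls_const: "embed_fls i (fls_const v) = fls_const (embed i v)"
  unfolding embed_fls_eq by (rule fls_map_const) (rule rhom.zero[OF rhom_embed])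

lemma embed_fls_Zp: "embed_fls i (Zp n) = Zp n"
  unfolding embed_fls_eq by (rule fls_map_Zp[OF rhom_embed])

lemma embed_fls_exp:
  "embed_fls i (fps_to_fls (exp_fps (\<lambda>r. cst (f r) * gen1 (r - 1)))) =
    fps_to_fls (exp_fps (\<lambda>r. cst (f r) * gen i (r - 1)))"
proof -
  interpret rhom "embed i :: _ \<Rightarrow> ('a \<Rightarrow> fock) vec" by (rule rhom_embed)
  have "fps_map (embed i) (exp_fps (\<lambda>r. cst (f r) * gen1 (r - 1))) = exp_fps (\<lambda>r. cst (f r) * gen i (r - 1))"
    by (rule exp_fps_unique[OF is_exp_map[OF rhom_axioms is_exp_exp_fps]])
      (simp add: fps_eq_iff mult embed_cst embed_gen1)
  then show ?thesis
    by (simp add: embed_fls_eq fls_map_fps_to_fls zero)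
qed

lemma embed_fls_mon: "embed_fls i (mon \<mu> f) = mon \<mu> (\<lambda>r. embed_fls i (f r))"
  by (rule rhom_mon[OF rhom_embed_fls])

lemma embed_fls_dilate: "c \<noteq> 0 \<Longrightarrow> embed_fls i (dilate c f) = dilate c (embed_fls i f)"
  by (rule fls_eqI) (simp add: embed_fls.rep_eq dilate.rep_eq smul_cst rhom.mult[OF rhom_embed] embed_cst)

lemma qh_neq_0 [simp]: "qh \<noteq> 0"
  by (simp add: qh_def Zero_fract_def eq_fract)

lemma q_neq_0 [simp]: "q \<noteq> 0" "Q \<noteq> 0"
  by (simp_all add: q_def Q_def)

text \<open>A position \<open>i < l\<close> carries \<open>phi\<close> at
  \<open>z q^(pos i + 1/2)\<close>: a creation exponential and, from \<open>K^-1\<close>, a factor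
  \<open>q^-2\<close> for each lattice step. Position \<open>l\<close> carries \<open>x_plus\<close>
  at \<open>z q^(pos l)\<close>, where the operator \<open>z^\<partial>\<close> produces the weight
  2 and the scale \<open>q^(2 pos l)\<close>.\<close>

definition x_data :: "'c::{finite, linorder} \<Rightarrow> 'c vdata" where
  "x_data l = \<lparr>
    lam = (\<lambda>i r. if i < l then phi_lam r * (qh ^ (2 * pos i + 1)) ^ r
                 else if i = l then plus_lam r * (q ^ pos l) ^ r else 0),
    kap = (\<lambda>i r. if i = l then plus_kap r * inverse (q ^ pos l) ^ r else 0),
    chg = (\<lambda>i. if i = l then 1 else 0),
    scl = (\<lambda>i. if i < l then q powi (- 2) else if i = l then (q ^ pos l) powi 2 else 1),
    wt = (\<lambda>i. if i = l then 2 else 0)\<rparr>"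

lemma valid_x_data [simp]: "valid (x_data l)"
  by (simp add: valid_def x_data_def)

lemma lat_sum: "lat (\<lambda>j. \<Sum>i\<in>A. f i j) = (\<Prod>i\<in>A. lat (f i))"
  by (induction A rule: infinite_finite_induct) (simp_all add: lat_0 lat_add)

lemma lat_sites: "lat n = (\<Prod>i\<in>UNIV. lat (site i (n i) :: 'c::finite \<Rightarrow> int))"
  unfolding lat_sum[symmetric] by (rule arg_cong[where f = lat]) (simp add: site_def)

lemma exp_fps_0: "exp_fps (\<lambda>r. 0) = (1 :: 'k::comm_monoid_add vec fps)"
  by (rule exp_fps_unique[symmetric, of 0]) (simp_all add: is_exp_def fps_eq_iff)

lemma exp_fps_sum: "exp_fps (\<lambda>r. \<Sum>i\<in>A. h i r) = (\<Prod>i\<in>A. exp_fps (h i) :: 'k::comm_monoid_add vec fps)"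
proof (induction A rule: infinite_finite_induct)
  case (insert x A)
  have "exp_fps (h x) * exp_fps (\<lambda>r. \<Sum>i\<in>A. h i r) = exp_fps (\<lambda>r. \<Sum>i\<in>insert x A. h i r)"
    by (rule exp_fps_unique[OF is_exp_add[OF is_exp_exp_fps is_exp_exp_fps]])
      (rule arg_cong[where f = fps_deriv], rule fps_ext, simp add: insert)
  then show ?case using insert by simp
qed (simp_all add: exp_fps_0)

lemma fps_to_fls_prod: "fps_to_fls (prod f A) = (\<Prod>i\<in>A. fps_to_fls (f i :: 'a::comm_ring_1 fps))"
  by (induction A rule: infinite_finite_induct) (simp_all add: fls_times_fps_to_fls)

lemma vop_single_sites:
  assumes "valid D"
  shows "creat D * chi D b = (\<Prod>i\<in>UNIV.
    (fls_const (lat (site i (chg D i))) * fps_to_fls (exp_fps (\<lambda>r. cst (lam D i r) * gen i (r - 1)))) *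
    (fls_const (lat (site i (snd (b i)))) * chi1 D i (b i)))"
  unfolding creat_def chi_def lat_sites[of "chg D"] lat_sites[of "\<lambda>i. snd (b i)"] exp_fps_sum fps_to_fls_prod
    rhom.prod[OF rhom_fls_const] prod.distrib by (simp only: mult_ac)

lemma embed_x_plus:
  "embed_fls i (x_plus (Poly_Mapping.single k 1)) =
    (fls_const (lat (site i 1)) * fps_to_fls (exp_fps (\<lambda>r. cst (plus_lam r) * gen i (r - 1)))) *
    (fls_const (lat (site i (snd k))) * (Zp (2 * snd k) * mon (fst k) (\<lambda>r. fls_const (gen i r) + fcst (plus_kap (Suc r)) * Zp (- int (Suc r)))))"
  by (cases k)
    (simp only: x_plus_single rhom.mult[OF rhom_embed_fls] rhom.add[OF rhom_embed_fls] embed_fls_mon embed_fls_const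
      embed_lat1 embed_gen1 embed_cst embed_fls_exp embed_fls_Zp fst_conv snd_conv)

lemma embed_phi:
  "embed_fls i (phi (Poly_Mapping.single k 1)) =
    fps_to_fls (exp_fps (\<lambda>r. cst (phi_lam r) * gen i (r - 1))) *
    (fls_const (lat (site i (snd k))) * (fcst (q powi (- 2 * snd k)) * mon (fst k) (\<lambda>r. fls_const (gen i r))))"
  by (cases k)
    (simp only: phi_single rhom.mult[OF rhom_embed_fls] embed_fls_mon embed_fls_const
      embed_lat1 embed_gen1 embed_cst embed_fls_exp fst_conv snd_conv)

lemma embed_single_sites: "embed i (Poly_Mapping.single k 1) = lat (site i (snd k)) * mon (fst k) (gen i)"
  by (cases k) (simp only: single_fock rhom.mult[OF rhom_embed] rhom_mon[OF rhom_embed] embed_lat1 embed_gen1 fst_conv snd_conv)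

text \<open>Both sides are linear, and on a basis vector both factor over the tensor positions;
  \<open>site\<close> compares the factors in the cases \<open>i < l\<close>, \<open>i = l\<close>
  and \<open>i > l\<close>.\<close>

lemma x_cur_eq: "(x_cur :: ('c::{finite, linorder} \<Rightarrow> fock) cur) = (\<Sum>l\<in>UNIV. vop (x_data l))"
  unfolding x_cur_def
proof (rule sum.cong)
  fix l :: 'c
  let ?A = "\<lambda>i. if i < l then cur_dilate (qh ^ (2 * pos i + 1)) phi
    else if i = l then cur_dilate (q ^ pos l) x_plus else fls_const"
  have site: "embed_fls i (?A i (Poly_Mapping.single k 1)) =
    (fls_const (lat (site i (chg (x_data l) i))) * fps_to_fls (exp_fps (\<lambda>r. cst (lam (x_data l) i r) * gen i (r - 1)))) *
    (fls_const (lat (site i (snd k))) * chi1 (x_data l) i k)" for i k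
  proof -
    consider "i < l" | "i = l" | "i > l" by force
    then show ?thesis
    proof cases
      case 1
      define c where "c = qh ^ (2 * pos i + 1)"
      have c: "c \<noteq> 0" by (simp add: c_def)
      interpret d: rhom "dilate c :: ('c \<Rightarrow> fock) vec fls \<Rightarrow> _" by (rule rhom_dilate[OF c])
      have x: "chg (x_data l) i = 0" "lam (x_data l) i r = c ^ r * phi_lam r" "kap (x_data l) i r = 0"
        "scl (x_data l) i = q powi (- 2)" "wt (x_data l) i = 0" for r
        using 1 by (simp_all add: x_data_def c_def)
      have s0: "lat (site i 0) = 1" by (simp add: site_def lat_0)
      have "embed_fls i (?A i (Poly_Mapping.single k 1)) = dilate c (embed_fls i (phi (Poly_Mapping.single k 1)))"
        using 1 by (simp add: cur_dilate_def embed_fls_dilate c c_def)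
      also have "\<dots> = fps_to_fls (exp_fps (\<lambda>r. cst (c ^ r * phi_lam r) * gen i (r - 1))) *
        (fls_const (lat (site i (snd k))) * (fcst (q powi (- 2 * snd k)) * mon (fst k) (\<lambda>r. fls_const (gen i r))))"
        unfolding embed_phi d.mult dilate_const rhom_mon[OF d.rhom_axioms] dilate_exp_fps cst_mult mult.assoc ..
      finally show ?thesis
        unfolding x chi1_def s0 power_int_mult[symmetric] by simp
    next
      case 2
      define c where "c = q ^ pos i"
      have c: "c \<noteq> 0" by (simp add: c_def)
      interpret d: rhom "dilate c :: ('c \<Rightarrow> fock) vec fls \<Rightarrow> _" by (rule rhom_dilate[OF c])
      have x: "chg (x_data l) i = 1" "lam (x_data l) i r = c ^ r * plus_lam r" "kap (x_data l) i r = plus_kap r * c powi (- int r)"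
        "scl (x_data l) i = c powi 2" "wt (x_data l) i = 2" for r
        using 2 by (simp_all add: x_data_def c_def power_int_minus power_inverse)
      have "embed_fls i (?A i (Poly_Mapping.single k 1)) = dilate c (embed_fls i (x_plus (Poly_Mapping.single k 1)))"
        using 2 by (simp add: cur_dilate_def embed_fls_dilate c c_def)
      also have "\<dots> = (fls_const (lat (site i 1)) * fps_to_fls (exp_fps (\<lambda>r. cst (c ^ r * plus_lam r) * gen i (r - 1)))) *
        (fls_const (lat (site i (snd k))) * (fcst (c powi (2 * snd k)) * Zp (2 * snd k) *
          mon (fst k) (\<lambda>r. fls_const (gen i r) + fcst (plus_kap (Suc r) * c powi (- int (Suc r))) * Zp (- int (Suc r)))))"
        unfolding embed_x_plus d.mult d.add dilate_const rhom_mon[OF d.rhom_axioms] dilate_exp_fps cst_mult mult.assoc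
          dilate_Zp rhom.mult[OF rhom_fls_const] ..
      finally show ?thesis
        unfolding x chi1_def power_int_mult .
    next
      case 3
      then have nl: "\<not> i < l" "i \<noteq> l" by auto
      have x: "chg (x_data l) i = 0" "lam (x_data l) i r = 0" "kap (x_data l) i r = 0"
        "scl (x_data l) i = 1" "wt (x_data l) i = 0" for r
        using nl by (simp_all add: x_data_def)
      have s0: "lat (site i 0) = 1" by (simp add: site_def lat_0)
      have "embed_fls i (?A i (Poly_Mapping.single k 1)) = fls_const (lat (site i (snd k)) * mon (fst k) (gen i))"
        using nl by (simp add: embed_fls_const embed_single_sites)
      then show ?thesis
        unfolding x chi1_def s0 by (simp add: exp_fps_0 rhom.mult[OF rhom_fls_const] rhom_mon[OF rhom_fls_const])
    qed
  qed
  show "tensor_cur ?A = vop (x_data l)"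
  proof -
    have "vop (x_data l) = lin_ext fls_smul (\<lambda>b. \<Prod>i\<in>UNIV. embed_fls i (?A i (Poly_Mapping.single (b i) 1)))"
    proof (rule lin_ext_eqI)
      show "vop (x_data l) (Poly_Mapping.single b 1) = (\<Prod>i\<in>UNIV. embed_fls i (?A i (Poly_Mapping.single (b i) 1)))" for b
        unfolding site vop_single_sites[OF valid_x_data, symmetric] vop_def tau_single[OF valid_x_data] by simp
    qed (use currentsD[OF currents_vop[OF valid_x_data, of l]] in auto)
    then show ?thesis by (simp add: tensor_cur_def)
  qed
qed simp

section \<open>Contractions\<close>

lemma qh_pow: "qh ^ n = Fraction_Field.Fract (monom 1 n) 1"
proof (induction n)
  case 0
  show ?case by (simp add: One_fract_def)
next
  case (Suc n)
  then show ?case by (simp add: qh_def monom_Suc)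
qed

lemma qh_pow_eq_1: "qh ^ n = 1 \<longleftrightarrow> n = 0"
proof -
  have "monom (1::complex) n = 1 \<longleftrightarrow> n = 0"
    by (metis degree_1 degree_monom_eq monom_eq_1 zero_neq_one)
  then show ?thesis by (simp add: qh_pow One_fract_def eq_fract)
qed

lemma Q_pow_eq_1: "Q ^ n = 1 \<longleftrightarrow> n = 0"
  by (simp add: Q_def q_def qh_pow_eq_1 flip: power_mult)

lemma Q_powi_eq_1: "Q powi n = 1 \<longleftrightarrow> n = 0"
  by (auto simp: power_int_def Q_pow_eq_1 power_inverse)

lemma Q_eq_qq: "Q = q * q"
  by (simp add: Q_def power2_eq_square)

lemma q_minus_inverse: "q - inverse q \<noteq> 0"
  using Q_pow_eq_1[of 1] by (simp add: Q_eq_qq field_simps)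

lemma qint_neq_0:
  assumes "r > 0" shows "qint r \<noteq> 0"
proof -
  have "q ^ r - inverse q ^ r \<noteq> 0"
    using assms Q_pow_eq_1[of r] by (simp add: Q_eq_qq power_mult_distrib field_simps)
  then show ?thesis using q_minus_inverse by (simp add: qint_def)
qed

lemma qint_double: "qint (2 * r) = qint r * (q ^ r + inverse q ^ r)"
  unfolding qint_def mult_2 power_add by (simp add: algebra_simps diff_divide_distrib add_divide_distrib)

text \<open>The series of \<open>-log(1 - x u)\<close>; division by zero gives it the constant term
  zero.\<close>

definition log_fps :: "F \<Rightarrow> F fps" where
  "log_fps x = Abs_fps (\<lambda>r. x ^ r / of_nat r)"

lemma is_exp_neg_log: "is_exp (- log_fps x) (fps_of_poly [:1, - x:])"
proof -
  have g: "fps_deriv (log_fps x) * (1 - fps_const x * fps_X) = fps_const x"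
  proof (rule fps_ext)
    fix n
    have d: "fps_deriv (log_fps x) $ n = x ^ Suc n" for n
      by (simp add: log_fps_def field_simps del: of_nat_Suc)
    show "(fps_deriv (log_fps x) * (1 - fps_const x * fps_X)) $ n = fps_const x $ n"
      by (cases n) (simp_all add: right_diff_distrib d mult.assoc[symmetric] del: fps_deriv_nth)
  qed
  have p: "fps_of_poly [:1, - x:] = 1 - fps_const x * fps_X"
    by (simp add: fps_of_poly_linear' flip: fps_const_neg)
  have d: "fps_deriv (1 - fps_const x * fps_X) = - fps_const x"
    by (rule fps_ext) (simp add: fps_X_def)
  show ?thesis
    unfolding is_exp_def p d fps_deriv_neg minus_mult_left[symmetric] g by simp
qed

lemma is_exp_inverse: "is_exp (h :: F fps) f \<Longrightarrow> is_exp (- h) (inverse f)"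
proof -
  assume f: "is_exp h f"
  then have f0: "f $ 0 \<noteq> 0" by (simp add: is_exp_def)
  have "fps_deriv (inverse f) = - fps_deriv f * (inverse f)\<^sup>2"
    using f0 by (simp add: fps_inverse_deriv)
  also have "\<dots> = fps_deriv (- h) * (f * inverse f) * inverse f"
    using f by (simp add: is_exp_def power2_eq_square mult_ac)
  also have "f * inverse f = 1"
    using f0 by (simp add: inverse_mult_eq_1')
  finally show ?thesis using f by (simp add: is_exp_def)
qed

definition contr_series :: "'c::finite vdata \<Rightarrow> 'c vdata \<Rightarrow> F fps" where
  "contr_series D D' = Abs_fps (\<lambda>r. \<Sum>i\<in>UNIV. kap D i r * lam D' i r)"

text \<open>
  \<open>contr D D' G\<close>: the contraction of the two vertex operators is a rational function of $z_2/z_1$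
  whose denominator is in $\mathbb F[z]_0$ and whose value at 1 is \<open>G\<close>.
\<close>

definition contr :: "'c::finite vdata \<Rightarrow> 'c vdata \<Rightarrow> F \<Rightarrow> bool" where
  "contr D D' G \<longleftrightarrow> (\<exists>g p p'. is_exp (contr_series D D') g \<and> p \<in> polys0 \<and>
    fps_of_poly p * g = fps_of_poly p' \<and> poly p' 1 = G)"

lemma is_exp_deriv_cong: "is_exp h f \<Longrightarrow> fps_deriv h = fps_deriv h' \<Longrightarrow> is_exp h' f"
  by (simp add: is_exp_def)

text \<open>Exponents add, so contractions multiply, and \<open>polys0\<close> is closed under
  products.\<close>

lemma contr_vadd_left:
  assumes "contr D E G" "contr D' E G'" shows "contr (vadd D D') E (G * G')"
proof -
  obtain g p r where 1: "is_exp (contr_series D E) g" "p \<in> polys0" "fps_of_poly p * g = fps_of_poly r" "poly r 1 = G"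
    using assms(1) by (auto simp: contr_def)
  obtain g' p' r' where 2: "is_exp (contr_series D' E) g'" "p' \<in> polys0" "fps_of_poly p' * g' = fps_of_poly r'" "poly r' 1 = G'"
    using assms(2) by (auto simp: contr_def)
  have "contr_series (vadd D D') E = contr_series D E + contr_series D' E"
    by (rule fps_ext) (simp add: contr_series_def distrib_right sum.distrib)
  then have "is_exp (contr_series (vadd D D') E) (g * g')"
    using is_exp_add[OF 1(1) 2(1)] by simp
  moreover have "fps_of_poly (p * p') * (g * g') = fps_of_poly (r * r')"
    unfolding fps_of_poly_mult 1(3)[symmetric] 2(3)[symmetric] by (simp only: mult_ac)
  ultimately show ?thesis
    unfolding contr_def using 1 2 polys0_mult by (metis poly_mult)
qed

lemma contr_vadd_right:
  assumes "contr E D G" "contr E D' G'" shows "contr E (vadd D D') (G * G')"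
proof -
  obtain g p r where 1: "is_exp (contr_series E D) g" "p \<in> polys0" "fps_of_poly p * g = fps_of_poly r" "poly r 1 = G"
    using assms(1) by (auto simp: contr_def)
  obtain g' p' r' where 2: "is_exp (contr_series E D') g'" "p' \<in> polys0" "fps_of_poly p' * g' = fps_of_poly r'" "poly r' 1 = G'"
    using assms(2) by (auto simp: contr_def)
  have "contr_series E (vadd D D') = contr_series E D + contr_series E D'"
    by (rule fps_ext) (simp add: contr_series_def distrib_left sum.distrib)
  then have "is_exp (contr_series E (vadd D D')) (g * g')"
    using is_exp_add[OF 1(1) 2(1)] by simp
  moreover have "fps_of_poly (p * p') * (g * g') = fps_of_poly (r * r')"
    unfolding fps_of_poly_mult 1(3)[symmetric] 2(3)[symmetric] by (simp only: mult_ac)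
  ultimately show ?thesis
    unfolding contr_def using 1 2 polys0_mult by (metis poly_mult)
qed

definition vzero :: "'c vdata" where
  "vzero = \<lparr>lam = (\<lambda>i r. 0), kap = (\<lambda>i r. 0), chg = (\<lambda>i. 0), scl = (\<lambda>i. 1), wt = (\<lambda>i. 0)\<rparr>"

lemma vzero_sel [simp]: "lam vzero i r = 0" "kap vzero i r = 0" "chg vzero i = 0" "scl vzero i = 1" "wt vzero i = 0"
  by (simp_all add: vzero_def)

lemma valid_vzero [simp]: "valid vzero"
  by (simp add: valid_def)

lemma contr_0: "contr_series D D' = 0 \<Longrightarrow> contr D D' 1"
  unfolding contr_def by (rule exI[of _ 1], rule exI[of _ 1], rule exI[of _ 1]) (simp add: is_exp_def)

lemma contr_vzero: "contr vzero D 1" "contr D vzero 1"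
  by (rule contr_0, simp add: contr_series_def fps_eq_iff)+

section \<open>Contractions between the summands of the current\<close>

definition pt :: "'c::{finite, linorder} \<times> nat \<Rightarrow> 'c vdata" where
  "pt x = vdil (Q ^ snd x) (x_data (fst x))"

lemma valid_pt [simp]: "valid (pt x)"
  by (simp add: pt_def)

text \<open>The contraction of two summands at shifted points, evaluated at
  \<open>z_1 = z_2\<close>. It is asymmetric in the indices because \<open>phi\<close> occurs only
  in positions before that of \<open>x_plus\<close>.\<close>

definition gg :: "'c::linorder \<times> nat \<Rightarrow> 'c \<times> nat \<Rightarrow> F" where
  "gg x x' = (let y = Q powi (int (snd x') - int (snd x)) in
    if fst x = fst x' then (1 - y) * (1 - y / Q)
    else if fst x < fst x' then (1 - y / Q) / (1 - Q * y) else 1)"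

text \<open>Only position \<open>l\<close> has annihilation terms, so a single product remains. For
  equal indices \<open>plus_kap r * plus_lam r\<close> is \<open>-(1 + Q^-r)/r\<close>. Against
  \<open>phi\<close>, the factor \<open>q^r - q^-r\<close> from \<open>[r](q - q^-1)\<close> meets
  \<open>q^r + q^-r\<close> from \<open>[2r]/[r]\<close> and gives \<open>(Q^r - Q^-r)/r\<close>.
  These are coefficients of logarithms of linear factors; derivatives are compared because exponents
  matter only up to their constant terms.\<close>

lemma contr_series_pt:
  fixes x x' :: "'c::{finite, linorder} \<times> nat"
  assumes "y = Q powi (int (snd x') - int (snd x))"
  shows "fps_deriv (contr_series (pt x) (pt x')) = fps_deriv
    (if fst x = fst x' then (- log_fps y) + (- log_fps (y / Q))
     else if fst x < fst x' then (- log_fps (y / Q)) + (- (- log_fps (Q * y))) else 0)"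
proof -
  obtain l a where x: "x = (l, a)" by (cases x)
  obtain m b where x': "x' = (m, b)" by (cases x')
  have y: "y = Q ^ b / Q ^ a"
    by (simp add: assms x x' power_int_diff)
  have sum: "contr_series (pt x) (pt x') $ r = kap (pt x) l r * lam (pt x') l r" for r
  proof -
    have "contr_series (pt x) (pt x') $ r = (\<Sum>i\<in>UNIV. if i = l then kap (pt x) l r * lam (pt x') l r else 0)"
      unfolding contr_series_def fps_nth_Abs_fps by (rule sum.cong) (auto simp: pt_def x x_data_def)
    then show ?thesis by simp
  qed
  have k: "kap (pt x) l r = plus_kap r * inverse (q ^ pos l) ^ r * inverse (Q ^ a) ^ r" for r
    by (simp add: pt_def x x_data_def)
  have cf: "contr_series (pt x) (pt x') $ r =
    (if l = m then - (y ^ r / of_nat r) + - ((y / Q) ^ r / of_nat r)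
     else if l < m then - ((y / Q) ^ r / of_nat r) + (Q * y) ^ r / of_nat r else 0)" if r: "r > 0" for r
  proof -
    have qr: "qint r \<noteq> 0" "q ^ r \<noteq> 0" "qh ^ r \<noteq> 0" "of_nat r \<noteq> (0::F)" using r by (simp_all add: qint_neq_0)
    have kap: "plus_kap r = - (inverse qh ^ r * (qint r * (q ^ r + inverse q ^ r)) / of_nat r)"
      using qr by (simp add: plus_kap_def qint_double)
    consider "l = m" | "l < m" | "m < l" by force
    then show ?thesis
    proof cases
      case 1
      have "lam (pt x') l r = plus_lam r * (q ^ pos l) ^ r * (Q ^ b) ^ r"
        by (simp add: pt_def x' x_data_def 1)
      then have "contr_series (pt x) (pt x') $ r =
        plus_kap r * plus_lam r * (inverse (q ^ pos l) ^ r * (q ^ pos l) ^ r) * (inverse (Q ^ a) ^ r * (Q ^ b) ^ r)"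
        by (simp add: sum k)
      also have "inverse (q ^ pos l) ^ r * (q ^ pos l) ^ r = 1"
        by (simp flip: power_mult_distrib)
      also have "inverse (Q ^ a) ^ r * (Q ^ b) ^ r = y ^ r"
        by (simp add: y field_simps flip: power_mult_distrib)
      also have "plus_kap r * plus_lam r = - ((inverse qh ^ r * inverse qh ^ r) * (q ^ r + inverse q ^ r) / of_nat r)"
        using qr by (simp add: kap plus_lam_def)
      also have "inverse qh ^ r * inverse qh ^ r = inverse q ^ r"
        by (simp add: q_def power2_eq_square power_mult_distrib)
      also have "inverse q ^ r * (q ^ r + inverse q ^ r) = 1 + inverse Q ^ r"
        by (simp add: Q_eq_qq distrib_left flip: power_mult_distrib)
      finally have "contr_series (pt x) (pt x') $ r = - (((1 + inverse Q ^ r) * y ^ r) / of_nat r)"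
        by simp
      also have "(1 + inverse Q ^ r) * y ^ r = y ^ r + (y / Q) ^ r"
        by (simp add: divide_inverse power_mult_distrib distrib_left mult.commute)
      finally show ?thesis
        using 1 by (simp add: add_divide_distrib)
    next
      case 2
      have "lam (pt x') l r = phi_lam r * (qh ^ (2 * pos l + 1)) ^ r * (Q ^ b) ^ r"
        using 2 by (simp add: pt_def x' x_data_def)
      moreover have "(qh ^ (2 * pos l + 1)) ^ r = (q ^ pos l) ^ r * qh ^ r"
        by (simp add: q_def power_mult_distrib flip: power_mult)
      ultimately have "contr_series (pt x) (pt x') $ r =
        plus_kap r * phi_lam r * qh ^ r * (inverse (q ^ pos l) ^ r * (q ^ pos l) ^ r) * (inverse (Q ^ a) ^ r * (Q ^ b) ^ r)"
        by (simp add: sum k)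
      also have "inverse (q ^ pos l) ^ r * (q ^ pos l) ^ r = 1"
        by (simp flip: power_mult_distrib)
      also have "inverse (Q ^ a) ^ r * (Q ^ b) ^ r = y ^ r"
        by (simp add: y field_simps flip: power_mult_distrib)
      also have "plus_kap r * phi_lam r * qh ^ r = (inverse qh ^ r * qh ^ r) * (qint r * (q - inverse q)) * (q ^ r + inverse q ^ r) / of_nat r"
        by (simp only: kap phi_lam_def divide_inverse minus_mult_minus mult_ac)
      also have "inverse qh ^ r * qh ^ r = 1"
        by (simp flip: power_mult_distrib)
      also have "qint r * (q - inverse q) = q ^ r - inverse q ^ r"
        using q_minus_inverse by (simp add: qint_def)
      also have "1 * (q ^ r - inverse q ^ r) * (q ^ r + inverse q ^ r) = Q ^ r - inverse Q ^ r"
        by (simp add: Q_eq_qq power_mult_distrib algebra_simps)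
      finally have "contr_series (pt x) (pt x') $ r = ((Q ^ r - inverse Q ^ r) * y ^ r) / of_nat r"
        by simp
      also have "(Q ^ r - inverse Q ^ r) * y ^ r = - ((y / Q) ^ r) + (Q * y) ^ r"
        by (simp add: divide_inverse power_mult_distrib right_diff_distrib mult.commute)
      finally show ?thesis
        using 2 by (simp add: add_divide_distrib diff_divide_distrib less_imp_neq)
    next
      case 3
      then have "l \<noteq> m" "\<not> l < m" by auto
      moreover have "lam (pt x') l r = 0"
        using \<open>l \<noteq> m\<close> \<open>\<not> l < m\<close> by (simp add: pt_def x' x_data_def)
      ultimately show ?thesis by (simp add: sum)
    qed
  qed
  show ?thesis
  proof (rule fps_ext)
    fix n
    have "contr_series (pt x) (pt x') $ (n + 1) =
      (if fst x = fst x' then (- log_fps y) + (- log_fps (y / Q))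
       else if fst x < fst x' then (- log_fps (y / Q)) + (- (- log_fps (Q * y))) else 0) $ (n + 1)"
      by (subst cf) (simp_all add: x x' log_fps_def)
    then show "fps_deriv (contr_series (pt x) (pt x')) $ n = fps_deriv
      (if fst x = fst x' then (- log_fps y) + (- log_fps (y / Q))
       else if fst x < fst x' then (- log_fps (y / Q)) + (- (- log_fps (Q * y))) else 0) $ n"
      by (simp only: fps_deriv_nth)
  qed
qed

lemma contr_pt:
  assumes "snd x < snd x'"
  shows "contr (pt x) (pt x') (gg x x')"
proof -
  define y where "y = Q powi (int (snd x') - int (snd x))"
  define n where "n = nat (int (snd x') - int (snd x))"
  have y: "y = Q ^ n"
    using assms by (simp add: y_def n_def power_int_def)
  note e = is_exp_deriv_cong[OF _ contr_series_pt[OF y_def, symmetric]]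
  consider "fst x = fst x'" | "fst x < fst x'" | "fst x \<noteq> fst x'" "\<not> fst x < fst x'" by blast
  then show ?thesis
  proof cases
    case 1
    have "is_exp (contr_series (pt x) (pt x')) (fps_of_poly [:1, - y:] * fps_of_poly [:1, - (y / Q):])"
      using e is_exp_add[OF is_exp_neg_log is_exp_neg_log] 1 by simp
    then show ?thesis
      unfolding contr_def
      by (rule_tac exI, rule_tac exI[of _ 1], rule_tac exI[of _ "[:1, - y:] * [:1, - (y / Q):]"])
        (use 1 in \<open>simp add: fps_of_poly_mult gg_def y_def[symmetric] del: mult_pCons_left mult_pCons_right\<close>)
  next
    case 2
    \<comment> \<open>At \<open>u = Q^k\<close> the denominator \<open>1 - Q y u\<close> equals
      \<open>1 - Q^(k+n+1)\<close>, which is nonzero; dividing it by its value at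
      \<open>u = 1\<close> puts it into \<open>polys0\<close>.\<close>
    have "Q ^ Suc n \<noteq> 1" by (simp add: Q_pow_eq_1 del: power_Suc)
    then have Qy: "1 - Q * y \<noteq> 0" by (simp add: y)
    have "Q ^ (k + Suc n) \<noteq> 1" for k by (subst Q_pow_eq_1) simp
    moreover have "Q ^ k * (Q * y) = Q ^ (k + Suc n)" for k by (simp add: y power_add)
    ultimately have nz: "1 - Q ^ k * (Q * y) \<noteq> 0" for k by (metis eq_iff_diff_eq_0)
    let ?c = "inverse (1 - Q * y)"
    have "is_exp (contr_series (pt x) (pt x')) (fps_of_poly [:1, - (y / Q):] * inverse (fps_of_poly [:1, - (Q * y):]))" (is "is_exp _ ?g")
      using e is_exp_add[OF is_exp_neg_log is_exp_inverse[OF is_exp_neg_log]] 2 by (simp add: less_imp_neq)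
    moreover have "smult ?c [:1, - (Q * y):] \<in> polys0"
      using Qy nz by (auto simp: polys0_def field_simps)
    moreover have "fps_of_poly (smult ?c [:1, - (Q * y):]) * ?g = fps_of_poly (smult ?c [:1, - (y / Q):])"
    proof -
      have "fps_of_poly [:1, - (Q * y):] * inverse (fps_of_poly [:1, - (Q * y):]) = 1"
        by (rule inverse_mult_eq_1') simp
      then have "fps_const ?c * fps_of_poly [:1, - (y / Q):] * (fps_of_poly [:1, - (Q * y):] * inverse (fps_of_poly [:1, - (Q * y):]))
         = fps_const ?c * fps_of_poly [:1, - (y / Q):]" by simp
      then show ?thesis unfolding fps_of_poly_smult by (simp only: mult_ac)
    qed
    moreover have "poly (smult ?c [:1, - (y / Q):]) 1 = gg x x'"
    proof -
      have "poly [:1, - (y / Q):] 1 = 1 - y / Q" by simp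
      with 2 show ?thesis
        unfolding poly_smult by (simp add: gg_def y_def[symmetric] less_imp_neq divide_inverse mult.commute del: poly_pCons)
    qed
    ultimately show ?thesis unfolding contr_def by blast
  next
    case 3
    have "is_exp (contr_series (pt x) (pt x')) 1"
      by (rule e) (use 3 in \<open>simp add: is_exp_def\<close>)
    then show ?thesis
      unfolding contr_def
      by (rule_tac exI, rule_tac exI[of _ 1], rule_tac exI[of _ 1]) (use 3 in \<open>simp add: gg_def Let_def\<close>)
  qed
qed

lemma reg_prod_vop_contr:
  assumes "valid D" "valid D'" "contr D D' G"
  shows "reg_prod (vop D) (vop D')
    (cur_smul (pair_scl D (chg D') * G) (cur_shift (pair_wt D (chg D')) (vop (vadd D D'))))"
proof -
  obtain g p r where 1: "is_exp (contr_series D D') g" "p \<in> polys0" "fps_of_poly p * g = fps_of_poly r" "poly r 1 = G"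
    using assms(3) by (auto simp: contr_def)
  show ?thesis
    using reg_prod_vop[OF assms(1,2) 1(1)[unfolded contr_series_def] 1(2,3)] 1(4) by simp
qed

section \<open>Products of the current at several points\<close>

text \<open>
  A list of pairs \<open>(l, a)\<close> stands for the normally ordered product of the \<open>l\<close>-th summands of
  $x(z\mathsf q^a)$.
\<close>

definition pts :: "('c::{finite, linorder} \<times> nat) list \<Rightarrow> 'c vdata" where
  "pts w = foldr (\<lambda>x. vadd (pt x)) w vzero"

lemma pts_simps [simp]: "pts [] = vzero" "pts (x # w) = vadd (pt x) (pts w)"
  by (simp_all add: pts_def)

lemma vdata_eqI:
  fixes D E :: "'c vdata"
  assumes "\<And>i r. lam D i r = lam E i r" "\<And>i r. kap D i r = kap E i r" "\<And>i. chg D i = chg E i"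
    "\<And>i. scl D i = scl E i" "\<And>i. wt D i = wt E i"
  shows "D = E"
  using assms by (intro vdata.equality) (auto simp: fun_eq_iff)

lemma vadd_assoc: "vadd (vadd D E) G = vadd D (vadd E G)"
  by (rule vdata_eqI) (simp_all add: add.assoc mult.assoc)

lemma vadd_vzero [simp]: "vadd vzero D = D" "vadd D vzero = D"
  by (rule vdata_eqI; simp)+

lemma pts_append: "pts (w @ w') = vadd (pts w) (pts w')"
  by (induction w) (simp_all add: vadd_assoc)

lemma valid_pts [simp]: "valid (pts w)"
  by (induction w) simp_all

lemma pair_scl_vadd: "pair_scl (vadd D E) n = pair_scl D n * pair_scl E n"
  by (simp add: pair_scl_def power_int_mult_distrib prod.distrib)

lemma pair_scl_add: "valid D \<Longrightarrow> pair_scl D (chg (vadd E E')) = pair_scl D (chg E) * pair_scl D (chg E')"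
  by (simp add: pair_scl_def valid_def power_int_add prod.distrib)

lemma pair_scl_vzero [simp]: "pair_scl vzero n = 1" "pair_scl D (chg vzero) = 1"
  by (simp_all add: pair_scl_def)

lemma pair_wt_vadd: "pair_wt (vadd D E) n = pair_wt D n + pair_wt E n"
  by (simp add: pair_wt_def distrib_right sum.distrib)

lemma pair_wt_add: "pair_wt D (chg (vadd E E')) = pair_wt D (chg E) + pair_wt D (chg E')"
  by (simp add: pair_wt_def distrib_left sum.distrib)

lemma pair_wt_vzero [simp]: "pair_wt vzero n = 0" "pair_wt D (chg vzero) = 0"
  by (simp_all add: pair_wt_def)

definition gs :: "('c::linorder \<times> nat) list \<Rightarrow> ('c \<times> nat) list \<Rightarrow> F" where
  "gs w w' = (\<Prod>x\<leftarrow>w. \<Prod>x'\<leftarrow>w'. gg x x')"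

lemma gs_simps [simp]: "gs [] w' = 1" "gs (x # w) w' = (\<Prod>x'\<leftarrow>w'. gg x x') * gs w w'"
  by (simp_all add: gs_def)

lemma contr_pts:
  assumes "\<And>x x'. x \<in> set w \<Longrightarrow> x' \<in> set w' \<Longrightarrow> snd x < snd x'"
  shows "contr (pts w) (pts w') (gs w w')"
  using assms
proof (induction w)
  case Nil
  show ?case by (simp add: contr_vzero)
next
  case (Cons x w)
  have "contr (pt x) (pts w') (\<Prod>x'\<leftarrow>w'. gg x x')"
    using Cons.prems
  proof (induction w')
    case (Cons x' w')
    then have "contr (pt x) (pt x') (gg x x')" by (intro contr_pt) simp
    with Cons show ?case by (auto intro: contr_vadd_right)
  qed (simp add: contr_vzero)
  with Cons show ?case by (auto intro: contr_vadd_left)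
qed

text \<open>Multiplying the factors of a list one after the other leaves a scalar \<open>cf\<close>
  and a power \<open>ze\<close> of \<open>z\<close>, both from the contractions on the diagonal. The
  rules for concatenation are those of \<open>reg_prod_vop_contr\<close>, so \<open>nprod\<close>
  turns concatenation into the regularized product.\<close>

primrec cf :: "('c::{finite, linorder} \<times> nat) list \<Rightarrow> F" where
  "cf [] = 1"
| "cf (x # w) = cf w * pair_scl (pt x) (chg (pts w)) * (\<Prod>x'\<leftarrow>w. gg x x')"

primrec ze :: "('c::{finite, linorder} \<times> nat) list \<Rightarrow> int" where
  "ze [] = 0"
| "ze (x # w) = ze w + pair_wt (pt x) (chg (pts w))"

lemma cf_append: "cf (w @ w') = cf w * cf w' * (pair_scl (pts w) (chg (pts w')) * gs w w')"
  by (induction w) (simp_all add: pts_append pair_scl_vadd pair_scl_add mult_ac)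

lemma ze_append: "ze (w @ w') = ze w + ze w' + pair_wt (pts w) (chg (pts w'))"
  by (induction w) (simp_all add: pts_append pair_wt_vadd pair_wt_add)

definition nprod :: "('c::{finite, linorder} \<times> nat) list \<Rightarrow> ('c \<Rightarrow> fock) cur" where
  "nprod w = cur_smul (cf w) (cur_shift (ze w) (vop (pts w)))"

lemma currents_nprod [simp]: "nprod w \<in> currents"
  unfolding nprod_def by (intro currents_smul currents_shift currents_vop valid_pts)

lemma cur_scale_scale:
  fixes a :: "'k::comm_monoid_add cur"
  shows "cur_smul x (cur_shift k (cur_smul y (cur_shift m a))) = cur_smul (x * y) (cur_shift (k + m) a)"
  by (simp only: cur_smul_def cur_shift_eq fls_smul_cst cst_mult rhom.mult[OF rhom_fls_const] Zp_add mult_ac)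

lemma reg_prod_nprod:
  assumes "\<And>x x'. x \<in> set w \<Longrightarrow> x' \<in> set w' \<Longrightarrow> snd x < snd x'"
  shows "reg_prod (nprod w) (nprod w') (nprod (w @ w'))"
  using reg_prod_scale[OF reg_prod_vop_contr[OF valid_pts valid_pts contr_pts[OF assms]], where x = "cf w" and k = "ze w" and y = "cf w'" and m = "ze w'"]
  by (simp add: nprod_def cur_scale_scale cf_append ze_append pts_append)

text \<open>Expanding the product of the \<open>x(z Q^a)\<close> by \<open>x_cur_eq\<close> selects
  one summand at every point; the lists \<open>w\<close> over \<open>as\<close> are these
  selections.\<close>

definition xprod :: "nat list \<Rightarrow> ('c::{finite, linorder} \<Rightarrow> fock) cur" where
  "xprod as = (\<Sum>w | map snd w = as. nprod w)"

lemma finite_colorings [simp]: "finite {w :: ('c::finite \<times> nat) list. map snd w = as}"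
proof (rule finite_subset)
  show "{w :: ('c \<times> nat) list. map snd w = as} \<subseteq> {w. set w \<subseteq> UNIV \<times> set as \<and> length w = length as}"
    by (auto simp: image_iff) (metis snd_conv)
  show "finite {w :: ('c \<times> nat) list. set w \<subseteq> UNIV \<times> set as \<and> length w = length as}"
    by (rule finite_lists_length_eq) simp
qed

lemma currents_xprod [simp]: "xprod as \<in> currents"
  unfolding xprod_def by (rule currents_sum) simp

lemma reg_prod_xprod:
  fixes as bs :: "nat list"
  assumes "\<And>a b. a \<in> set as \<Longrightarrow> b \<in> set bs \<Longrightarrow> a < b"
  shows "reg_prod (xprod as :: ('c::{finite, linorder} \<Rightarrow> fock) cur) (xprod bs) (xprod (as @ bs))"
proof -
  have "reg_prod (xprod as) (xprod bs)
    (\<Sum>w :: ('c \<times> nat) list | map snd w = as. \<Sum>w' | map snd w' = bs. nprod (w @ w'))"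
    unfolding xprod_def
  proof (rule reg_prod_sum)
    fix w w' :: "('c \<times> nat) list"
    assume w: "w \<in> {w. map snd w = as}" "w' \<in> {w'. map snd w' = bs}"
    show "reg_prod (nprod w) (nprod w') (nprod (w @ w'))"
    proof (rule reg_prod_nprod)
      fix x x' assume "x \<in> set w" "x' \<in> set w'"
      then have "snd x \<in> set (map snd w)" "snd x' \<in> set (map snd w')" by simp_all
      with w assms show "snd x < snd x'" by simp
    qed
  qed simp_all
  also have "(\<Sum>w :: ('c \<times> nat) list | map snd w = as. \<Sum>w' | map snd w' = bs. nprod (w @ w')) = xprod (as @ bs)"
    unfolding xprod_def sum.cartesian_product
    by (rule sum.reindex_bij_witness[where i = "\<lambda>w. (take (length as) w, drop (length as) w)" and j = "\<lambda>(w, w'). w @ w'"])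
      (auto simp: take_map[symmetric] drop_map[symmetric])
  finally show ?thesis .
qed

section \<open>The shift of all points by one\<close>

definition sh :: "'c \<times> nat \<Rightarrow> 'c \<times> nat" where
  "sh x = (fst x, Suc (snd x))"

lemma sh_sel [simp]: "fst (sh x) = fst x" "snd (sh x) = Suc (snd x)"
  by (simp_all add: sh_def)

lemma vdil_vadd: "c \<noteq> 0 \<Longrightarrow> vdil c (vadd D E) = vadd (vdil c D) (vdil c E)"
  by (rule vdata_eqI) (simp_all add: algebra_simps power_int_add)

lemma vdil_vzero: "vdil c vzero = vzero"
  by (rule vdata_eqI) simp_all

lemma vdil_pt: "vdil Q (pt x) = pt (sh x)"
  by (rule vdata_eqI) (simp_all add: pt_def power_mult_distrib power_int_mult_distrib mult_ac)

lemma vdil_pts: "vdil Q (pts w) = pts (map sh w)"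
  by (induction w) (simp_all add: vdil_vzero vdil_vadd vdil_pt)

lemma pair_scl_vdil: "c \<noteq> 0 \<Longrightarrow> pair_scl (vdil c D) n = pair_scl D n * c powi pair_wt D n"
proof -
  assume c: "c \<noteq> 0"
  have "c powi (\<Sum>i\<in>A. f i) = (\<Prod>i\<in>A. c powi f i)" for A :: "'a set" and f
    using c by (induction A rule: infinite_finite_induct) (simp_all add: power_int_add)
  then show ?thesis
    by (simp add: pair_scl_def pair_wt_def power_int_mult_distrib prod.distrib power_int_mult)
qed

lemma gg_shift: "gg (sh x) (sh x') = gg x x'"
  by (simp add: gg_def Let_def)

lemma pair_wt_vdil [simp]: "pair_wt (vdil c D) n = pair_wt D n"
  by (simp add: pair_wt_def)

lemma ze_shift: "ze (map sh w) = ze w"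
  by (induction w) (simp_all flip: vdil_pts vdil_pt)

text \<open>Contractions depend only on differences of points, so the dilation acts on the scalar
  just through the accumulated power of \<open>z\<close>.\<close>

lemma cf_shift: "cf (map sh w) = cf w * Q powi ze w"
  by (induction w) (simp_all add: pair_scl_vdil power_int_add gg_shift o_def mult_ac flip: vdil_pts vdil_pt)

lemma cur_dilate_scale:
  fixes a :: "'k::comm_monoid_add cur"
  assumes "c \<noteq> 0"
  shows "cur_dilate c (cur_smul x (cur_shift k a)) = cur_smul (x * c powi k) (cur_shift k (cur_dilate c a))"
  by (simp only: cur_dilate_def cur_smul_def cur_shift_eq fls_smul_cst rhom.mult[OF rhom_dilate[OF assms]] dilate_const
      dilate_Zp rhom.mult[OF rhom_fcst] mult_ac)

lemma cur_dilate_nprod: "cur_dilate Q (nprod w) = nprod (map sh w)"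
  unfolding nprod_def
  by (simp only: cur_dilate_scale[OF q_neq_0(2)] cur_dilate_vop[OF q_neq_0(2)] vdil_pts cf_shift ze_shift)

lemma cur_dilate_sum:
  fixes f :: "'i \<Rightarrow> 'k cur"
  shows "cur_dilate c (\<Sum>i\<in>A. f i) = (\<Sum>i\<in>A. cur_dilate c (f i))"
proof -
  interpret vector_space "smul :: F \<Rightarrow> 'k vec \<Rightarrow> 'k vec" by (rule vector_space_smul)
  show ?thesis
    by (induction A rule: infinite_finite_induct)
      (auto simp: cur_dilate_def fun_eq_iff fls_eq_iff dilate.rep_eq scale_right_distrib)
qed

lemma cur_dilate_xprod: "cur_dilate Q (xprod as) = xprod (map Suc as)"
  unfolding xprod_def cur_dilate_sum cur_dilate_nprod
proof (rule sum.reindex_bij_witness[where j = "map sh" and i = "map (\<lambda>x. (fst x, snd x - 1))"])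
  fix w :: "('a \<times> nat) list"
  assume "w \<in> {w. map snd w = map Suc as}"
  then have w: "map snd w = map Suc as" by simp
  have "snd x > 0" if "x \<in> set w" for x
    using arg_cong[OF w, of set] that by force
  then show "map sh (map (\<lambda>x. (fst x, snd x - 1)) w) = w"
    by (auto simp: sh_def intro!: map_idI)
  have "map (\<lambda>x. snd x - 1) w = map (\<lambda>n. n - 1) (map snd w)" by simp
  then show "map (\<lambda>x. (fst x, snd x - 1)) w \<in> {w. map snd w = as}"
    unfolding w by (simp add: o_def)
qed (auto simp: o_def intro!: map_idI)

lemma vop_vzero: "vop vzero = fls_const"
proof
  fix v :: "('c::finite \<Rightarrow> fock) vec"
  have c: "chi vzero b = fls_const (Poly_Mapping.single b 1)" for b :: "'c \<Rightarrow> fock"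
  proof -
    have "Poly_Mapping.single b 1 = (\<Prod>i\<in>UNIV. embed i (Poly_Mapping.single (b i) 1))"
    proof -
      have "(\<Prod>i\<in>A. embed i (Poly_Mapping.single (b i) 1)) = (Poly_Mapping.single (\<lambda>i. if i \<in> A then b i else 0) 1 :: ('c \<Rightarrow> fock) vec)" for A
      proof (induction A rule: infinite_finite_induct)
        case (insert x A)
        have "(\<lambda>_. 0)(x := b x) + (\<lambda>i. if i \<in> A then b i else 0) = (\<lambda>i. if i \<in> insert x A then b i else 0)"
          using insert by (auto simp: fun_eq_iff)
        then show ?case using insert by (simp add: embed_single mult_single)
      qed (simp_all add: zero_fun_def[symmetric])
      then show ?thesis by simp
    qed
    also have "\<dots> = lat (\<lambda>i. snd (b i)) * (\<Prod>i\<in>UNIV. mon (fst (b i)) (gen i))"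
      unfolding embed_single_sites prod.distrib lat_sites[of "\<lambda>i. snd (b i)"] ..
    finally show ?thesis
      by (simp add: chi_def chi1_def rhom.mult[OF rhom_fls_const] rhom.prod[OF rhom_fls_const] rhom_mon[OF rhom_fls_const])
  qed
  have "creat (vzero :: 'c vdata) = 1"
    using lat_0 by (simp add: creat_def exp_fps_0 vzero_def)
  moreover have "tau vzero v = fls_const v"
    unfolding tau_def
    by (rule fun_cong[where x = v], rule lin_ext_eqI[symmetric])
      (simp_all add: c fls_plus_const fls_smul_cst smul_cst)
  ultimately show "vop vzero v = fls_const v"
    by (simp add: vop_def)
qed

lemma cur_scale_id: "cur_smul 1 (cur_shift 0 a) = (a :: 'k::comm_monoid_add cur)"
  by (simp add: cur_smul_def cur_shift_eq fls_smul_cst)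

lemma xprod_Nil: "xprod [] = fls_const"
  by (simp add: xprod_def nprod_def cur_scale_id vop_vzero)

lemma xprod_0: "xprod [0] = x_cur"
proof -
  have 1: "{w :: ('a \<times> nat) list. map snd w = [0]} = (\<lambda>l. [(l, 0)]) ` UNIV"
    by auto
  have 2: "pt (l, 0) = x_data l" for l :: 'a
    by (rule vdata_eqI) (simp_all add: pt_def)
  show ?thesis
    unfolding xprod_def 1 x_cur_eq
    by (subst sum.reindex) (auto simp: inj_on_def nprod_def cur_scale_id 2)
qed

section \<open>Vanishing and linear independence\<close>

text \<open>For neighbouring points \<open>y = Q\<close>, and the factor \<open>1 - y / Q\<close> is
  present unless the index drops.\<close>

lemma gg_Suc_eq_0: "snd x' = Suc (snd x) \<Longrightarrow> gg x x' \<noteq> 0 \<Longrightarrow> fst x > fst x'"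
  by (cases "fst x = fst x'"; cases "fst x < fst x'") (simp_all add: gg_def Let_def)

lemma gg_neq_0:
  assumes "snd x < snd x'" "snd x' = Suc (snd x) \<Longrightarrow> fst x > fst x'"
  shows "gg x x' \<noteq> 0"
proof -
  define n where "n = int (snd x') - int (snd x)"
  have y: "1 - Q powi n \<noteq> 0" "1 - Q * Q powi n \<noteq> 0"
    using assms(1) Q_powi_eq_1[of n] Q_powi_eq_1[of "n + 1"] by (auto simp: n_def power_int_add_1')
  have "1 - Q powi n / Q \<noteq> 0" if "snd x' \<noteq> Suc (snd x)"
    using assms(1) that Q_powi_eq_1[of "n - 1"] by (auto simp: n_def power_int_diff)
  moreover have "snd x' = Suc (snd x) \<Longrightarrow> \<not> fst x < fst x' \<and> fst x \<noteq> fst x'"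
    using assms(2) by auto
  ultimately show ?thesis
    using y by (auto simp: gg_def Let_def n_def[symmetric])
qed

lemma cf_decreasing:
  "map snd w = [a..<a + n] \<Longrightarrow> cf w \<noteq> 0 \<Longrightarrow> sorted_wrt (>) (map fst w)"
proof (induction w arbitrary: a n)
  case (Cons x w)
  from Cons.prems(1) obtain n' where n: "n = Suc n'"
    by (cases n) auto
  have "[a..<a + n] = a # [Suc a..<Suc a + n']"
    by (simp add: upt_conv_Cons n del: upt_Suc)
  with Cons.prems(1) have x: "snd x = a" and w: "map snd w = [Suc a..<Suc a + n']"
    by simp_all
  have s: "sorted_wrt (>) (map fst w)"
    using Cons.IH[OF w] Cons.prems(2) by simp
  show ?case
  proof (cases w)
    case (Cons x' w')
    with w have "Suc a < Suc a + n'" by (cases n') auto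
    with w Cons have "snd x' = Suc (snd x)"
      by (simp add: x upt_conv_Cons del: upt_Suc)
    then have "fst x' < fst x"
      using \<open>cf (x # w) \<noteq> 0\<close> Cons by (intro gg_Suc_eq_0) auto
    with s show ?thesis by (auto simp: Cons)
  qed simp
qed simp

lemma xprod_eq_0:
  assumes "CARD('c::{finite, linorder}) < n"
  shows "(xprod [a..<a + n] :: ('c \<Rightarrow> fock) cur) = 0"
proof -
  have "nprod w = 0" if w: "map snd w = [a..<a + n]" for w :: "('c \<times> nat) list"
  proof -
    have "cf w = 0"
    proof (rule ccontr)
      assume "cf w \<noteq> 0"
      with w have "sorted_wrt (>) (map fst w)" by (rule cf_decreasing)
      then have "distinct (map fst w)"
        by (induction w) auto
      then have "length w = card (set (map fst w))"
        by (metis distinct_card length_map)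
      also have "\<dots> \<le> CARD('c)" by (rule card_mono) auto
      finally show False
        using assms arg_cong[OF w, of length] by simp
    qed
    then show ?thesis
      by (simp add: nprod_def cur_smul_def fls_smul_cst fun_eq_iff)
  qed
  then show ?thesis by (simp add: xprod_def)
qed

section \<open>Linear independence of exponentials\<close>

lemma dedekind:
  fixes \<chi> :: "'i \<Rightarrow> 'm::plus \<Rightarrow> 'r::idom"
  assumes "finite X" and mult: "\<And>i \<mu> \<nu>. i \<in> X \<Longrightarrow> \<chi> i (\<mu> + \<nu>) = \<chi> i \<mu> * \<chi> i \<nu>"
    and "\<And>i j. i \<in> X \<Longrightarrow> j \<in> X \<Longrightarrow> i \<noteq> j \<Longrightarrow> \<exists>\<mu>. \<chi> i \<mu> \<noteq> \<chi> j \<mu>"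
    and "\<And>\<mu>. (\<Sum>i\<in>X. c i * \<chi> i \<mu>) = 0" and "i \<in> X"
  shows "c i * \<chi> i \<mu> = 0"
  using assms
proof (induction X arbitrary: c i \<mu> rule: finite_induct)
  case (insert k X)
  have *: "c j * \<chi> j \<mu> = 0" if j: "j \<in> X" for j \<mu>
  proof -
    obtain \<nu> where \<nu>: "\<chi> k \<nu> \<noteq> \<chi> j \<nu>"
      using insert.prems(2)[of k j] insert.hyps j by auto
    \<comment> \<open>The relation at \<open>\<mu> + \<nu>\<close> minus
      \<open>\<chi> k \<nu>\<close> times the relation at \<open>\<mu>\<close> has no term for
      \<open>k\<close>, and its coefficient at \<open>j\<close> has a nonzero extra factor by the
      choice of \<open>\<nu>\<close>.\<close>
    define c' where "c' j = c j * (\<chi> j \<nu> - \<chi> k \<nu>)" for j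
    have "(\<Sum>j\<in>X. c' j * \<chi> j \<mu>) = 0" for \<mu>
    proof -
      have "(\<Sum>j\<in>X. c' j * \<chi> j \<mu>) = (\<Sum>j\<in>insert k X. c' j * \<chi> j \<mu>)"
        using insert.hyps by (simp add: c'_def)
      also have "\<dots> = (\<Sum>j\<in>insert k X. c j * \<chi> j (\<mu> + \<nu>)) - \<chi> k \<nu> * (\<Sum>j\<in>insert k X. c j * \<chi> j \<mu>)"
        unfolding sum_distrib_left sum_subtractf[symmetric]
        by (rule sum.cong) (simp_all add: insert.prems(1) c'_def algebra_simps)
      finally show ?thesis using insert.prems(3) by simp
    qed
    then have "c' j * \<chi> j \<mu> = 0"
      using insert.prems(1,2) j by (intro insert.IH) auto
    with \<nu> show ?thesis by (simp add: c'_def)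
  qed
  moreover from this insert.prems(3)[of \<mu>] insert.hyps have "c k * \<chi> k \<mu> = 0"
    by (simp add: sum.neutral)
  ultimately show ?case using insert.prems(4) by blast
qed simp

text \<open>Different \<open>a\<close> give different characters sending \<open>r\<close> to
  \<open>(Q^a)^r\<close>, so \<open>dedekind\<close> applies. Equality is known from
  \<open>r = 1\<close> on; using it at \<open>Suc r\<close> puts the factor \<open>Q^a\<close> into
  the coefficients \<open>c a\<close>.\<close>

lemma power_sums_inj:
  assumes "finite A" "finite B" and eq: "\<And>r. r \<ge> 1 \<Longrightarrow> (\<Sum>a\<in>A. (Q ^ a) ^ r) = (\<Sum>a\<in>B. (Q ^ a) ^ r)"
  shows "A = B"
proof -
  define c where "c a = (of_bool (a \<in> A) - of_bool (a \<in> B)) * Q ^ a" for a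
  have Q: "Q ^ a = Q ^ b \<longleftrightarrow> a = b" for a b
    using Q_powi_eq_1[of "int a - int b"] by (simp add: power_int_diff)
  have sum: "(\<Sum>a\<in>A \<union> B. c a * (Q ^ a) ^ r) = 0" for r
  proof -
    have "(\<Sum>a\<in>A \<union> B. of_bool (a \<in> A) * (Q ^ a) ^ Suc r) = (\<Sum>a\<in>A. (Q ^ a) ^ Suc r)"
      "(\<Sum>a\<in>A \<union> B. of_bool (a \<in> B) * (Q ^ a) ^ Suc r) = (\<Sum>a\<in>B. (Q ^ a) ^ Suc r)"
      using assms(1,2) by (auto intro!: sum.mono_neutral_cong_right)
    then have "(\<Sum>a\<in>A \<union> B. of_bool (a \<in> A) * (Q ^ a) ^ Suc r) - (\<Sum>a\<in>A \<union> B. of_bool (a \<in> B) * (Q ^ a) ^ Suc r) = 0"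
      using eq[of "Suc r"] by simp
    then show ?thesis
      by (simp add: c_def sum_subtractf[symmetric] algebra_simps)
  qed
  have "c a * (Q ^ a) ^ r = 0" if a: "a \<in> A \<union> B" for a r
  proof (rule dedekind[where X = "A \<union> B" and \<chi> = "\<lambda>a r. (Q ^ a) ^ r"])
    show "\<exists>r. (Q ^ a) ^ r \<noteq> (Q ^ b) ^ r" if "a \<noteq> b" for a b
      using that Q by (metis power_one_right)
  qed (use assms sum a in \<open>auto simp: power_add\<close>)
  from this[of _ 0] have "c a = 0" if "a \<in> A \<union> B" for a using that by simp
  then have "a \<in> A \<longleftrightarrow> a \<in> B" if "a \<in> A \<union> B" for a
    using that by (force simp: c_def)
  then show ?thesis by blast
qed

lemma lam_pts: "lam (pts w) i r = (\<Sum>x\<leftarrow>w. lam (pt x) i r)"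
  by (induction w) simp_all

text \<open>Position \<open>i\<close> receives creation terms only from summands
  \<open>l \<ge> i\<close>. At the largest \<open>i\<close> where the sets of points differ, the
  contributions of \<open>l > i\<close> agree, and those of \<open>l = i\<close> are nonzero
  multiples of power sums of the \<open>Q^a\<close>.\<close>

lemma lam_pts_inj:
  assumes w: "distinct w" and w': "distinct w'"
    and eq: "\<And>i r. r \<ge> 1 \<Longrightarrow> lam (pts w) i r = lam (pts w') i r"
  shows "set w = set w'"
proof (rule ccontr)
  assume neq: "set w \<noteq> set w'"
  define P where "P = (\<lambda>(w :: ('a \<times> nat) list) i. {a. (i, a) \<in> set w})"
  have fin: "finite (P w i)" for w i
    by (rule finite_subset[of _ "snd ` set w"]) (force simp: P_def)+
  define i where "i = Max {i. P w i \<noteq> P w' i}"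
  have "{i. P w i \<noteq> P w' i} \<noteq> {}"
    using neq by (auto simp: P_def)
  then have i: "P w i \<noteq> P w' i"
    using Max_in[of "{i. P w i \<noteq> P w' i}"] by (simp add: i_def)
  have gt: "P w l = P w' l" if "l > i" for l
  proof (rule ccontr)
    assume "P w l \<noteq> P w' l"
    then have "l \<le> i" unfolding i_def by (intro Max_ge) auto
    with that show False by simp
  qed
  define t where "t = (\<lambda>(w :: ('a \<times> nat) list) l r. \<Sum>a\<in>P w l. lam (pt (l, a)) i r)"
  have lam: "lam (pts w) i r = (\<Sum>l\<in>UNIV. t w l r)" if "distinct w" for w r
  proof -
    have "lam (pts w) i r = (\<Sum>x\<in>set w. lam (pt x) i r)"
      using that by (simp add: lam_pts sum_list_distinct_conv_sum_set)
    also have "set w = Sigma UNIV (P w)" by (auto simp: P_def)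
    also have "(\<Sum>x\<in>Sigma UNIV (P w). lam (pt x) i r) = (\<Sum>l\<in>UNIV. t w l r)"
      unfolding t_def by (subst sum.Sigma) (auto simp: fin)
    finally show ?thesis .
  qed
  have t0: "t w l r = 0" if "l < i" for w l r
    using that by (auto simp: t_def pt_def x_data_def intro!: sum.neutral)
  have tgt: "t w l r = t w' l r" if "l > i" for l r
    using gt[OF that] by (simp add: t_def)
  have "t w i r = t w' i r" if "r \<ge> 1" for r
  proof -
    have "(\<Sum>l\<in>UNIV. t w l r) = t w i r + (\<Sum>l\<in>UNIV - {i}. t w l r)" for w
      by (rule sum.remove) auto
    moreover have "(\<Sum>l\<in>UNIV - {i}. t w l r) = (\<Sum>l\<in>UNIV - {i}. t w' l r)"
    proof (rule sum.cong)
      fix l assume "l \<in> UNIV - {i}"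
      then consider "l < i" | "l > i" by force
      then show "t w l r = t w' l r" by cases (simp_all add: t0 tgt)
    qed simp
    ultimately show ?thesis
      using eq[OF that, of i] lam[OF w, of r] lam[OF w', of r] by simp
  qed
  moreover have "t w i r = plus_lam r * (q ^ pos i) ^ r * (\<Sum>a\<in>P w i. (Q ^ a) ^ r)" for w r
    by (simp add: t_def pt_def x_data_def sum_distrib_left mult_ac)
  moreover have "plus_lam r * (q ^ pos i) ^ r \<noteq> 0" if "r \<ge> 1" for r
    using that qint_neq_0[of r] by (simp add: plus_lam_def)
  ultimately have "(\<Sum>a\<in>P w i. (Q ^ a) ^ r) = (\<Sum>a\<in>P w' i. (Q ^ a) ^ r)" if "r \<ge> 1" for r
    using that mult_cancel_left[of "plus_lam r * (q ^ pos i) ^ r"] by simp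
  then have "P w i = P w' i"
    using fin by (intro power_sums_inj) auto
  with i show False by blast
qed

text \<open>Evaluation of the Heisenberg variables at \<open>y\<close> and of the lattice elements
  at 1. The creation exponentials become scalar series that are multiplicative in \<open>y\<close>,
  that is, characters with values in a domain, as \<open>dedekind\<close> demands.\<close>

definition evl :: "('c::finite \<Rightarrow> nat \<Rightarrow> F) \<Rightarrow> ('c \<Rightarrow> fock) vec \<Rightarrow> F" where
  "evl y = lin_ext (*) (\<lambda>b. \<Prod>i\<in>UNIV. mon (fst (b i)) (y i))"

lemma monoid_char_evl: "monoid_char (\<lambda>c. c) (*) (\<lambda>b. \<Prod>i\<in>UNIV. mon (fst (b i)) (y i :: nat \<Rightarrow> F))"
  by unfold_locales (simp_all add: mon_add prod.distrib)

lemma rhom_evl: "rhom (evl y)"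
  unfolding evl_def by (rule monoid_char.rhom_ext[OF monoid_char_evl])

lemma evl_cst: "evl y (cst c) = c"
  unfolding evl_def by (rule monoid_char.ext_cst[OF monoid_char_evl])

lemma evl_lat: "evl y (lat n) = 1"
  by (simp add: evl_def lat_def monoid_char.ext_single[OF monoid_char_evl])

lemma evl_gen: "evl y (gen i r) = y i r"
proof -
  define b :: "'a \<Rightarrow> fock" where "b = (\<lambda>_. 0)(i := (Poly_Mapping.single r 1, 0))"
  have "(\<Prod>j\<in>UNIV. mon (fst (b j)) (y j)) = (\<Prod>j\<in>UNIV. if j = i then y i r else 1)"
    by (rule prod.cong) (auto simp: b_def)
  then show ?thesis
    unfolding evl_def gen_def b_def[symmetric] monoid_char.ext_single[OF monoid_char_evl] by simp
qed

definition exp_chi :: "('c::{finite, linorder} \<times> nat) list \<Rightarrow> ('c \<Rightarrow> nat \<Rightarrow> F) \<Rightarrow> F fps" where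
  "exp_chi w y = fps_map (evl y) (exp_fps (\<lambda>r. \<Sum>i\<in>UNIV. cst (lam (pts w) i r) * gen i (r - 1)))"

lemma is_exp_chi: "is_exp (Abs_fps (\<lambda>r. \<Sum>i\<in>UNIV. lam (pts w) i r * y i (r - 1))) (exp_chi w y)"
proof -
  interpret rhom "evl y" by (rule rhom_evl)
  have "is_exp (fps_map (evl y) (Abs_fps (\<lambda>r. \<Sum>i\<in>UNIV. cst (lam (pts w) i r) * gen i (r - 1)))) (exp_chi w y)"
    unfolding exp_chi_def by (rule is_exp_map[OF rhom_axioms is_exp_exp_fps])
  also have "fps_map (evl y) (Abs_fps (\<lambda>r. \<Sum>i\<in>UNIV. cst (lam (pts w) i r) * gen i (r - 1))) =
      Abs_fps (\<lambda>r. \<Sum>i\<in>UNIV. lam (pts w) i r * y i (r - 1))"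
    by (rule fps_ext) (simp add: sum mult evl_cst evl_gen)
  finally show ?thesis .
qed

lemma exp_chi_add: "exp_chi w (y + y') = exp_chi w y * exp_chi w y'"
proof (rule is_exp_unique[OF _ is_exp_chi is_exp_add[OF is_exp_chi is_exp_chi]])
  show "x = x'" if "of_nat (Suc n) * x = of_nat (Suc n) * x'" for n and x x' :: F
    using that by (simp del: of_nat_Suc)
  show "fps_deriv (Abs_fps (\<lambda>r. \<Sum>i\<in>UNIV. lam (pts w) i r * (y + y') i (r - 1))) =
    fps_deriv (Abs_fps (\<lambda>r. \<Sum>i\<in>UNIV. lam (pts w) i r * y i (r - 1)) + Abs_fps (\<lambda>r. \<Sum>i\<in>UNIV. lam (pts w) i r * y' i (r - 1)))"
    by (rule arg_cong[where f = fps_deriv], rule fps_ext) (simp add: distrib_left sum.distrib)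
qed

lemma exp_chi_neq_0: "exp_chi w y \<noteq> 0"
  using is_exp_chi[of w y] by (auto simp: is_exp_def)

text \<open>The unit vector at \<open>(i, r - 1)\<close> isolates one coefficient of the exponent,
  and cancelling the nonzero exponential in its differential equation recovers that
  coefficient.\<close>

lemma exp_chi_inj:
  assumes "\<And>y. exp_chi w y = exp_chi w' y" and "r \<ge> 1"
  shows "lam (pts w) i r = lam (pts w') i r"
proof -
  define y where "y = (\<lambda>j s. of_bool (j = i \<and> s = r - 1) :: F)"
  have "fps_deriv (Abs_fps (\<lambda>r. \<Sum>i\<in>UNIV. lam (pts w) i r * y i (r - 1))) * exp_chi w y =
     fps_deriv (Abs_fps (\<lambda>r. \<Sum>i\<in>UNIV. lam (pts w') i r * y i (r - 1))) * exp_chi w y"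
    using is_exp_chi[of w y] is_exp_chi[of w' y] assms(1)[of y] unfolding is_exp_def by metis
  then have "fps_deriv (Abs_fps (\<lambda>r. \<Sum>i\<in>UNIV. lam (pts w) i r * y i (r - 1))) $ (r - 1) =
     fps_deriv (Abs_fps (\<lambda>r. \<Sum>i\<in>UNIV. lam (pts w') i r * y i (r - 1))) $ (r - 1)"
    using exp_chi_neq_0[of w y] by simp
  then have "(\<Sum>j\<in>UNIV. lam (pts w) j r * y j (r - 1)) = (\<Sum>j\<in>UNIV. lam (pts w') j r * y j (r - 1))"
    using assms(2) by (cases r) (simp_all del: of_nat_Suc)
  moreover have "(\<Sum>j\<in>UNIV. lam (pts w) j r * y j (r - 1)) = lam (pts w) i r" for w
  proof -
    have "(\<Sum>j\<in>UNIV. lam (pts w) j r * y j (r - 1)) = (\<Sum>j\<in>UNIV. if j = i then lam (pts w) i r else 0)"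
      by (rule sum.cong) (auto simp: y_def)
    then show ?thesis by simp
  qed
  ultimately show ?thesis by simp
qed

lemma evl_nprod:
  "fls_map (evl y) (nprod w 1) = fls_const (cf w) * (Zp (ze w) * fps_to_fls (exp_chi w y))"
proof -
  interpret e: rhom "evl y" by (rule rhom_evl)
  interpret em: rhom "fls_map (evl y)" by (rule rhom_fls_map[OF rhom_evl])
  have c: "fls_map (evl y) (fls_const v) = fls_const (evl y v)" for v
    by (rule fls_map_const) (rule e.zero)
  have "nprod w 1 = fcst (cf w) * (Zp (ze w) * creat (pts w))"
    by (simp add: nprod_def cur_smul_def cur_shift_eq fls_smul_cst vop_def rhom.one[OF rhom_tau])
  then show ?thesis
    by (simp only: em.mult c evl_cst fls_map_Zp[OF rhom_evl] creat_def evl_lat fls_map_fps_to_fls[of "evl y", OF e.zero] exp_chi_def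
        fls_const_1 mult_1_left)
qed

text \<open>The relation is applied to the vacuum vector 1, on which a regularized product is a
  scalar and a power of \<open>z\<close> times its creation exponential. After evaluation
  \<open>dedekind\<close> over \<open>F((z))\<close> separates the coloured lists, and the exponent
  of \<open>z\<close> separates the shifts \<open>k\<close>. Strictly increasing points let the set
  of coloured points determine the list.\<close>

theorem xprod_independent:
  fixes w :: "('c::{finite, linorder} \<times> nat) list"
  assumes "finite A" and srt: "\<And>k as. (k, as) \<in> A \<Longrightarrow> sorted_wrt (<) as"
    and zero: "(\<Sum>(k, as)\<in>A. cur_smul (f k as) (cur_shift k (xprod as))) = (0 :: ('c \<Rightarrow> fock) cur)"
    and k: "(k, map snd w) \<in> A" and cf: "cf w \<noteq> 0"
  shows "f k (map snd w) = 0"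
proof -
  define K where "K = fst ` A"
  define L where "L = snd ` A"
  \<comment> \<open>Extension by zero to the rectangle \<open>K \<times> L\<close>, so that the sums
    over shifts and over lists of points can be exchanged.\<close>
  define f0 where "f0 k as = (if (k, as) \<in> A then f k as else 0)" for k as
  have fin: "finite K" "finite L" using assms(1) by (simp_all add: K_def L_def)
  define X where "X = Sigma L (\<lambda>as. {w :: ('c \<times> nat) list. map snd w = as})"
  \<comment> \<open>All shifts of one coloured list share the same exponential; their coefficients
    are gathered into one element of \<open>F((z))\<close>.\<close>
  define C where "C p = (\<Sum>k\<in>K. fls_const (f0 k (fst p) * cf (snd p)) * Zp (k + ze (snd p)))" for p :: "nat list \<times> ('c \<times> nat) list"
  have [simp]: "cur_smul 0 a = 0" for a :: "('c \<Rightarrow> fock) cur"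
    by (simp add: cur_smul_def fls_smul_cst fun_eq_iff)
  have z0: "(\<Sum>(k, as)\<in>K \<times> L. cur_smul (f0 k as) (cur_shift k (xprod as))) = (0 :: ('c \<Rightarrow> fock) cur)"
  proof -
    have "(\<Sum>(k, as)\<in>A. cur_smul (f k as) (cur_shift k (xprod as))) =
        (\<Sum>(k, as)\<in>K \<times> L. cur_smul (f0 k as) (cur_shift k (xprod as) :: ('c \<Rightarrow> fock) cur))"
      by (rule sum.mono_neutral_cong_left) (use fin in \<open>auto simp: K_def L_def f0_def rev_image_eqI\<close>)
    with zero show ?thesis by simp
  qed
  have "(\<Sum>p\<in>X. C p * fps_to_fls (exp_chi (snd p) y)) = 0" for y
  proof -
    interpret e: rhom "evl y :: ('c \<Rightarrow> fock) vec \<Rightarrow> F" by (rule rhom_evl)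
    interpret em: rhom "fls_map (evl y :: ('c \<Rightarrow> fock) vec \<Rightarrow> F)" by (rule rhom_fls_map[OF rhom_evl])
    have c: "fls_map (evl y) (fls_const v) = fls_const (evl y v)" for v :: "('c \<Rightarrow> fock) vec"
      by (rule fls_map_const) (rule e.zero)
    have ap: "(\<Sum>i\<in>I. g i) v = (\<Sum>i\<in>I. g i v)" for I :: "'i set" and g :: "'i \<Rightarrow> ('c \<Rightarrow> fock) cur" and v
      by (induction I rule: infinite_finite_induct) simp_all
    have "0 = fls_map (evl y) ((\<Sum>(k, as)\<in>K \<times> L. cur_smul (f0 k as) (cur_shift k (xprod as :: ('c \<Rightarrow> fock) cur))) 1)"
      by (simp add: z0 em.zero)
    also have "\<dots> = (\<Sum>(k, as)\<in>K \<times> L. \<Sum>w | map snd w = as.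
        fls_const (f0 k as) * (Zp k * (fls_const (cf w) * (Zp (ze w) * fps_to_fls (exp_chi w y)))))"
      unfolding ap em.sum
      by (rule sum.cong)
        (auto simp only: cur_smul_def cur_shift_eq fls_smul_cst xprod_def ap em.mult em.sum c evl_cst
          fls_map_Zp[OF rhom_evl] evl_nprod sum_distrib_left split: prod.splits)
    also have "\<dots> = (\<Sum>as\<in>L. \<Sum>w | map snd w = as. \<Sum>k\<in>K.
        fls_const (f0 k as) * (Zp k * (fls_const (cf w) * (Zp (ze w) * fps_to_fls (exp_chi w y)))))"
      by (subst sum.cartesian_product[symmetric], subst sum.swap, rule sum.cong, rule refl, rule sum.swap)
    also have "\<dots> = (\<Sum>as\<in>L. \<Sum>w | map snd w = as. C (as, w) * fps_to_fls (exp_chi w y))"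
      unfolding C_def fst_conv snd_conv sum_distrib_right Zp_add rhom.mult[OF rhom_fls_const] by (simp only: mult_ac)
    also have "\<dots> = (\<Sum>p\<in>X. C p * fps_to_fls (exp_chi (snd p) y))"
      unfolding X_def by (subst sum.Sigma) (auto simp: fin intro!: sum.cong)
    finally show ?thesis ..
  qed
  then have "C (map snd w, w) * fps_to_fls (exp_chi (snd (map snd w, w)) 0) = 0"
  proof (rule dedekind[where X = X and \<chi> = "\<lambda>p y. fps_to_fls (exp_chi (snd p) y)", rotated 3])
    show "finite X" unfolding X_def using fin by auto
    show "(map snd w, w) \<in> X" using k by (force simp: X_def L_def)
    show "fps_to_fls (exp_chi (snd p) (y + y')) = fps_to_fls (exp_chi (snd p) y) * fps_to_fls (exp_chi (snd p) y')" for p y y'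
      by (simp add: exp_chi_add fls_times_fps_to_fls)
    fix p p' assume p: "p \<in> X" "p' \<in> X" "p \<noteq> p'"
    obtain w1 w2 where w: "p = (map snd w1, w1)" "p' = (map snd w2, w2)" "map snd w1 \<in> L" "map snd w2 \<in> L"
      using p by (auto simp: X_def)
    have s: "sorted_wrt (<) (map snd w1)" "sorted_wrt (<) (map snd w2)"
      using w srt by (auto simp: L_def)
    then have d: "distinct w1" "distinct w2"
      using strict_sorted_iff distinct_map by blast+
    show "\<exists>y. fps_to_fls (exp_chi (snd p) y) \<noteq> fps_to_fls (exp_chi (snd p') y)"
    proof (rule ccontr)
      assume "\<not> ?thesis"
      then have "exp_chi w1 y = exp_chi w2 y" for y by (simp add: w)
      then have set: "set w1 = set w2"
        by (intro lam_pts_inj d exp_chi_inj)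
      have "w1 = w2"
      proof -
        have "sorted (map snd w1)" "sorted (map snd w2)" "inj_on snd (set w1 \<union> set w2)"
          using s set by (auto simp: strict_sorted_iff distinct_map)
        then show ?thesis
          using set d by (metis map_sorted_distinct_set_unique distinct_map s strict_sorted_iff)
      qed
      with p w show False by simp
    qed
  qed
  then have "C (map snd w, w) = 0"
    using exp_chi_neq_0[of w 0] by simp
  then have "0 = C (map snd w, w) $$ (k + ze w)" by simp
  also have "\<dots> = (\<Sum>k'\<in>K. if k' = k then f0 k (map snd w) * cf w else 0)"
    unfolding C_def fls_nth_sum fst_conv snd_conv by (intro sum.cong) auto
  also have "\<dots> = f k (map snd w) * cf w"
    using k fin by (force simp: K_def f0_def)
  finally show ?thesis using cf by simp
qed

lemma cf_neq_0:
  "sorted_wrt (\<lambda>x x'. snd x < snd x' \<and> (snd x' = Suc (snd x) \<longrightarrow> fst x > fst x')) w \<Longrightarrow> cf w \<noteq> 0"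
proof (induction w)
  case (Cons x w)
  have "pair_scl (pt x) n \<noteq> 0" for n
    using valid_pt[of x] by (simp add: pair_scl_def valid_def)
  moreover have "gg x x' \<noteq> 0" if "x' \<in> set w" for x'
    using Cons.prems that by (intro gg_neq_0) auto
  ultimately show ?case
    using Cons by (auto simp: prod_list_zero_iff)
qed simp

section \<open>A commutative model of the algebra of currents\<close>

text \<open>
  The basis vector \<open>(k, S)\<close> of the model stands for $z^k$ times the regularized product of the
  $x(z\mathsf q^a)$, $a\in S$, in increasing order of $a$.
\<close>

type_synonym model = "(int \<times> nat multiset) vec"

text \<open>The substitution of \<open>z Q\<close> for \<open>z\<close>: it moves every point up by
  one.\<close>

definition msigma :: "model \<Rightarrow> model" where
  "msigma = lin_ext smul (\<lambda>(k, S). Poly_Mapping.single (k, image_mset Suc S) (Q powi k))"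

lemma monoid_char_msigma:
  "monoid_char cst smul (\<lambda>(k, S). Poly_Mapping.single (k, image_mset Suc S) (Q powi k) :: model)"
  by unfold_locales
    (auto simp: cst_add cst_mult smul_cst mult_single power_int_add zero_prod_def single_one[symmetric] simp del: single_one)

lemma rhom_msigma: "rhom msigma"
  unfolding msigma_def by (rule monoid_char.rhom_ext[OF monoid_char_msigma])

lemma msigma_cst: "msigma (cst c) = cst c"
  unfolding msigma_def by (rule monoid_char.ext_cst[OF monoid_char_msigma])

lemma msigma_single: "msigma (Poly_Mapping.single (k, S) c) = Poly_Mapping.single (k, image_mset Suc S) (c * Q powi k)"
  unfolding msigma_def monoid_char.ext_single[OF monoid_char_msigma]
  by (simp add: cst_def mult_single)

definition zinv :: model where
  "zinv = Poly_Mapping.single (- 1, {#}) 1"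

lemma msigma_zinv: "msigma zinv = cst (inverse Q) * zinv"
  by (simp add: zinv_def msigma_single cst_def mult_single)

definition mderiv :: "model \<Rightarrow> model" where
  "mderiv f = cst (inverse (Q - 1)) * (zinv * (msigma f - f))"

definition mdiv :: "nat \<Rightarrow> model \<Rightarrow> model"  \<comment> \<open>divided power of \<open>mderiv\<close>\<close>
  where "mdiv n f = cst (inverse (Qfact n)) * (mderiv ^^ n) f"

abbreviation msig :: "nat \<Rightarrow> model \<Rightarrow> model" where
  "msig n \<equiv> msigma ^^ n"

lemma rhom_funpow:
  fixes h :: "'a::comm_ring_1 \<Rightarrow> 'a"
  shows "rhom h \<Longrightarrow> rhom (h ^^ n)"
  by (induction n) (auto simp: rhom_def)

lemmas rhom_msig = rhom_funpow[OF rhom_msigma]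

lemma msig_cst: "msig n (cst c) = cst c"
  by (induction n) (simp_all add: msigma_cst)

lemma mderiv_add: "mderiv (f + g) = mderiv f + mderiv g"
  by (simp add: mderiv_def rhom.add[OF rhom_msigma] algebra_simps)

lemma mderiv_cst: "mderiv (cst c * f) = cst c * mderiv f"
  by (simp add: mderiv_def rhom.mult[OF rhom_msigma] msigma_cst algebra_simps)

lemma mderiv_pow_add: "(mderiv ^^ n) (f + g) = (mderiv ^^ n) f + (mderiv ^^ n) g"
  by (induction n) (simp_all add: mderiv_add)

lemma mderiv_pow_cst: "(mderiv ^^ n) (cst c * f) = cst c * (mderiv ^^ n) f"
  by (induction n) (simp_all add: mderiv_cst)

lemma mdiv_add: "mdiv n (f + g) = mdiv n f + mdiv n g"
  by (simp add: mdiv_def mderiv_pow_add distrib_left)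

lemma mdiv_cst: "mdiv n (cst c * f) = cst c * mdiv n f"
  unfolding mdiv_def mderiv_pow_cst by (simp only: mult_ac)

lemma mderiv_0 [simp]: "mderiv 0 = 0"
  using mderiv_cst[of 0 0] by simp

lemma mderiv_pow_0 [simp]: "(mderiv ^^ n) 0 = 0"
  by (induction n) simp_all

lemma mderiv_sum: "mderiv (sum f A) = (\<Sum>i\<in>A. mderiv (f i))"
  by (induction A rule: infinite_finite_induct) (simp_all add: mderiv_add)

lemma mderiv_mult: "mderiv (f * g) = mderiv f * msigma g + f * mderiv g"
  by (simp add: mderiv_def rhom.mult[OF rhom_msigma] algebra_simps)

text \<open>The factor \<open>Q\<close> compensates the \<open>Q^-1\<close> by which
  \<open>msigma\<close> scales \<open>zinv\<close>.\<close>

lemma mderiv_msigma: "mderiv (msigma f) = cst Q * msigma (mderiv f)"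
proof -
  have "cst Q * msigma (mderiv f) = (cst Q * cst (inverse Q)) * (cst (inverse (Q - 1)) * (zinv * (msigma (msigma f) - msigma f)))"
    unfolding mderiv_def rhom.mult[OF rhom_msigma] rhom.diff[OF rhom_msigma] msigma_cst msigma_zinv by (simp only: mult_ac)
  also have "cst Q * cst (inverse Q) = (1 :: model)"
    unfolding cst_mult[symmetric] by simp
  finally show ?thesis by (simp add: mderiv_def)
qed

lemma mderiv_msig: "mderiv (msig m f) = cst (Q ^ m) * msig m (mderiv f)"
  by (induction m) (simp_all add: mderiv_msigma rhom.mult[OF rhom_msigma] msigma_cst cst_mult mult_ac)

lemma mderiv_pow_msig: "(mderiv ^^ n) (msig m f) = cst (Q ^ (n * m)) * msig m ((mderiv ^^ n) f)"
  by (induction n) (simp_all add: mderiv_cst mderiv_msig cst_mult power_add mult_ac)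

lemma mdiv_msig: "mdiv n (msig m f) = cst (Q ^ (n * m)) * msig m (mdiv n f)"
  by (simp add: mdiv_def mderiv_pow_msig rhom.mult[OF rhom_msig] msig_cst mult_ac)

section \<open>Divided powers of the twisted derivation\<close>

lemma Q_neq_1: "Q \<noteq> 1"
  using Q_pow_eq_1[of 1] by simp

lemma Qnum_of_nat: "Qnum (int n) = (Q ^ n - 1) / (Q - 1)"
  by (simp add: Qnum_def)

lemma Qnum_neq_0: "n > 0 \<Longrightarrow> Qnum (int n) \<noteq> 0"
  by (simp add: Qnum_of_nat Q_neq_1 Q_pow_eq_1)

lemma Qfact_Suc: "Qfact (Suc n) = Qfact n * Qnum (int (Suc n))"
  by (simp add: Qfact_def)

lemma Qfact_neq_0 [simp]: "Qfact n \<noteq> 0"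
  unfolding Qfact_def using Qnum_neq_0 by (simp del: of_nat_Suc)

lemma Qnum_split: "j \<le> n \<Longrightarrow> Qnum (int j) + Q ^ j * Qnum (int (n - j)) = Qnum (int n)"
proof -
  assume "j \<le> n"
  then have "Q ^ j * Q ^ (n - j) = Q ^ n" by (simp flip: power_add)
  then show ?thesis
    unfolding Qnum_of_nat times_divide_eq_right add_divide_distrib[symmetric] by (simp add: right_diff_distrib)
qed

lemma mderiv_mdiv: "mderiv (mdiv n f) = cst (Qnum (int (Suc n))) * mdiv (Suc n) f"
proof -
  have "Qnum (int (Suc n)) * inverse (Qfact (Suc n)) = inverse (Qfact n)"
    using Qnum_neq_0[of "Suc n"] unfolding Qfact_Suc by (simp add: field_simps del: of_nat_Suc)
  then show ?thesis
    by (simp add: mdiv_def mderiv_cst mult.assoc[symmetric] cst_mult[symmetric] del: of_nat_Suc)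
qed

lemma cst_cancel: "c \<noteq> 0 \<Longrightarrow> cst c * f = cst c * g \<Longrightarrow> f = (g :: 'k::comm_monoid_add vec)"
proof -
  assume c: "c \<noteq> 0" "cst c * f = cst c * g"
  have "f = cst (inverse c) * (cst c * f)" for f :: "'k vec"
    using c(1) by (simp add: mult.assoc[symmetric] cst_mult[symmetric])
  with c(2) show ?thesis by metis
qed

text \<open>Differentiating the \<open>l\<close>-th term feeds the terms \<open>l + 1\<close> and
  \<open>l\<close>; by \<open>Qnum_split\<close> the coefficients of each term add up to the
  q-number of \<open>s + 1\<close>, which is then cancelled. Divided powers absorb the binomials of
  the q-Leibniz rule.\<close>

lemma mdiv_mult: "mdiv s (f * g) = (\<Sum>l\<le>s. mdiv l f * msig l (mdiv (s - l) g))"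
proof (induction s)
  case 0
  show ?case by (simp add: mdiv_def Qfact_def)
next
  case (Suc s)
  define T where "T j = mdiv j f * msig j (mdiv (Suc s - j) g)" for j
  have 1: "mderiv (mdiv l f * msig l (mdiv (s - l) g)) =
      cst (Qnum (int (Suc l))) * T (Suc l) + cst (Q ^ l * Qnum (int (Suc s - l))) * T l" if "l \<le> s" for l
    using that
    by (simp add: mderiv_mult mderiv_mdiv mderiv_msig T_def rhom.mult[OF rhom_msig] msig_cst cst_mult Suc_diff_le mult_ac del: of_nat_Suc)
  have "cst (Qnum (int (Suc s))) * mdiv (Suc s) (f * g) = mderiv (mdiv s (f * g))"
    by (simp only: mderiv_mdiv)
  also have "\<dots> = (\<Sum>l\<le>s. cst (Qnum (int (Suc l))) * T (Suc l)) + (\<Sum>l\<le>s. cst (Q ^ l * Qnum (int (Suc s - l))) * T l)"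
    unfolding Suc.IH mderiv_sum sum.distrib[symmetric] by (rule sum.cong) (simp_all add: 1 del: of_nat_Suc)
  also have "(\<Sum>l\<le>s. cst (Qnum (int (Suc l))) * T (Suc l)) = (\<Sum>j\<le>Suc s. cst (Qnum (int j)) * T j)"
    unfolding sum.atMost_Suc_shift[of "\<lambda>j. cst (Qnum (int j)) * T j"] by (simp add: Qnum_def del: of_nat_Suc)
  also have "(\<Sum>l\<le>s. cst (Q ^ l * Qnum (int (Suc s - l))) * T l) = (\<Sum>j\<le>Suc s. cst (Q ^ j * Qnum (int (Suc s - j))) * T j)"
    by (simp add: Qnum_def)
  also have "(\<Sum>j\<le>Suc s. cst (Qnum (int j)) * T j) + (\<Sum>j\<le>Suc s. cst (Q ^ j * Qnum (int (Suc s - j))) * T j)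
      = (\<Sum>j\<le>Suc s. cst (Qnum (int (Suc s))) * T j)"
    unfolding sum.distrib[symmetric]
    by (rule sum.cong) (simp_all only: Qnum_split atMost_iff flip: distrib_right cst_add)
  finally have "cst (Qnum (int (Suc s))) * mdiv (Suc s) (f * g) = cst (Qnum (int (Suc s))) * (\<Sum>j\<le>Suc s. T j)"
    by (simp only: sum_distrib_left)
  then show ?case
    unfolding T_def by (rule cst_cancel[rotated]) (use Qnum_neq_0[of "Suc s"] in simp)
qed

lemma Qbinom_eq: "Qbinom (int (l + r)) l = Qfact (l + r) / (Qfact l * Qfact r)"
proof -
  have "(\<Prod>i<l. Qnum (int (l + r) - int i)) * Qfact r = Qfact (l + r)"
  proof (induction l)
    case (Suc l)
    have "(\<Prod>i<Suc l. Qnum (int (Suc l + r) - int i)) = Qnum (int (Suc l + r)) * (\<Prod>i<l. Qnum (int (l + r) - int i))"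
      by (subst prod.lessThan_Suc_shift) simp
    with Suc show ?case by (simp add: Qfact_Suc mult_ac del: of_nat_Suc)
  qed simp
  then have "(\<Prod>i<l. Qnum (int (l + r) - int i)) = Qfact (l + r) / Qfact r"
    by (simp add: eq_divide_eq)
  then show ?thesis by (simp add: Qbinom_def)
qed

lemma mdiv_mdiv: "mdiv l (mdiv r f) = cst (Qbinom (int (l + r)) l) * mdiv (l + r) f"
proof -
  have "inverse (Qfact l) * inverse (Qfact r) = Qbinom (int (l + r)) l * inverse (Qfact (l + r))"
    by (simp only: Qbinom_eq) (simp add: field_simps)
  then show ?thesis
    unfolding mdiv_def mderiv_pow_cst funpow_add o_apply mult.assoc[symmetric] cst_mult[symmetric] by simp
qed

text \<open>The model of the product in mode \<open>-r-1\<close> of elements \<open>f\<close> of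
  weight \<open>\<alpha>\<close> and \<open>g\<close>; the limit becomes plain
  multiplication.\<close>

definition mmul :: "nat \<Rightarrow> nat \<Rightarrow> model \<Rightarrow> model \<Rightarrow> model" where
  "mmul r \<alpha> f g = mdiv r f * msig (\<alpha> + r) g"

text \<open>The sum is the q-Leibniz rule for \<open>mdiv s\<close>. Iterated divided powers give
  the q-binomial, and commuting the derivation with the shift by \<open>\<alpha> + r\<close> gives
  the power of \<open>Q\<close>. The shifts of \<open>h\<close> agree as \<open>(\<alpha> + r + l) +
  (\<beta> + s - l) = \<alpha> + \<beta> + r + s\<close>.\<close>

lemma mmul_assoc:
  "mmul s (\<alpha> + \<beta> + r) (mmul r \<alpha> f g) h =
    (\<Sum>l\<le>s. cst (Qbinom (int (l + r)) l * Q ^ ((s - l) * (\<alpha> + r))) * mmul (r + l) \<alpha> f (mmul (s - l) \<beta> g h))"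
proof -
  have "mmul s (\<alpha> + \<beta> + r) (mmul r \<alpha> f g) h =
      (\<Sum>l\<le>s. mdiv l (mdiv r f) * msig l (mdiv (s - l) (msig (\<alpha> + r) g)) * msig (\<alpha> + \<beta> + r + s) h)"
    unfolding mmul_def mdiv_mult sum_distrib_right ..
  also have "\<dots> = (\<Sum>l\<le>s. cst (Qbinom (int (l + r)) l * Q ^ ((s - l) * (\<alpha> + r))) * mmul (r + l) \<alpha> f (mmul (s - l) \<beta> g h))"
  proof (rule sum.cong)
    fix l assume "l \<in> {..s}"
    then have 1: "\<alpha> + \<beta> + r + s = (\<alpha> + (r + l)) + (\<beta> + (s - l))" by simp
    have 2: "msig l (msig (\<alpha> + r) x) = msig (\<alpha> + (r + l)) x" for x
    proof -
      have "\<alpha> + (r + l) = l + (\<alpha> + r)" by simp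
      then show ?thesis by (simp only: funpow_add o_apply)
    qed
    have 3: "msig (\<alpha> + \<beta> + r + s) x = msig (\<alpha> + (r + l)) (msig (\<beta> + (s - l)) x)" for x
      unfolding 1 by (simp add: funpow_add)
    show "mdiv l (mdiv r f) * msig l (mdiv (s - l) (msig (\<alpha> + r) g)) * msig (\<alpha> + \<beta> + r + s) h =
       cst (Qbinom (int (l + r)) l * Q ^ ((s - l) * (\<alpha> + r))) * mmul (r + l) \<alpha> f (mmul (s - l) \<beta> g h)"
      unfolding mmul_def mdiv_mdiv mdiv_msig rhom.mult[OF rhom_msig] msig_cst 2 3 cst_mult add.commute[of l r]
      by (simp only: mult_ac)
  qed simp
  finally show ?thesis .
qed

section \<open>Bounds on the points\<close>

definition below :: "nat \<Rightarrow> model \<Rightarrow> bool" where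
  "below \<alpha> f \<longleftrightarrow> (\<forall>x\<in>Poly_Mapping.keys f. \<forall>a\<in>#snd x. a < \<alpha>)"

definition above :: "nat \<Rightarrow> model \<Rightarrow> bool" where
  "above \<alpha> f \<longleftrightarrow> (\<forall>x\<in>Poly_Mapping.keys f. \<forall>a\<in>#snd x. \<alpha> \<le> a)"

lemma below_0 [simp]: "below \<alpha> 0"
  by (simp add: below_def)

lemma below_single: "(\<And>a. a \<in># S \<Longrightarrow> a < \<alpha>) \<Longrightarrow> below \<alpha> (Poly_Mapping.single (k, S) c)"
  by (simp add: below_def)

lemma below_add: "below \<alpha> f \<Longrightarrow> below \<alpha> g \<Longrightarrow> below \<alpha> (f + g)"
  using keys_add[of f g] unfolding below_def by blast

lemma below_uminus: "below \<alpha> f \<Longrightarrow> below \<alpha> (- f)"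
  by (simp add: below_def)

lemma below_diff: "below \<alpha> f \<Longrightarrow> below \<alpha> g \<Longrightarrow> below \<alpha> (f - g)"
  using below_add[OF _ below_uminus, of \<alpha> f g] by simp

lemma below_mono: "below \<alpha> f \<Longrightarrow> \<alpha> \<le> \<beta> \<Longrightarrow> below \<beta> f"
  unfolding below_def by fastforce

lemma below_mult:
  assumes "below \<alpha> f" "below \<alpha> g" shows "below \<alpha> (f * g)"
  unfolding below_def
proof (intro ballI)
  fix x a assume x: "x \<in> Poly_Mapping.keys (f * g)" and a: "a \<in># snd x"
  obtain y z where "y \<in> Poly_Mapping.keys f" "z \<in> Poly_Mapping.keys g" "x = y + z"
    using subsetD[OF keys_mult x] by blast
  with assms a show "a < \<alpha>" by (auto simp: below_def)
qed

lemma below_cst [simp]: "below \<alpha> (cst c)"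
  by (simp add: below_def cst_def zero_prod_def)

lemma below_1 [simp]: "below \<alpha> 1"
  using below_cst[of \<alpha> 1] by (simp del: below_cst)

lemma below_zinv [simp]: "below \<alpha> zinv"
  by (simp add: below_def zinv_def)

lemma keys_msigma:
  assumes "x \<in> Poly_Mapping.keys (msigma f)"
  obtains y where "y \<in> Poly_Mapping.keys f" "x = (fst y, image_mset Suc (snd y))"
proof -
  have "msigma f = (\<Sum>y\<in>Poly_Mapping.keys f. msigma (Poly_Mapping.single y (Poly_Mapping.lookup f y)))"
    by (subst (1) poly_mapping_sum_single[OF finite_keys subset_refl, of f]) (rule rhom.sum[OF rhom_msigma])
  then have "x \<in> (\<Union>y\<in>Poly_Mapping.keys f. Poly_Mapping.keys (msigma (Poly_Mapping.single y (Poly_Mapping.lookup f y))))"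
    using assms keys_sum[of "\<lambda>y. msigma (Poly_Mapping.single y (Poly_Mapping.lookup f y))" "Poly_Mapping.keys f"] by auto
  then obtain y where y: "y \<in> Poly_Mapping.keys f" "x \<in> Poly_Mapping.keys (msigma (Poly_Mapping.single y (Poly_Mapping.lookup f y)))"
    by blast
  have "Poly_Mapping.keys (msigma (Poly_Mapping.single y c)) \<subseteq> {(fst y, image_mset Suc (snd y))}" for c
    by (cases y) (simp add: msigma_single)
  with y that show ?thesis by blast
qed

lemma below_msigma: "below \<alpha> f \<Longrightarrow> below (Suc \<alpha>) (msigma f)"
  unfolding below_def by (auto elim!: keys_msigma)

lemma below_msig: "below \<alpha> f \<Longrightarrow> below (\<alpha> + n) (msig n f)"
  by (induction n) (auto intro: below_msigma)

text \<open>The derivative contains the shifted term, so the bound grows by one; this matches the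
  extra weight \<open>r\<close> of a product in mode \<open>-r-1\<close>.\<close>

lemma below_mderiv: "below \<alpha> f \<Longrightarrow> below (Suc \<alpha>) (mderiv f)"
proof -
  assume f: "below \<alpha> f"
  then have "below (Suc \<alpha>) f" by (rule below_mono) simp
  with f show ?thesis
    unfolding mderiv_def by (intro below_mult below_cst below_zinv below_diff below_msigma)
qed

lemma below_mdiv: "below \<alpha> f \<Longrightarrow> below (\<alpha> + n) (mdiv n f)"
proof -
  assume "below \<alpha> f"
  then have "below (\<alpha> + n) ((mderiv ^^ n) f)"
    by (induction n) (auto intro: below_mderiv)
  then show ?thesis unfolding mdiv_def by (intro below_mult below_cst)
qed

lemma below_mmul: "below \<alpha> f \<Longrightarrow> below \<beta> g \<Longrightarrow> below (\<alpha> + \<beta> + r) (mmul r \<alpha> f g)"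
proof -
  assume f: "below \<alpha> f" and g: "below \<beta> g"
  have "below (\<alpha> + \<beta> + r) (mdiv r f)"
    by (rule below_mono[OF below_mdiv[OF f]]) simp
  moreover have "below (\<alpha> + \<beta> + r) (msig (\<alpha> + r) g)"
    by (rule below_mono[OF below_msig[OF g]]) simp
  ultimately show ?thesis
    unfolding mmul_def by (rule below_mult)
qed

lemma above_0: "above 0 f"
  by (auto simp: above_def)

lemma above_msigma: "above \<alpha> f \<Longrightarrow> above (Suc \<alpha>) (msigma f)"
  unfolding above_def by (auto elim!: keys_msigma)

lemma above_msig: "above n (msig n f)"
  by (induction n) (auto intro: above_msigma above_0)

lemma mmul_add_left: "mmul r \<alpha> (f + f') g = mmul r \<alpha> f g + mmul r \<alpha> f' g"
  by (simp add: mmul_def mdiv_add distrib_right)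

lemma mmul_add_right: "mmul r \<alpha> f (g + g') = mmul r \<alpha> f g + mmul r \<alpha> f g'"
  by (simp add: mmul_def rhom.add[OF rhom_msig] distrib_left)

lemma mmul_cst_left: "mmul r \<alpha> (cst c * f) g = cst c * mmul r \<alpha> f g"
  unfolding mmul_def mdiv_cst by (simp only: mult_ac)

lemma mmul_cst_right: "mmul r \<alpha> f (cst c * g) = cst c * mmul r \<alpha> f g"
  unfolding mmul_def rhom.mult[OF rhom_msig] msig_cst by (simp only: mult_ac)

lemma mmul_one_right: "mmul r \<alpha> f 1 = mdiv r f"
  by (simp add: mmul_def rhom.one[OF rhom_msig])

lemma mmul_one_left: "mmul r 0 1 g = (if r = 0 then g else 0)"
proof (cases r)
  case 0
  then show ?thesis by (simp add: mmul_def mdiv_def Qfact_def)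
next
  case (Suc r')
  have "mderiv 1 = 0" by (simp add: mderiv_def rhom.one[OF rhom_msigma])
  then have "(mderiv ^^ r) 1 = 0" unfolding Suc funpow_Suc_right by simp
  then show ?thesis by (simp add: mmul_def mdiv_def Suc)
qed

section \<open>Linear operations on currents\<close>

lemma cur_smul_0 [simp]:
  fixes a :: "'k cur"
  shows "cur_smul 0 a = 0" "cur_smul c (0 :: 'k cur) = 0"
proof -
  interpret vector_space "cur_smul :: F \<Rightarrow> 'k cur \<Rightarrow> 'k cur" by (rule vector_space_cur_smul)
  show "cur_smul 0 a = 0" "cur_smul c (0 :: 'k cur) = 0"
    by (rule scale_zero_left, rule scale_zero_right)
qed

lemma cur_smul_smul: "cur_smul c (cur_smul d a) = cur_smul (c * d) a"
  and cur_smul_add: "cur_smul c (a + b) = cur_smul c a + cur_smul c b"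
  and cur_smul_add_left: "cur_smul (c + d) a = cur_smul c a + cur_smul d a"
  and cur_smul_one [simp]: "cur_smul 1 a = a"
proof -
  interpret vector_space "cur_smul :: F \<Rightarrow> 'a cur \<Rightarrow> 'a cur" by (rule vector_space_cur_smul)
  show "cur_smul c (cur_smul d a) = cur_smul (c * d) a" "cur_smul c (a + b) = cur_smul c a + cur_smul c b"
    "cur_smul (c + d) a = cur_smul c a + cur_smul d a" "cur_smul 1 a = a" for a b :: "'a cur"
    by (simp_all add: scale_right_distrib scale_left_distrib)
qed

lemma cur_shift_shift: "cur_shift k (cur_shift m a) = cur_shift (k + m) a"
  by (simp add: cur_shift_def add.commute)

lemma cur_shift_smul: "cur_shift k (cur_smul c a) = cur_smul c (cur_shift k a)"
  by (auto simp: cur_shift_def cur_smul_def fun_eq_iff fls_eq_iff fls_smul.rep_eq)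

lemma cur_shift_add: "cur_shift k (a + b) = cur_shift k a + cur_shift k b"
  by (auto simp: cur_shift_def fun_eq_iff fls_eq_iff)

lemma cur_shift_0 [simp]: "cur_shift k 0 = 0"
  by (auto simp: cur_shift_def fun_eq_iff fls_eq_iff)

lemma cur_dilate_smul: "cur_dilate c (cur_smul d a) = cur_smul d (cur_dilate c a)"
proof -
  interpret vector_space "smul :: F \<Rightarrow> 'a vec \<Rightarrow> 'a vec" by (rule vector_space_smul)
  show ?thesis
    by (auto simp: cur_dilate_def cur_smul_def fun_eq_iff fls_eq_iff fls_smul.rep_eq dilate.rep_eq mult.commute)
qed

lemma cur_dilate_add: "cur_dilate c (a + b) = cur_dilate c a + cur_dilate c b"
proof -
  interpret vector_space "smul :: F \<Rightarrow> 'a vec \<Rightarrow> 'a vec" by (rule vector_space_smul)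
  show "cur_dilate c (a + b) = cur_dilate c a + cur_dilate c b" for a b :: "'a cur"
    by (auto simp: cur_dilate_def fun_eq_iff fls_eq_iff dilate.rep_eq scale_right_distrib)
qed

lemma cur_dilate_shift: "cur_dilate Q (cur_shift k a) = cur_smul (Q powi k) (cur_shift k (cur_dilate Q a))"
  for a :: "'k::comm_monoid_add cur"
  using cur_dilate_scale[of Q 1 k a] by simp

lemma cur_dilate_pow: "cur_dilate (Q ^ n) a = (cur_dilate Q ^^ n) a"
proof (induction n)
  case 0
  interpret vector_space "smul :: F \<Rightarrow> 'a vec \<Rightarrow> 'a vec" by (rule vector_space_smul)
  show ?case by (auto simp: cur_dilate_def fun_eq_iff fls_eq_iff dilate.rep_eq)
next
  case (Suc n)
  interpret vector_space "smul :: F \<Rightarrow> 'a vec \<Rightarrow> 'a vec" by (rule vector_space_smul)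
  have "cur_dilate (Q ^ Suc n) a = cur_dilate Q (cur_dilate (Q ^ n) a)"
    by (auto simp: cur_dilate_def fun_eq_iff fls_eq_iff dilate.rep_eq power_int_mult_distrib)
  then show ?case by (simp add: Suc)
qed

lemma cur_qderiv_eq: "cur_qderiv a = cur_smul (inverse (Q - 1)) (cur_shift (- 1) (cur_dilate Q a - a))"
  by (auto simp: cur_qderiv_def qderiv_def cur_smul_def cur_shift_def cur_dilate_def)

lemma homog_add: "homog (a + b) \<alpha> = homog a \<alpha> + homog b \<alpha>"
  by (simp add: homog_def single_add)

lemma homog_0 [simp]: "homog 0 \<alpha> = 0"
  by (simp add: homog_def)

lemma lookup_homog: "Poly_Mapping.lookup (homog a \<alpha>) \<beta> = (a when \<alpha> = \<beta>)"
  by (simp add: homog_def lookup_single)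

lemma homog_smul: "homog (cur_smul c a) \<alpha> = curt_smul c (homog a \<alpha>)"
  by (rule poly_mapping_eqI) (simp add: lookup_homog when_def)

lemma keys_homog: "Poly_Mapping.keys (homog a \<alpha>) = (if a = 0 then {} else {\<alpha>})"
  by (simp add: homog_def)

lemma sum_homog:
  assumes "finite K" "Poly_Mapping.keys A \<subseteq> K"
  shows "A = (\<Sum>\<alpha>\<in>K. homog (Poly_Mapping.lookup A \<alpha>) \<alpha>)"
  using assms
  by (intro poly_mapping_eqI) (auto simp: lookup_sum lookup_homog when_def in_keys_iff)

text \<open>The properties of the products of the current from which the algebra structure and the
  spanning statement follow; they keep vertex operators out of these arguments. Indexing by
  multisets makes the model a commutative ring, although \<open>P_prod\<close> concerns only
  separated points in increasing order.\<close>

locale current_family =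
  fixes P :: "nat multiset \<Rightarrow> 'k::comm_monoid_add cur"
  assumes P_currents: "P S \<in> currents"
    and P_empty: "P {#} = fls_const"
    and P_dilate: "cur_dilate Q (P S) = P (image_mset Suc S)"
    and P_prod: "(\<And>a b. a \<in># S \<Longrightarrow> b \<in># T \<Longrightarrow> a < b) \<Longrightarrow> reg_prod (P S) (P T) (P (S + T))"
begin

text \<open>Compatible with linear combinations, shift and derivation, but multiplicative only in
  the sense of \<open>reg_prod_ev\<close>.\<close>

definition ev :: "model \<Rightarrow> 'k cur" where
  "ev = lin_ext cur_smul (\<lambda>(k, S). cur_shift k (P S))"

lemma ev_single: "ev (Poly_Mapping.single (k, S) c) = cur_smul c (cur_shift k (P S))"
  unfolding ev_def by (subst lin_ext_single) simp_all

lemma ev_add: "ev (f + g) = ev f + ev g"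
  unfolding ev_def by (rule lin_ext_add) (simp_all add: cur_smul_add_left)

lemma ev_sum: "ev (sum f A) = (\<Sum>i\<in>A. ev (f i))"
  by (rule additive_sum) (rule ev_add)

lemma ev_0 [simp]: "ev 0 = 0"
  using ev_sum[of _ "{}"] by simp

lemma ev_uminus: "ev (- f) = - ev f"
  using ev_add[of f "- f"] by (simp add: minus_unique)

lemma ev_diff: "ev (f - g) = ev f - ev g"
  using ev_add[of f "- g"] ev_uminus by simp

lemma ev_eq: "ev f = (\<Sum>x\<in>Poly_Mapping.keys f. cur_smul (Poly_Mapping.lookup f x) (cur_shift (fst x) (P (snd x))))"
  by (simp add: ev_def lin_ext_def case_prod_beta)

lemma ev_induct_eq:
  assumes "\<And>k S c. h (Poly_Mapping.single (k, S) c) = h' (Poly_Mapping.single (k, S) c)"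
    and "\<And>f g. h (f + g) = h f + (h g :: 'k cur)" "\<And>f g. h' (f + g) = h' f + h' g"
  shows "h f = h' (f :: model)"
proof -
  note f = poly_mapping_sum_single[OF finite_keys subset_refl, of f]
  have "h (Poly_Mapping.single x c) = h' (Poly_Mapping.single x c)" for x c
    by (cases x) (simp add: assms(1))
  then show ?thesis
    by (subst (1 2) f) (simp add: additive_sum[of h, OF assms(2)] additive_sum[of h', OF assms(3)])
qed

lemma ev_cst: "ev (cst c * f) = cur_smul c (ev f)"
  by (rule ev_induct_eq, simp add: cst_def mult_single ev_single cur_smul_smul)
    (simp_all only: distrib_left ev_add cur_smul_add)

lemma ev_currents: "ev f \<in> currents"
  unfolding ev_eq by (intro currents_sum currents_smul currents_shift P_currents)

lemma ev_msigma: "ev (msigma f) = cur_dilate Q (ev f)"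
  by (rule ev_induct_eq, simp add: msigma_single ev_single cur_dilate_smul cur_dilate_shift cur_smul_smul P_dilate)
    (simp_all only: rhom.add[OF rhom_msigma] ev_add cur_dilate_add)

lemma ev_msig: "ev (msig n f) = cur_dilate (Q ^ n) (ev f)"
  unfolding cur_dilate_pow by (induction n) (simp_all add: ev_msigma)

lemma ev_zinv: "ev (zinv * f) = cur_shift (- 1) (ev f)"
  by (rule ev_induct_eq, simp add: zinv_def mult_single ev_single cur_shift_smul cur_shift_shift)
    (simp_all only: distrib_left ev_add cur_shift_add)

lemma ev_mderiv: "ev (mderiv f) = cur_qderiv (ev f)"
  by (simp add: mderiv_def cur_qderiv_eq ev_cst ev_zinv ev_diff ev_msigma)

lemma ev_mderiv_pow: "ev ((mderiv ^^ n) f) = (cur_qderiv ^^ n) (ev f)"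
  by (induction n) (simp_all add: ev_mderiv)

lemma ev_one: "ev 1 = fls_const"
  using ev_single[of 0 "{#}" 1] by (simp add: P_empty cur_shift_def zero_prod_def[symmetric] zero_multiset_def[symmetric])

lemma reg_prod_ev:
  assumes "below \<alpha> f" "above \<alpha> g"
  shows "reg_prod (ev f) (ev g) (ev (f * g))"
proof -
  let ?t = "\<lambda>f x. cur_smul (Poly_Mapping.lookup f x) (cur_shift (fst x) (P (snd x)))"
  have "reg_prod (\<Sum>x\<in>Poly_Mapping.keys f. ?t f x) (\<Sum>x'\<in>Poly_Mapping.keys g. ?t g x')
     (\<Sum>x\<in>Poly_Mapping.keys f. \<Sum>x'\<in>Poly_Mapping.keys g.
        cur_smul (Poly_Mapping.lookup f x * Poly_Mapping.lookup g x') (cur_shift (fst x + fst x') (P (snd x + snd x'))))"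
  proof (rule reg_prod_sum)
    fix x x' assume x: "x \<in> Poly_Mapping.keys f" "x' \<in> Poly_Mapping.keys g"
    have "a < b" if "a \<in># snd x" "b \<in># snd x'" for a b
    proof -
      have "a < \<alpha>" "\<alpha> \<le> b"
        using assms x that unfolding below_def above_def by blast+
      then show ?thesis by simp
    qed
    then show "reg_prod (?t f x) (?t g x')
       (cur_smul (Poly_Mapping.lookup f x * Poly_Mapping.lookup g x') (cur_shift (fst x + fst x') (P (snd x + snd x'))))"
      by (intro reg_prod_scale P_prod)
  qed (simp_all add: currents_smul currents_shift P_currents)
  moreover have "(\<Sum>x\<in>Poly_Mapping.keys f. \<Sum>x'\<in>Poly_Mapping.keys g.
        cur_smul (Poly_Mapping.lookup f x * Poly_Mapping.lookup g x') (cur_shift (fst x + fst x') (P (snd x + snd x')))) = ev (f * g)"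
  proof -
    have "f * g = (\<Sum>x\<in>Poly_Mapping.keys f. \<Sum>x'\<in>Poly_Mapping.keys g.
        Poly_Mapping.single (fst x + fst x', snd x + snd x') (Poly_Mapping.lookup f x * Poly_Mapping.lookup g x'))"
      by (subst poly_mapping_sum_single[OF finite_keys subset_refl, of f],
          subst poly_mapping_sum_single[OF finite_keys subset_refl, of g], unfold sum_product mult_single plus_prod_def) (rule refl)
    then show ?thesis by (simp only: ev_sum ev_single)
  qed
  ultimately show ?thesis by (simp add: ev_eq[of f] ev_eq[of g])
qed

lemma reg_prod_mmul:
  assumes "below \<alpha> f"
  shows "reg_prod ((cur_qderiv ^^ r) (ev f)) (cur_dilate (Q ^ (\<alpha> + r)) (ev g)) (cur_smul (Qfact r) (ev (mmul r \<alpha> f g)))"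
proof -
  have "below (\<alpha> + r) ((mderiv ^^ r) f)"
    using assms by (induction r) (auto intro: below_mderiv)
  then have "reg_prod (ev ((mderiv ^^ r) f)) (ev (msig (\<alpha> + r) g)) (ev ((mderiv ^^ r) f * msig (\<alpha> + r) g))"
    using above_msig by (rule reg_prod_ev)
  moreover have "cur_smul (Qfact r) (ev (mmul r \<alpha> f g)) = ev ((mderiv ^^ r) f * msig (\<alpha> + r) g)"
    by (simp add: mmul_def mdiv_def mult.assoc ev_cst cur_smul_smul)
  ultimately show ?thesis by (simp add: ev_mderiv_pow ev_msig)
qed

lemma prod_hom_ev:
  assumes "below \<alpha> f"
  shows "prod_hom r (ev f) \<alpha> (ev g) = ev (mmul r \<alpha> f g)"
  using prod_hom_eq[OF reg_prod_mmul[OF assms]] by (simp add: cur_smul_smul)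

lemma quasi_comm_hom_ev:
  assumes "below \<alpha> f" shows "quasi_comm_hom (ev f) \<alpha> (ev g)"
  using reg_prod_imp_quasi_comm[OF reg_prod_mmul[OF assms, of 0 g]] by (simp add: quasi_comm_hom_def)

text \<open>The ambient space on which every product exists and is computed in the model.
  Representatives \<open>f\<close> need not be unique.\<close>

definition W :: "'k curt set" where
  "W = {A. \<forall>\<alpha>. \<exists>f. below \<alpha> f \<and> Poly_Mapping.lookup A \<alpha> = ev f}"

lemma homog_W:
  assumes "below \<alpha> f" shows "homog (ev f) \<alpha> \<in> W"
proof -
  have "\<exists>g. below \<beta> g \<and> Poly_Mapping.lookup (homog (ev f) \<alpha>) \<beta> = ev g" for \<beta>
  proof (cases "\<alpha> = \<beta>")
    case True
    with assms show ?thesis by (intro exI[of _ f]) (simp add: lookup_homog)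
  next
    case False
    then show ?thesis by (intro exI[of _ 0]) (simp add: lookup_homog)
  qed
  then show ?thesis by (simp add: W_def)
qed

lemma W_lookup: "A \<in> W \<Longrightarrow> \<exists>f. below \<alpha> f \<and> Poly_Mapping.lookup A \<alpha> = ev f"
  by (simp add: W_def)

lemma W_0 [simp]: "0 \<in> W"
  by (auto simp: W_def intro!: exI[of _ 0])

lemma W_add:
  assumes "A \<in> W" "B \<in> W" shows "A + B \<in> W"
proof -
  have "\<exists>h. below \<alpha> h \<and> Poly_Mapping.lookup (A + B) \<alpha> = ev h" for \<alpha>
  proof -
    obtain f g where "below \<alpha> f" "Poly_Mapping.lookup A \<alpha> = ev f" "below \<alpha> g" "Poly_Mapping.lookup B \<alpha> = ev g"
      using W_lookup[OF assms(1)] W_lookup[OF assms(2)] by metis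
    then show ?thesis by (intro exI[of _ "f + g"]) (simp add: lookup_add ev_add below_add)
  qed
  then show ?thesis by (simp add: W_def)
qed

lemma W_sum: "(\<And>i. i \<in> I \<Longrightarrow> f i \<in> W) \<Longrightarrow> sum f I \<in> W"
  by (induction I rule: infinite_finite_induct) (auto intro: W_add)

lemma W_smul:
  assumes "A \<in> W" shows "curt_smul c A \<in> W"
proof -
  have "\<exists>h. below \<alpha> h \<and> Poly_Mapping.lookup (curt_smul c A) \<alpha> = ev h" for \<alpha>
  proof -
    obtain f where "below \<alpha> f" "Poly_Mapping.lookup A \<alpha> = ev f"
      using W_lookup[OF assms] by metis
    then show ?thesis by (intro exI[of _ "cst c * f"]) (simp add: ev_cst below_mult)
  qed
  then show ?thesis by (simp add: W_def)
qed

lemma W_induct [consumes 1, case_names homog add zero]: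
  assumes A: "A \<in> W" and h: "\<And>\<alpha> f. below \<alpha> f \<Longrightarrow> R (homog (ev f) \<alpha>)"
    and add: "\<And>A B. A \<in> W \<Longrightarrow> B \<in> W \<Longrightarrow> R A \<Longrightarrow> R B \<Longrightarrow> R (A + B)" and zero: "R 0"
  shows "R A"
proof -
  have *: "homog (Poly_Mapping.lookup A \<alpha>) \<alpha> \<in> W \<and> R (homog (Poly_Mapping.lookup A \<alpha>) \<alpha>)" for \<alpha>
    using W_lookup[OF A, of \<alpha>] h homog_W by metis
  have "(\<Sum>\<alpha>\<in>K. homog (Poly_Mapping.lookup A \<alpha>) \<alpha>) \<in> W \<and> R (\<Sum>\<alpha>\<in>K. homog (Poly_Mapping.lookup A \<alpha>) \<alpha>)" if "finite K" for K
    using that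
  proof (induction K rule: finite_induct)
    case (insert \<alpha> K)
    then show ?case using * by (auto intro!: add W_add)
  qed (simp add: zero)
  from this[OF finite_keys[of A]] sum_homog[OF finite_keys subset_refl, of A] show ?thesis
    by (simp only:)
qed

text \<open>Because of the choice in \<open>prod_hom\<close>, linearity is not formal; it is
  inherited from \<open>mmul\<close> through representatives that obey the bound on the
  points.\<close>

lemma prod_hom_linear:
  assumes "\<exists>f. below \<alpha> f \<and> a = ev f" "\<exists>f. below \<alpha> f \<and> a' = ev f" "\<exists>f. b = ev f" "\<exists>f. b' = ev f"
  shows "prod_hom r (a + a') \<alpha> b = prod_hom r a \<alpha> b + prod_hom r a' \<alpha> b"
    and "prod_hom r a \<alpha> (b + b') = prod_hom r a \<alpha> b + prod_hom r a \<alpha> b'"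
    and "prod_hom r (cur_smul c a) \<alpha> b = cur_smul c (prod_hom r a \<alpha> b)"
    and "prod_hom r a \<alpha> (cur_smul c b) = cur_smul c (prod_hom r a \<alpha> b)"
proof -
  obtain f f' g g' where *: "a = ev f" "a' = ev f'" "b = ev g" "b' = ev g'" "below \<alpha> f" "below \<alpha> f'"
    using assms by auto
  have "below \<alpha> (f + f')" "below \<alpha> (cst c * f)"
    using *(5,6) by (simp_all add: below_add below_mult)
  note [simp] = prod_hom_ev[OF this(1)] prod_hom_ev[OF this(2)] prod_hom_ev[OF *(5)] prod_hom_ev[OF *(6)]
  show "prod_hom r (a + a') \<alpha> b = prod_hom r a \<alpha> b + prod_hom r a' \<alpha> b"
    unfolding * ev_add[symmetric] by (simp add: mmul_add_left) (simp only: ev_add)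
  show "prod_hom r a \<alpha> (b + b') = prod_hom r a \<alpha> b + prod_hom r a \<alpha> b'"
    unfolding * ev_add[symmetric] by (simp add: mmul_add_right) (simp only: ev_add)
  show "prod_hom r (cur_smul c a) \<alpha> b = cur_smul c (prod_hom r a \<alpha> b)"
    unfolding * ev_cst[symmetric] by (simp add: mmul_cst_left) (simp only: ev_cst)
  show "prod_hom r a \<alpha> (cur_smul c b) = cur_smul c (prod_hom r a \<alpha> b)"
    unfolding * ev_cst[symmetric] by (simp add: mmul_cst_right) (simp only: ev_cst)
qed

lemma prod_hom_0:
  "\<exists>f. b = ev f \<Longrightarrow> prod_hom r 0 \<alpha> b = 0" "\<exists>f. below \<alpha> f \<and> a = ev f \<Longrightarrow> prod_hom r a \<alpha> 0 = 0"
proof -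
  have z: "mmul r \<alpha> 0 g = 0" "mmul r \<alpha> f 0 = 0" for f g
    using mmul_cst_left[of r \<alpha> 0 0 g] mmul_cst_right[of r \<alpha> f 0 0] by simp_all
  have "prod_hom r 0 \<alpha> (ev g) = 0" for g
    using prod_hom_ev[of \<alpha> 0 r g] by (simp add: z)
  then show "\<exists>f. b = ev f \<Longrightarrow> prod_hom r 0 \<alpha> b = 0"
    by blast
  have "prod_hom r (ev f) \<alpha> 0 = 0" if "below \<alpha> f" for f
    using prod_hom_ev[OF that, of r 0] by (simp add: z)
  then show "\<exists>f. below \<alpha> f \<and> a = ev f \<Longrightarrow> prod_hom r a \<alpha> 0 = 0"
    by blast
qed

lemma curt_prod_nonneg: "n \<ge> 0 \<Longrightarrow> curt_prod n A B = 0"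
  by (simp add: curt_prod_def)

text \<open>\<open>curt_prod\<close> sums over the keys, which change under addition; a common index
  set makes linearity visible.\<close>

lemma curt_prod_superset:
  assumes "A \<in> W" "B \<in> W" "n < 0" "finite K" "Poly_Mapping.keys A \<subseteq> K" "finite L" "Poly_Mapping.keys B \<subseteq> L"
  shows "curt_prod n A B = (\<Sum>\<alpha>\<in>K. \<Sum>\<beta>\<in>L.
    homog (prod_hom (nat (- n - 1)) (Poly_Mapping.lookup A \<alpha>) \<alpha> (Poly_Mapping.lookup B \<beta>)) (\<alpha> + \<beta> + nat (- n - 1)))"
proof -
  have z: "prod_hom r (Poly_Mapping.lookup A \<alpha>) \<alpha> (Poly_Mapping.lookup B \<beta>) = 0"
    if "\<alpha> \<notin> Poly_Mapping.keys A \<or> \<beta> \<notin> Poly_Mapping.keys B" for r \<alpha> \<beta>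
  proof -
    have "\<exists>f. below \<alpha> f \<and> Poly_Mapping.lookup A \<alpha> = ev f" "\<exists>f. Poly_Mapping.lookup B \<beta> = ev f"
      using W_lookup[OF assms(1), of \<alpha>] W_lookup[OF assms(2), of \<beta>] by auto
    note e = this
    from that have "Poly_Mapping.lookup A \<alpha> = 0 \<or> Poly_Mapping.lookup B \<beta> = 0"
      by (simp add: in_keys_iff)
    then show ?thesis
    proof
      assume "Poly_Mapping.lookup A \<alpha> = 0"
      then show ?thesis using prod_hom_0(1)[OF e(2)] by (simp only:)
    next
      assume "Poly_Mapping.lookup B \<beta> = 0"
      then show ?thesis using prod_hom_0(2)[OF e(1)] by (simp only:)
    qed
  qed
  have "curt_prod n A B = (\<Sum>\<alpha>\<in>Poly_Mapping.keys A. \<Sum>\<beta>\<in>Poly_Mapping.keys B.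
    homog (prod_hom (nat (- n - 1)) (Poly_Mapping.lookup A \<alpha>) \<alpha> (Poly_Mapping.lookup B \<beta>)) (\<alpha> + \<beta> + nat (- n - 1)))"
    using assms(3) by (simp add: curt_prod_def Let_def)
  also have "\<dots> = (\<Sum>\<alpha>\<in>K. \<Sum>\<beta>\<in>L.
    homog (prod_hom (nat (- n - 1)) (Poly_Mapping.lookup A \<alpha>) \<alpha> (Poly_Mapping.lookup B \<beta>)) (\<alpha> + \<beta> + nat (- n - 1)))"
    by (rule sum.mono_neutral_cong_left[OF assms(4,5)])
      (auto simp: z intro!: sum.neutral sum.mono_neutral_left assms(6,7))
  finally show ?thesis .
qed

lemma curt_prod_homog:
  assumes "below \<alpha> f" "below \<beta> g"
  shows "curt_prod (- int r - 1) (homog (ev f) \<alpha>) (homog (ev g) \<beta>) = homog (ev (mmul r \<alpha> f g)) (\<alpha> + \<beta> + r)"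
  using assms
  by (subst curt_prod_superset[of _ _ _ "{\<alpha>}" "{\<beta>}"])
    (auto simp: homog_W keys_homog lookup_homog prod_hom_ev)

lemma curt_prod_add_left:
  assumes "A \<in> W" "A' \<in> W" "B \<in> W"
  shows "curt_prod n (A + A') B = curt_prod n A B + curt_prod n A' B"
proof (cases "n < 0")
  case True
  let ?K = "Poly_Mapping.keys A \<union> Poly_Mapping.keys A'"
  have x: "\<exists>f. below \<alpha> f \<and> Poly_Mapping.lookup A \<alpha> = ev f" "\<exists>f. below \<alpha> f \<and> Poly_Mapping.lookup A' \<alpha> = ev f"
    "\<exists>f. Poly_Mapping.lookup B \<beta> = ev f" for \<alpha> \<beta>
    using W_lookup[OF assms(1), of \<alpha>] W_lookup[OF assms(2), of \<alpha>] W_lookup[OF assms(3), of \<beta>] by auto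
  show ?thesis
    using True keys_add[of A A']
    by (simp add: curt_prod_superset[where K = ?K and L = "Poly_Mapping.keys B"] assms W_add lookup_add
      prod_hom_linear(1)[OF x(1,2,3,3)] homog_add sum.distrib)
qed (simp add: curt_prod_nonneg)

lemma curt_prod_add_right:
  assumes "A \<in> W" "B \<in> W" "B' \<in> W"
  shows "curt_prod n A (B + B') = curt_prod n A B + curt_prod n A B'"
proof (cases "n < 0")
  case True
  let ?L = "Poly_Mapping.keys B \<union> Poly_Mapping.keys B'"
  have x: "\<exists>f. below \<alpha> f \<and> Poly_Mapping.lookup A \<alpha> = ev f" "\<exists>f. Poly_Mapping.lookup B \<beta> = ev f"
    "\<exists>f. Poly_Mapping.lookup B' \<beta> = ev f" for \<alpha> \<beta>
    using W_lookup[OF assms(1), of \<alpha>] W_lookup[OF assms(2), of \<beta>] W_lookup[OF assms(3), of \<beta>] by auto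
  show ?thesis
    using True keys_add[of B B']
    by (simp add: curt_prod_superset[where L = ?L and K = "Poly_Mapping.keys A"] assms W_add lookup_add
      prod_hom_linear(2)[OF x(1,1,2,3)] homog_add sum.distrib)
qed (simp add: curt_prod_nonneg)

lemma curt_smul_add: "curt_smul c (A + B) = curt_smul c A + curt_smul c B"
  by (rule poly_mapping_eqI) (simp add: lookup_add cur_smul_add)

lemma curt_smul_sum: "curt_smul c (sum f I) = (\<Sum>i\<in>I. curt_smul c (f i))"
  by (rule additive_sum) (rule curt_smul_add)

lemma keys_curt_smul: "Poly_Mapping.keys (curt_smul c A) \<subseteq> Poly_Mapping.keys A"
  by (auto simp: in_keys_iff)

lemma curt_prod_smul_left:
  assumes "A \<in> W" "B \<in> W"
  shows "curt_prod n (curt_smul c A) B = curt_smul c (curt_prod n A B)"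
proof (cases "n < 0")
  case True
  have x: "\<exists>f. below \<alpha> f \<and> Poly_Mapping.lookup A \<alpha> = ev f" "\<exists>f. Poly_Mapping.lookup B \<beta> = ev f" for \<alpha> \<beta>
    using W_lookup[OF assms(1), of \<alpha>] W_lookup[OF assms(2), of \<beta>] by auto
  show ?thesis
    using True keys_curt_smul[of c A]
    by (simp add: curt_prod_superset[where K = "Poly_Mapping.keys A" and L = "Poly_Mapping.keys B"] assms W_smul
      prod_hom_linear(3)[OF x(1,1,2,2)] homog_smul curt_smul_sum)
next
  case False
  have "curt_smul c (0 :: 'k curt) = 0" by (rule poly_mapping_eqI) simp
  with False show ?thesis by (simp add: curt_prod_nonneg)
qed

lemma curt_prod_smul_right:
  assumes "A \<in> W" "B \<in> W"
  shows "curt_prod n A (curt_smul c B) = curt_smul c (curt_prod n A B)"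
proof (cases "n < 0")
  case True
  have x: "\<exists>f. below \<alpha> f \<and> Poly_Mapping.lookup A \<alpha> = ev f" "\<exists>f. Poly_Mapping.lookup B \<beta> = ev f" for \<alpha> \<beta>
    using W_lookup[OF assms(1), of \<alpha>] W_lookup[OF assms(2), of \<beta>] by auto
  show ?thesis
    using True keys_curt_smul[of c B]
    by (simp add: curt_prod_superset[where K = "Poly_Mapping.keys A" and L = "Poly_Mapping.keys B"] assms W_smul
      prod_hom_linear(4)[OF x(1,1,2,2)] homog_smul curt_smul_sum)
next
  case False
  have "curt_smul c (0 :: 'k curt) = 0" by (rule poly_mapping_eqI) simp
  with False show ?thesis by (simp add: curt_prod_nonneg)
qed

lemma curt_prod_0_left [simp]: "curt_prod n 0 B = 0" and curt_prod_0_right [simp]: "curt_prod n A 0 = 0"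
  by (simp_all add: curt_prod_def Let_def)

lemma neg_int_cases:
  fixes n :: int
  assumes "n < 0" obtains r where "n = - int r - 1"
  using assms by (intro that[of "nat (- n - 1)"]) simp

lemma curt_prod_W:
  assumes "A \<in> W" "B \<in> W" shows "curt_prod n A B \<in> W"
  using assms(1)
proof (induction A rule: W_induct)
  case (homog \<alpha> f)
  show ?case
    using assms(2)
  proof (induction B rule: W_induct)
    case (homog \<beta> g)
    show ?case
    proof (cases "n < 0")
      case True
      then obtain r where "n = - int r - 1" by (rule neg_int_cases)
      with homog \<open>below \<alpha> f\<close> show ?thesis
        by (simp add: curt_prod_homog homog_W below_mmul)
    qed (simp add: curt_prod_nonneg)
  qed (simp_all add: curt_prod_add_right W_add homog_W homog)
qed (simp_all add: curt_prod_add_left W_add assms)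

lemma W_currents_t: "W \<subseteq> currents_t"
proof
  fix A assume "A \<in> W"
  then have "Poly_Mapping.lookup A \<alpha> \<in> currents" for \<alpha>
    using W_lookup[of A \<alpha>] ev_currents by metis
  then show "A \<in> currents_t" by (simp add: currents_t_def)
qed

lemma quasi_comm_W: "A \<in> W \<Longrightarrow> B \<in> W \<Longrightarrow> quasi_comm A B"
  unfolding quasi_comm_def using quasi_comm_hom_ev W_lookup by metis

lemma curt_one_eq: "curt_one = homog (ev 1) 0"
  by (simp add: curt_one_def ev_one)

lemma curt_one_W: "curt_one \<in> W"
  by (simp add: curt_one_eq homog_W)

lemma curt_prod_one_left:
  assumes "B \<in> W" shows "curt_prod n curt_one B = (if n = - 1 then B else 0)"
  using assms
proof (induction B rule: W_induct)
  case (homog \<beta> g)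
  show ?case
  proof (cases "n < 0")
    case True
    then obtain r where "n = - int r - 1" by (rule neg_int_cases)
    with homog show ?thesis by (simp add: curt_one_eq curt_prod_homog mmul_one_left)
  qed (simp add: curt_prod_nonneg)
qed (simp_all add: curt_prod_add_right curt_one_W)

lemma curt_prod_one_right:
  assumes "A \<in> W" shows "curt_prod (- 1) A curt_one = A"
  using assms
proof (induction A rule: W_induct)
  case (homog \<alpha> f)
  show ?case
    using curt_prod_homog[OF homog below_1, of 0 0] by (simp add: curt_one_eq mmul_one_right mdiv_def Qfact_def)
qed (simp_all add: curt_prod_add_left curt_one_W)

lemma q_assoc_homog:
  assumes "below \<alpha> f" "B \<in> W" "C \<in> W"
  shows "curt_prod (- int s - 1) (curt_prod (- int r - 1) (homog (ev f) \<alpha>) B) C =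
    (\<Sum>l\<le>s. curt_smul (Qbinom (int (l + r)) l * Q ^ ((s - l) * (\<alpha> + r)))
      (curt_prod (- int (r + l) - 1) (homog (ev f) \<alpha>) (curt_prod (- int (s - l) - 1) B C)))"
  using assms(2)
proof (induction B rule: W_induct)
  case (homog \<beta> g)
  show ?case
    using assms(3)
  proof (induction C rule: W_induct)
    case (homog \<gamma> h)
    note g = \<open>below \<beta> g\<close>
    have "curt_prod (- int s - 1) (curt_prod (- int r - 1) (homog (ev f) \<alpha>) (homog (ev g) \<beta>)) (homog (ev h) \<gamma>) =
        homog (ev (mmul s (\<alpha> + \<beta> + r) (mmul r \<alpha> f g) h)) (\<alpha> + \<beta> + r + \<gamma> + s)"
      by (simp only: curt_prod_homog[OF assms(1) g] curt_prod_homog[OF below_mmul[OF assms(1) g] homog])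
    also have "\<dots> = (\<Sum>l\<le>s. homog (ev (cst (Qbinom (int (l + r)) l * Q ^ ((s - l) * (\<alpha> + r))) * mmul (r + l) \<alpha> f (mmul (s - l) \<beta> g h)))
       (\<alpha> + \<beta> + r + \<gamma> + s))"
      unfolding mmul_assoc ev_sum by (rule additive_sum[where f = "\<lambda>a. homog a (\<alpha> + \<beta> + r + \<gamma> + s)"]) (rule homog_add)
    also have "\<dots> = (\<Sum>l\<le>s. curt_smul (Qbinom (int (l + r)) l * Q ^ ((s - l) * (\<alpha> + r)))
      (curt_prod (- int (r + l) - 1) (homog (ev f) \<alpha>) (curt_prod (- int (s - l) - 1) (homog (ev g) \<beta>) (homog (ev h) \<gamma>))))"
    proof (rule sum.cong)
      fix l assume "l \<in> {..s}"
      then have "\<alpha> + \<beta> + r + \<gamma> + s = \<alpha> + (\<beta> + \<gamma> + (s - l)) + (r + l)" by simp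
      then show "homog (ev (cst (Qbinom (int (l + r)) l * Q ^ ((s - l) * (\<alpha> + r))) * mmul (r + l) \<alpha> f (mmul (s - l) \<beta> g h)))
          (\<alpha> + \<beta> + r + \<gamma> + s) = curt_smul (Qbinom (int (l + r)) l * Q ^ ((s - l) * (\<alpha> + r)))
        (curt_prod (- int (r + l) - 1) (homog (ev f) \<alpha>) (curt_prod (- int (s - l) - 1) (homog (ev g) \<beta>) (homog (ev h) \<gamma>)))"
        by (simp only: curt_prod_homog[OF g homog] curt_prod_homog[OF assms(1) below_mmul[OF g homog]] ev_cst homog_smul)
    qed simp
    finally show ?case .
  qed (simp_all add: curt_prod_add_right curt_prod_W homog_W homog assms curt_smul_add sum.distrib W_add curt_smul_sum[of _ _ "{}", simplified])
qed (simp_all add: curt_prod_add_right curt_prod_add_left curt_prod_W homog_W assms curt_smul_add sum.distrib W_add curt_smul_sum[of _ _ "{}", simplified])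

lemma q_assoc_W:
  assumes "below \<alpha> f" "B \<in> W" "C \<in> W"
  shows "curt_prod s (curt_prod r (homog (ev f) \<alpha>) B) C =
    Sum_any (\<lambda>l::nat. curt_smul (Qbinom (int l - r - 1) l * Q powi ((s + int l + 1) * (r - int \<alpha> + 1)))
      (curt_prod (r - int l) (homog (ev f) \<alpha>) (curt_prod (s + int l) B C)))"
proof -
  have z: "curt_smul c (0 :: 'k curt) = 0" for c
    by (rule poly_mapping_eqI) simp
  have z': "curt_smul 0 (A :: 'k curt) = 0" for A
    by (rule poly_mapping_eqI) simp
  consider "s \<ge> 0" | "s < 0" "r \<ge> 0" | "s < 0" "r < 0" by linarith
  then show ?thesis
  proof cases
    case 1
    then show ?thesis by (simp add: curt_prod_nonneg z)
  next
    case 2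
    \<comment> \<open>If \<open>r - l \<ge> 0\<close> the mode is zero; otherwise
      \<open>0 \<le> l - r - 1 < l\<close>, and the q-binomial contains the factor
      \<open>Qnum 0\<close>.\<close>
    have "curt_smul (Qbinom (int l - r - 1) l * Q powi ((s + int l + 1) * (r - int \<alpha> + 1)))
      (curt_prod (r - int l) (homog (ev f) \<alpha>) (curt_prod (s + int l) B C)) = 0" for l
    proof (cases "r - int l \<ge> 0")
      case False
      define i where "i = nat (int l - r - 1)"
      have i: "i < l" "int l - r - 1 - int i = 0" using False 2 by (auto simp: i_def)
      have "Qnum 0 = 0" by (simp add: Qnum_def)
      then have 0: "(\<Prod>i<l. Qnum (int l - r - 1 - int i)) = 0"
        using i by (intro prod_zero) (auto intro!: bexI[of _ i])
      show ?thesis unfolding Qbinom_def 0 by (simp add: z')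
    qed (simp add: curt_prod_nonneg z)
    then show ?thesis using 2 by (simp add: curt_prod_nonneg)
  next
    case 3
    obtain r' where r: "r = - int r' - 1" using \<open>r < 0\<close> by (rule neg_int_cases)
    obtain s' where s: "s = - int s' - 1" using \<open>s < 0\<close> by (rule neg_int_cases)
    have "Sum_any (\<lambda>l::nat. curt_smul (Qbinom (int l - r - 1) l * Q powi ((s + int l + 1) * (r - int \<alpha> + 1)))
        (curt_prod (r - int l) (homog (ev f) \<alpha>) (curt_prod (s + int l) B C))) =
      (\<Sum>l\<le>s'. curt_smul (Qbinom (int l - r - 1) l * Q powi ((s + int l + 1) * (r - int \<alpha> + 1)))
        (curt_prod (r - int l) (homog (ev f) \<alpha>) (curt_prod (s + int l) B C)))"
    proof (rule Sum_any.expand_superset)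
      have 0: "curt_prod (s + int l) B C = 0" if "\<not> l \<le> s'" for l
        using that s by (intro curt_prod_nonneg) simp
      have "curt_smul (Qbinom (int l - r - 1) l * Q powi ((s + int l + 1) * (r - int \<alpha> + 1)))
        (curt_prod (r - int l) (homog (ev f) \<alpha>) (curt_prod (s + int l) B C)) = 0" if "\<not> l \<le> s'" for l
        unfolding 0[OF that] curt_prod_0_right by (rule z)
      then show "{l. curt_smul (Qbinom (int l - r - 1) l * Q powi ((s + int l + 1) * (r - int \<alpha> + 1)))
        (curt_prod (r - int l) (homog (ev f) \<alpha>) (curt_prod (s + int l) B C)) \<noteq> 0} \<subseteq> {..s'}"
        by auto
    qed simp
    also have "\<dots> = (\<Sum>l\<le>s'. curt_smul (Qbinom (int (l + r')) l * Q ^ ((s' - l) * (\<alpha> + r')))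
      (curt_prod (- int (r' + l) - 1) (homog (ev f) \<alpha>) (curt_prod (- int (s' - l) - 1) B C)))"
    proof (rule sum.cong)
      fix l assume "l \<in> {..s'}"
      then have l: "l \<le> s'" by simp
      have 1: "int l - r - 1 = int (l + r')" "r - int l = - int (r' + l) - 1" "s + int l = - int (s' - l) - 1"
        using l by (simp_all add: r s of_nat_diff)
      \<comment> \<open>Two signs cancel: \<open>s + l + 1 = -(s' - l)\<close> and
        \<open>r - \<alpha> + 1 = -(\<alpha> + r')\<close>.\<close>
      have "(s + int l + 1) * (r - int \<alpha> + 1) = int ((s' - l) * (\<alpha> + r'))"
        unfolding of_nat_mult of_nat_add of_nat_diff[OF l] r s by (simp add: algebra_simps)
      then have 2: "Q powi ((s + int l + 1) * (r - int \<alpha> + 1)) = Q ^ ((s' - l) * (\<alpha> + r'))"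
        by (simp only: power_int_of_nat)
      show "curt_smul (Qbinom (int l - r - 1) l * Q powi ((s + int l + 1) * (r - int \<alpha> + 1)))
        (curt_prod (r - int l) (homog (ev f) \<alpha>) (curt_prod (s + int l) B C)) =
        curt_smul (Qbinom (int (l + r')) l * Q ^ ((s' - l) * (\<alpha> + r')))
      (curt_prod (- int (r' + l) - 1) (homog (ev f) \<alpha>) (curt_prod (- int (s' - l) - 1) B C))"
        unfolding 2 by (simp only: 1)
    qed simp
    also have "\<dots> = curt_prod s (curt_prod r (homog (ev f) \<alpha>) B) C"
      unfolding r s by (rule q_assoc_homog[OF assms, symmetric])
    finally show ?thesis ..
  qed
qed

text \<open>Apart from closure and grading, the axioms are identities that hold on \<open>W\<close>
  and pass to subspaces. The decomposition into degrees is the one by powers of \<open>t\<close>,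
  re-indexed by integers.\<close>

lemma q_vertex_algebraI:
  assumes sub: "V \<subseteq> W" and sp: "module.subspace curt_smul V" and one: "curt_one \<in> V"
    and closed: "\<And>n A B. A \<in> V \<Longrightarrow> B \<in> V \<Longrightarrow> curt_prod n A B \<in> V"
    and graded: "\<And>A \<alpha>. A \<in> V \<Longrightarrow> homog (Poly_Mapping.lookup A \<alpha>) \<alpha> \<in> V"
  shows "q_vertex_algebra_of_currents V"
proof -
  interpret vs: vector_space "curt_smul :: F \<Rightarrow> 'k curt \<Rightarrow> 'k curt" by (rule vector_space_curt_smul)
  have in_gr: "homog a \<alpha> \<in> V \<Longrightarrow> homog a \<alpha> \<in> curt_gr V (int \<alpha>)" for a \<alpha>
    by (auto simp: curt_gr_def)
  have gr_cases: "(\<exists>a \<alpha>. u = int \<alpha> \<and> A = homog a \<alpha> \<and> homog a \<alpha> \<in> V) \<or> u < 0 \<and> A = 0" if "A \<in> curt_gr V u" for A u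
    using that by (cases "u \<ge> 0") (auto simp: curt_gr_def intro!: exI[of _ "nat u"])
  have gr_sub: "curt_gr V u \<subseteq> V" for u
    using gr_cases vs.subspace_0[OF sp] by blast
  have "graded_nonlocal_q_vertex_algebra curt_smul V (curt_gr V) curt_prod curt_one"
  proof
    show "vs.subspace V" by fact
    show "curt_gr V u \<subseteq> V" for u by (rule gr_sub)
    show "curt_one \<in> V" by fact
    show "vs.subspace (curt_gr V u)" for u
    proof (cases "u \<ge> 0")
      case True
      show ?thesis
      proof (rule vs.subspaceI)
        show "0 \<in> curt_gr V u"
          using True vs.subspace_0[OF sp] by (auto simp: curt_gr_def intro!: exI[of _ 0])
        show "x + y \<in> curt_gr V u" if xy: "x \<in> curt_gr V u" "y \<in> curt_gr V u" for x y
        proof -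
          obtain a b where "x = homog a (nat u)" "y = homog b (nat u)"
            using xy True by (auto simp: curt_gr_def)
          then have "x + y = homog (a + b) (nat u)" by (simp only: homog_add)
          moreover have "x + y \<in> V"
            using xy gr_sub by (intro vs.subspace_add[OF sp]) auto
          ultimately show ?thesis using True by (auto simp: curt_gr_def)
        qed
        show "curt_smul c x \<in> curt_gr V u" if x: "x \<in> curt_gr V u" for c x
        proof -
          obtain a where "x = homog a (nat u)"
            using x True by (auto simp: curt_gr_def)
          then have "curt_smul c x = homog (cur_smul c a) (nat u)" by (simp only: homog_smul)
          moreover have "curt_smul c x \<in> V"
            using x gr_sub by (intro vs.subspace_scale[OF sp]) auto
          ultimately show ?thesis using True by (auto simp: curt_gr_def)
        qed
      qed
    qed (simp add: curt_gr_def vs.subspace_0[OF vs.subspace_single_0])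
    show "\<exists>!f :: int \<Rightarrow>\<^sub>0 'k curt. (\<forall>u. Poly_Mapping.lookup f u \<in> curt_gr V u) \<and>
         v = (\<Sum>u\<in>Poly_Mapping.keys f. Poly_Mapping.lookup f u)" if v: "v \<in> V" for v
    proof -
      define f where "f = (\<Sum>\<alpha>\<in>Poly_Mapping.keys v. Poly_Mapping.single (int \<alpha>) (homog (Poly_Mapping.lookup v \<alpha>) \<alpha>))"
      have lf: "Poly_Mapping.lookup f u = (if u \<ge> 0 then homog (Poly_Mapping.lookup v (nat u)) (nat u) else 0)" for u
      proof -
        have "Poly_Mapping.lookup f u = (\<Sum>\<alpha>\<in>Poly_Mapping.keys v. if u \<ge> 0 \<and> \<alpha> = nat u then homog (Poly_Mapping.lookup v \<alpha>) \<alpha> else 0)"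
          unfolding f_def lookup_sum lookup_single by (rule sum.cong) (auto simp: when_def)
        then show ?thesis by (auto simp: in_keys_iff)
      qed
      show ?thesis
      proof (rule ex1I[of _ f])
        have "Poly_Mapping.lookup f u \<in> curt_gr V u" for u
          using graded[OF v] in_gr[of _ "nat u"] by (auto simp: lf curt_gr_def)
        moreover have "v = (\<Sum>u\<in>Poly_Mapping.keys f. Poly_Mapping.lookup f u)"
        proof -
          have "(\<Sum>u\<in>Poly_Mapping.keys f. Poly_Mapping.lookup f u) = (\<Sum>u\<in>int ` Poly_Mapping.keys v. Poly_Mapping.lookup f u)"
          proof (rule sum.mono_neutral_left)
            show "Poly_Mapping.keys f \<subseteq> int ` Poly_Mapping.keys v"
            proof
              fix u assume "u \<in> Poly_Mapping.keys f"
              then have "u \<ge> 0" "Poly_Mapping.lookup v (nat u) \<noteq> 0"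
                by (auto simp: in_keys_iff lf split: if_splits)
              then show "u \<in> int ` Poly_Mapping.keys v"
                by (auto simp: in_keys_iff intro!: image_eqI[of _ _ "nat u"])
            qed
          qed (auto simp: in_keys_iff)
          also have "\<dots> = (\<Sum>\<alpha>\<in>Poly_Mapping.keys v. homog (Poly_Mapping.lookup v \<alpha>) \<alpha>)"
            by (subst sum.reindex) (auto simp: lf)
          also have "\<dots> = v" by (rule sum_homog[symmetric]) auto
          finally show ?thesis ..
        qed
        ultimately show "(\<forall>u. Poly_Mapping.lookup f u \<in> curt_gr V u) \<and> v = (\<Sum>u\<in>Poly_Mapping.keys f. Poly_Mapping.lookup f u)"
          by blast
        fix g :: "int \<Rightarrow>\<^sub>0 'k curt"
        assume g: "(\<forall>u. Poly_Mapping.lookup g u \<in> curt_gr V u) \<and> v = (\<Sum>u\<in>Poly_Mapping.keys g. Poly_Mapping.lookup g u)"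
        have lg: "Poly_Mapping.lookup (Poly_Mapping.lookup g u) \<alpha> = 0" if "u \<noteq> int \<alpha>" for u \<alpha>
        proof -
          have "Poly_Mapping.lookup g u \<in> curt_gr V u" using g by blast
          from gr_cases[OF this] that show ?thesis
            by (elim disjE exE conjE) (simp_all add: lookup_homog when_def)
        qed
        show "g = f"
        proof (rule poly_mapping_eqI)
          fix u
          show "Poly_Mapping.lookup g u = Poly_Mapping.lookup f u"
          proof (cases "u \<ge> 0")
            case False
            have "Poly_Mapping.lookup g u \<in> curt_gr V u" using g by blast
            with False have "Poly_Mapping.lookup g u = 0" by (simp add: curt_gr_def)
            with False show ?thesis by (simp add: lf)
          next
            case True
            then obtain \<alpha> where u: "u = int \<alpha>" using nonneg_int_cases by blast
            obtain a where a: "Poly_Mapping.lookup g u = homog a \<alpha>"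
              using g True by (auto simp: curt_gr_def u dest!: spec[of _ u])
            have "Poly_Mapping.lookup v \<alpha> = (\<Sum>w\<in>Poly_Mapping.keys g. Poly_Mapping.lookup (Poly_Mapping.lookup g w) \<alpha>)"
              using g by (simp add: lookup_sum)
            also have "\<dots> = (\<Sum>w\<in>insert u (Poly_Mapping.keys g). Poly_Mapping.lookup (Poly_Mapping.lookup g w) \<alpha>)"
              by (rule sum.mono_neutral_left) (auto simp: in_keys_iff)
            also have "\<dots> = (\<Sum>w\<in>insert u (Poly_Mapping.keys g). if w = u then a else 0)"
              by (rule sum.cong) (auto simp: a[unfolded u] lookup_homog lg u)
            also have "\<dots> = a" by simp
            finally show ?thesis using a[unfolded u] by (simp add: lf u)
          qed
        qed
      qed
    qed
    fix a b c :: "'k curt" and n u s r :: int and x :: F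
    show "a \<in> V \<Longrightarrow> b \<in> V \<Longrightarrow> curt_prod n a b \<in> V" by (rule closed)
    show "a \<in> V \<Longrightarrow> b \<in> V \<Longrightarrow> c \<in> V \<Longrightarrow> curt_prod n (a + b) c = curt_prod n a c + curt_prod n b c"
      using sub by (intro curt_prod_add_left) auto
    show "a \<in> V \<Longrightarrow> b \<in> V \<Longrightarrow> c \<in> V \<Longrightarrow> curt_prod n a (b + c) = curt_prod n a b + curt_prod n a c"
      using sub by (intro curt_prod_add_right) auto
    show "a \<in> V \<Longrightarrow> b \<in> V \<Longrightarrow> curt_prod n (curt_smul x a) b = curt_smul x (curt_prod n a b)"
      using sub by (intro curt_prod_smul_left) auto
    show "a \<in> V \<Longrightarrow> b \<in> V \<Longrightarrow> curt_prod n a (curt_smul x b) = curt_smul x (curt_prod n a b)"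
      using sub by (intro curt_prod_smul_right) auto
    show "a \<in> V \<Longrightarrow> b \<in> V \<Longrightarrow> \<exists>N. \<forall>n\<ge>N. curt_prod n a b = 0"
      by (intro exI[of _ 0]) (simp add: curt_prod_nonneg)
    show "b \<in> V \<Longrightarrow> curt_prod n curt_one b = (if n = - 1 then b else 0)"
      using sub by (intro curt_prod_one_left) auto
    show "a \<in> V \<Longrightarrow> curt_prod (- 1) a curt_one = a"
      using sub by (intro curt_prod_one_right) auto
    show "a \<in> V \<Longrightarrow> n \<ge> 0 \<Longrightarrow> curt_prod n a curt_one = 0"
      by (simp add: curt_prod_nonneg)
    show "curt_prod n a b \<in> curt_gr V (s + u - n - 1)" if a: "a \<in> curt_gr V u" and b: "b \<in> curt_gr V s"
    proof -
      have z: "0 \<in> curt_gr V w" for w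
        using vs.subspace_0[OF sp] by (auto simp: curt_gr_def intro!: exI[of _ 0])
      show ?thesis
      proof (cases "n < 0 \<and> a \<noteq> 0 \<and> b \<noteq> 0")
        case False
        then show ?thesis using z by (auto simp: curt_prod_nonneg)
      next
        case True
        then obtain r where n: "n = - int r - 1" using neg_int_cases by blast
        obtain a' \<alpha> where a': "u = int \<alpha>" "a = homog a' \<alpha>" "a \<in> V"
          using gr_cases[OF a] True by auto
        obtain b' \<beta> where b': "s = int \<beta>" "b = homog b' \<beta>" "b \<in> V"
          using gr_cases[OF b] True by auto
        obtain f g where fg: "below \<alpha> f" "a' = ev f" "below \<beta> g" "b' = ev g"
          using W_lookup[of a \<alpha>] W_lookup[of b \<beta>] a' b' sub by (auto simp: lookup_homog)
        have "curt_prod n a b = homog (ev (mmul r \<alpha> f g)) (\<alpha> + \<beta> + r)"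
          by (simp add: n a'(2) b'(2) fg curt_prod_homog)
        moreover have "s + u - n - 1 = int (\<alpha> + \<beta> + r)"
          by (simp add: n a'(1) b'(1))
        ultimately show ?thesis
          using closed[OF a'(3) b'(3), of n] in_gr by metis
      qed
    qed
    show "curt_prod s (curt_prod r a b) c =
         Sum_any (\<lambda>l::nat. curt_smul (Qbinom (int l - r - 1) l * Q powi ((s + int l + 1) * (r - u + 1)))
                            (curt_prod (r - int l) a (curt_prod (s + int l) b c)))"
      if a: "a \<in> curt_gr V u" and b: "b \<in> V" and c: "c \<in> V"
    proof -
      consider \<alpha> a' where "u = int \<alpha>" "a = homog a' \<alpha>" "a \<in> V" | "a = 0"
        using gr_cases[OF a] by blast
      then show ?thesis
      proof cases
        case 1
        then obtain f where "below \<alpha> f" "a' = ev f"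
          using W_lookup[of a \<alpha>] sub by (auto simp: lookup_homog)
        with 1 b c sub show ?thesis
          by (simp add: q_assoc_W subsetD)
      qed simp
    qed
  qed
  then show ?thesis
    using sub W_currents_t quasi_comm_W unfolding q_vertex_algebra_of_currents_def by blast
qed

end

section \<open>Monomials\<close>

text \<open>The bound \<open>m \<le> CARD('c)\<close> is left out: spanning is first proved with
  blocks of any length, and monomials with long blocks are discarded by
  \<open>mono_eq_0\<close>.\<close>

fun admissible :: "(nat \<times> int) list \<Rightarrow> bool" where
  "admissible [] \<longleftrightarrow> True"
| "admissible ((m, r) # ps) \<longleftrightarrow> 1 \<le> m \<and> r \<le> (if ps = [] then - 1 else - 2) \<and> admissible ps"

lemma admissible_iff:
  "admissible ps \<longleftrightarrow> (\<forall>j<length ps. 1 \<le> fst (ps ! j)) \<and>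
    (\<forall>j<length ps. snd (ps ! j) \<le> (if Suc j < length ps then - 2 else - 1))"
proof (induction ps rule: admissible.induct)
  case (2 m r ps)
  have *: "(\<forall>j<length ((m, r) # ps). R j) \<longleftrightarrow> R 0 \<and> (\<forall>j<length ps. R (Suc j))" for R
    by (auto simp: All_less_Suc2)
  show ?case
    unfolding * using 2 by auto
qed simp

interpretation curt_vs: vector_space "curt_smul :: F \<Rightarrow> 'k curt \<Rightarrow> 'k curt"
  by (rule vector_space_curt_smul)

context current_family
begin

definition X :: "'k curt" where
  "X = homog (P {#0#}) 1"

definition XM :: "nat \<Rightarrow> 'k curt" where
  "XM m = (curt_prod (- 1) X ^^ m) curt_one"

definition mono_prod :: "(nat \<times> int) list \<Rightarrow> 'k curt" where
  "mono_prod ps = foldr (\<lambda>(m, r). curt_prod r (XM m)) ps curt_one"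

definition word :: "int list \<Rightarrow> 'k curt" where
  "word rs = foldr (\<lambda>r. curt_prod r X) rs curt_one"

definition mx :: model where
  "mx = Poly_Mapping.single (0, {#0#}) 1"

lemma below_mx: "below 1 mx"
  unfolding mx_def by (rule below_single) simp

lemma X_eq: "X = homog (ev mx) 1"
  by (simp add: X_def mx_def ev_single cur_shift_def)

lemma X_W [simp]: "X \<in> W"
  unfolding X_eq by (rule homog_W[OF below_mx])

lemma XM_W [simp]: "XM m \<in> W"
  by (induction m) (simp_all add: XM_def curt_one_W curt_prod_W)

lemma XM_0 [simp]: "XM 0 = curt_one"
  by (simp add: XM_def)

lemma XM_Suc: "XM (Suc m) = curt_prod (- 1) X (XM m)"
  by (simp add: XM_def)

lemma XM_1: "XM (Suc 0) = X"
  by (simp add: XM_Suc curt_prod_one_right)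

lemma mono_simps [simp]: "mono_prod [] = curt_one" "mono_prod ((m, r) # ps) = curt_prod r (XM m) (mono_prod ps)"
  by (simp_all add: mono_prod_def)

lemma mono_W [simp]: "mono_prod ps \<in> W"
  by (induction ps) (auto simp: curt_one_W curt_prod_W)

lemma word_simps [simp]: "word [] = curt_one" "word (r # rs) = curt_prod r X (word rs)"
  by (simp_all add: word_def)

lemma word_W [simp]: "word rs \<in> W"
  by (induction rs) (auto simp: curt_one_W curt_prod_W)

lemma subspace_W: "curt_vs.subspace W"
  by (rule curt_vs.subspaceI) (auto intro: W_add W_smul)

lemma span_W: "S \<subseteq> W \<Longrightarrow> curt_vs.span S \<subseteq> W"
  by (rule curt_vs.span_minimal[OF _ subspace_W])

text \<open>The case \<open>r = 0\<close> and \<open>\<alpha> = 1\<close> of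
  \<open>q_assoc_homog\<close>, in which all q-binomials are 1.\<close>

lemma XM_assoc:
  assumes "C \<in> W"
  shows "curt_prod (- int s - 1) (XM (Suc m)) C =
    (\<Sum>l\<le>s. curt_smul (Q ^ (s - l)) (curt_prod (- int l - 1) X (curt_prod (- int (s - l) - 1) (XM m) C)))"
proof -
  have b: "Qbinom (int l) l = 1" for l
    using Qbinom_eq[of l 0] by (simp add: Qfact_def[of 0])
  have "XM (Suc m) = curt_prod (- int 0 - 1) (homog (ev mx) 1) (XM m)"
    by (simp add: XM_Suc X_eq)
  then show ?thesis
    using q_assoc_homog[OF below_mx XM_W assms, of s 0 m]
    by (simp only: b X_eq[symmetric] mult_1_left add_0_left add_0_right mult_1_right)
qed

lemma XM_minus_one:
  assumes "C \<in> W"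
  shows "curt_prod (- 1) (XM m) C = (curt_prod (- 1) X ^^ m) C"
proof (induction m)
  case 0
  show ?case using curt_prod_one_left[OF assms, of "- 1"] by simp
next
  case (Suc m)
  then show ?case using XM_assoc[OF assms, of 0 m] by simp
qed

text \<open>The number \<open>n\<close> counts the factors \<open>X\<close>; straightening preserves
  it, and it serves as the induction measure.\<close>

definition mono_span :: "nat \<Rightarrow> 'k curt set" where
  "mono_span n = curt_vs.span {mono_prod ps | ps. admissible ps \<and> sum_list (map fst ps) = n}"

lemma mono_span_W: "mono_span n \<subseteq> W"
  unfolding mono_span_def by (rule span_W) auto

lemma mono_in_span: "admissible ps \<Longrightarrow> sum_list (map fst ps) = n \<Longrightarrow> mono_prod ps \<in> mono_span n"
  unfolding mono_span_def by (rule curt_vs.span_base) auto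

lemma mono_span_add: "A \<in> mono_span n \<Longrightarrow> B \<in> mono_span n \<Longrightarrow> A + B \<in> mono_span n"
  unfolding mono_span_def by (rule curt_vs.span_add)

lemma mono_span_smul: "A \<in> mono_span n \<Longrightarrow> curt_smul c A \<in> mono_span n"
  unfolding mono_span_def by (rule curt_vs.span_scale)

lemma mono_span_linear:
  assumes A: "A \<in> mono_span n"
    and h: "\<And>ps. admissible ps \<Longrightarrow> sum_list (map fst ps) = n \<Longrightarrow> curt_prod r X (mono_prod ps) \<in> mono_span n'"
  shows "curt_prod r X A \<in> mono_span n'"
proof -
  have "A \<in> W \<and> curt_prod r X A \<in> mono_span n'"
    using A unfolding mono_span_def[of n]
  proof (induction rule: curt_vs.span_induct_alt)
    case base
    show ?case using curt_vs.span_zero by (simp add: mono_span_def)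
  next
    case (step c x y)
    then obtain ps where ps: "x = mono_prod ps" "admissible ps" "sum_list (map fst ps) = n" by blast
    with step h[OF ps(2,3)] show ?case
      by (auto simp: curt_prod_add_right curt_prod_smul_right W_add W_smul intro!: mono_span_add mono_span_smul)
  qed
  then show ?thesis ..
qed

lemma X_mono_span_le:
  assumes "A \<in> mono_span n" "r \<le> - 2"
  shows "curt_prod r X A \<in> mono_span (Suc n)"
proof (rule mono_span_linear[OF assms(1)])
  fix ps assume "admissible ps" "sum_list (map fst ps) = n"
  then have "mono_prod ((1, r) # ps) \<in> mono_span (Suc n)"
    using assms(2) by (intro mono_in_span) auto
  then show "curt_prod r X (mono_prod ps) \<in> mono_span (Suc n)"
    by (simp add: XM_1)
qed

text \<open>
  The case $r=-1$ is the only one where the product with \<open>X\<close> is not a monomial; it is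
  the $l=0$ term of the expansion of $(x_{m+1})_r$ in terms of $x_m$, whose other terms are
  covered by the case $r\le-2$.
\<close>

lemma X_mono_span: "A \<in> mono_span n \<Longrightarrow> curt_prod (- 1) X A \<in> mono_span (Suc n)"
proof (induction n arbitrary: A rule: less_induct)
  case (less n)
  show ?case
  proof (rule mono_span_linear[OF less.prems])
    fix ps assume ps: "admissible ps" "sum_list (map fst ps) = n"
    show "curt_prod (- 1) X (mono_prod ps) \<in> mono_span (Suc n)"
    proof (cases ps)
      case Nil
      then have "mono_prod [(1, - 1)] \<in> mono_span (Suc n)"
        using ps by (intro mono_in_span) auto
      then show ?thesis by (simp add: Nil XM_1)
    next
      case (Cons p ps')
      obtain m r where p: "p = (m, r)" by (cases p)
      define C where "C = mono_prod ps'"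
      have m: "m \<ge> 1" and adm: "admissible ps'" and r: "r \<le> (if ps' = [] then - 1 else - 2)"
        and n: "n = m + sum_list (map fst ps')"
        using ps by (simp_all add: Cons p split: if_splits)
      have CW: "C \<in> W" by (simp add: C_def)
      define s where "s = nat (- r - 1)"
      have s: "r = - int s - 1" using r by (simp add: s_def split: if_splits)
      \<comment> \<open>For \<open>l = s\<close> with \<open>ps'\<close> nonempty the mode is
        \<open>-1\<close>, which is not admissible. There \<open>XM m\<close> acts as
        \<open>m\<close> applications of \<open>X\<close> in mode \<open>-1\<close>, and each starts
        with fewer than \<open>n\<close> factors, so the induction hypothesis covers it. In the
        other cases the product is itself an admissible monomial.\<close>
      have low: "curt_prod (- int (s - l) - 1) (XM m) C \<in> mono_span n" if l: "l \<le> s" for l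
      proof (cases "ps' = [] \<or> s - l \<ge> 1")
        case True
        have "mono_prod ((m, - int (s - l) - 1) # ps') \<in> mono_span n"
          using True m adm n by (intro mono_in_span) auto
        then show ?thesis by (simp add: C_def)
      next
        case False
        have "(curt_prod (- 1) X ^^ j) C \<in> mono_span (n - m + j)" if "j \<le> m" for j
          using that
        proof (induction j)
          case 0
          show ?case using adm n by (auto simp: C_def intro: mono_in_span)
        next
          case (Suc j)
          then show ?case using less.IH[of "n - m + j"] m n by simp
        qed
        from this[of m] have "curt_prod (- 1) (XM m) C \<in> mono_span n"
          using n by (simp add: XM_minus_one[OF CW] add.commute)
        moreover have "- int (s - l) - 1 = - 1" using False by auto
        ultimately show ?thesis by (simp only:)
      qed
      have "mono_prod ((Suc m, r) # ps') \<in> mono_span (Suc n)"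
        using ps by (intro mono_in_span) (simp_all add: Cons p)
      then have top: "curt_prod (- int s - 1) (XM (Suc m)) C \<in> mono_span (Suc n)"
        by (simp add: C_def s)
      define R where "R = (\<Sum>l\<in>{1..s}. curt_smul (Q ^ (s - l)) (curt_prod (- int l - 1) X (curt_prod (- int (s - l) - 1) (XM m) C)))"
      have R: "R \<in> mono_span (Suc n)"
      proof -
        have "curt_smul (Q ^ (s - l)) (curt_prod (- int l - 1) X (curt_prod (- int (s - l) - 1) (XM m) C)) \<in> mono_span (Suc n)"
          if "l \<in> {1..s}" for l
          using that by (intro mono_span_smul X_mono_span_le low) auto
        then show ?thesis
          unfolding R_def mono_span_def by (rule curt_vs.span_sum)
      qed
      have "{..s} = insert 0 {1..s}" by auto
      then have "curt_prod (- int s - 1) (XM (Suc m)) C = curt_smul (Q ^ s) (curt_prod (- 1) X (mono_prod ps)) + R"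
        unfolding XM_assoc[OF CW] R_def by (simp add: Cons p s C_def)
      then have "curt_smul (Q ^ s) (curt_prod (- 1) X (mono_prod ps)) = curt_prod (- int s - 1) (XM (Suc m)) C - R"
        by simp
      moreover have "curt_prod (- int s - 1) (XM (Suc m)) C - R \<in> mono_span (Suc n)"
        using top R unfolding mono_span_def by (rule curt_vs.span_diff)
      \<comment> \<open>The coefficient \<open>Q^s\<close> of the wanted term is invertible.\<close>
      ultimately have "curt_smul (inverse (Q ^ s)) (curt_smul (Q ^ s) (curt_prod (- 1) X (mono_prod ps))) \<in> mono_span (Suc n)"
        by (simp only: mono_span_smul)
      then show ?thesis by simp
    qed
  qed
qed

definition VV :: "'k curt set" where
  "VV = curt_vs.span (mono_prod ` Collect admissible)"

lemma VV_W: "VV \<subseteq> W"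
  unfolding VV_def by (rule span_W) auto

lemma mono_span_VV: "mono_span n \<subseteq> VV"
  unfolding mono_span_def VV_def by (rule curt_vs.span_mono) auto

lemma X_VV:
  assumes "A \<in> VV" shows "curt_prod r X A \<in> VV"
proof -
  have "A \<in> W \<and> curt_prod r X A \<in> VV"
    using assms unfolding VV_def
  proof (induction rule: curt_vs.span_induct_alt)
    case base
    show ?case using curt_vs.span_zero by simp
  next
    case (step c x y)
    then obtain ps where ps: "x = mono_prod ps" "admissible ps" by blast
    then have x: "x \<in> mono_span (sum_list (map fst ps))" by (simp add: mono_in_span)
    consider "r \<ge> 0" | "r = - 1" | "r \<le> - 2" by linarith
    then have "curt_prod r X x \<in> VV"
    proof cases
      case 1
      then show ?thesis using curt_vs.span_zero by (simp add: curt_prod_nonneg VV_def)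
    next
      case 2
      then show ?thesis using X_mono_span[OF x] mono_span_VV by blast
    next
      case 3
      then show ?thesis using X_mono_span_le[OF x] mono_span_VV by blast
    qed
    with step ps show ?case
      unfolding VV_def
      by (auto simp: curt_prod_add_right curt_prod_smul_right W_add W_smul intro!: curt_vs.span_add curt_vs.span_scale)
  qed
  then show ?thesis ..
qed

lemma one_VV: "curt_one \<in> VV"
  unfolding VV_def by (rule curt_vs.span_base) (auto intro!: image_eqI[of _ _ "[]"])

lemma span_closed_left:
  assumes "A \<in> curt_vs.span S" "S \<subseteq> W" "C \<in> W" "curt_vs.subspace U"
    and "\<And>x. x \<in> S \<Longrightarrow> curt_prod r x C \<in> U"
  shows "curt_prod r A C \<in> U"
proof -
  have "A \<in> W \<and> curt_prod r A C \<in> U"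
    using assms(1)
  proof (induction rule: curt_vs.span_induct_alt)
    case base
    show ?case using curt_vs.subspace_0[OF assms(4)] by simp
  next
    case (step c x y)
    with assms(2,3,5) show ?case
      by (auto simp: curt_prod_add_left curt_prod_smul_left W_add W_smul subsetD
        intro!: curt_vs.subspace_add[OF assms(4)] curt_vs.subspace_scale[OF assms(4)])
  qed
  then show ?thesis ..
qed

text \<open>Words suit closure under all products, admissible monomials suit the basis;
  \<open>VV_eq_WD\<close> identifies the two spans.\<close>

definition WD :: "'k curt set" where
  "WD = curt_vs.span (range word)"

lemma subspace_WD: "curt_vs.subspace WD"
  unfolding WD_def by (rule curt_vs.subspace_span)

lemma WD_W: "WD \<subseteq> W"
  unfolding WD_def by (rule span_W) auto

lemma X_WD:
  assumes "A \<in> WD" shows "curt_prod r X A \<in> WD"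
proof -
  have "A \<in> W \<and> curt_prod r X A \<in> WD"
    using assms unfolding WD_def
  proof (induction rule: curt_vs.span_induct_alt)
    case base
    show ?case using curt_vs.span_zero by simp
  next
    case (step c x y)
    then obtain rs where x: "x = word rs" by blast
    have "curt_prod r X x \<in> curt_vs.span (range word)"
      by (rule curt_vs.span_base, rule range_eqI[of _ _ "r # rs"]) (simp add: x)
    with step x show ?case
      by (auto simp: curt_prod_add_right curt_prod_smul_right W_add W_smul intro!: curt_vs.span_add curt_vs.span_scale)
  qed
  then show ?thesis ..
qed

text \<open>By q-associativity the modes of \<open>X_r B\<close> are combinations of modes of
  \<open>X\<close> after modes of \<open>B\<close>, so the property passes from \<open>B\<close> to
  \<open>X_r B\<close>, hence to all words and to \<open>XM m\<close>.\<close>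

definition acts :: "'k curt \<Rightarrow> bool" where
  "acts A \<longleftrightarrow> A \<in> W \<and> (\<forall>C\<in>WD. \<forall>r. curt_prod r A C \<in> WD)"

lemma acts_one: "acts curt_one"
  using WD_W curt_vs.subspace_0[OF subspace_WD] by (auto simp: acts_def curt_one_W curt_prod_one_left subsetD)

lemma acts_X:
  assumes "acts B" shows "acts (curt_prod r X B)"
proof -
  have B: "B \<in> W" "\<And>C n. C \<in> WD \<Longrightarrow> curt_prod n B C \<in> WD"
    using assms by (auto simp: acts_def)
  have "curt_prod n (curt_prod r X B) C \<in> WD" if C: "C \<in> WD" for n C
  proof (cases "n < 0 \<and> r < 0")
    case False
    then show ?thesis
      using curt_vs.subspace_0[OF subspace_WD] by (auto simp: curt_prod_nonneg)
  next
    case True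
    then obtain s r' where n: "n = - int s - 1" and r: "r = - int r' - 1"
      using neg_int_cases by metis
    show ?thesis
      unfolding n r X_eq q_assoc_homog[OF below_mx B(1) subsetD[OF WD_W C]]
      unfolding X_eq[symmetric]
      by (intro curt_vs.subspace_sum[OF subspace_WD] curt_vs.subspace_scale[OF subspace_WD] X_WD B(2) C)
  qed
  then show ?thesis using B by (auto simp: acts_def curt_prod_W)
qed

lemma acts_word: "acts (word rs)"
  by (induction rs) (simp_all add: acts_one acts_X)

lemma acts_XM: "acts (XM m)"
  by (induction m) (simp_all add: acts_one acts_X XM_Suc)

lemma WD_closed:
  assumes "A \<in> WD" "B \<in> WD" shows "curt_prod n A B \<in> WD"
  using assms(1) unfolding WD_def
  by (rule span_closed_left) (use acts_word assms(2) WD_W subspace_WD in \<open>auto simp: acts_def WD_def[symmetric]\<close>)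

lemma VV_eq_WD: "VV = WD"
proof
  have "mono_prod ps \<in> WD" for ps
  proof (induction ps)
    case Nil
    show ?case unfolding WD_def by (rule curt_vs.span_base) (auto intro!: range_eqI[of _ _ "[]"])
  next
    case (Cons p ps)
    then show ?case using acts_XM by (cases p) (auto simp: acts_def)
  qed
  then show "VV \<subseteq> WD"
    unfolding VV_def by (intro curt_vs.span_minimal subspace_WD) auto
  have "word rs \<in> VV" for rs
    by (induction rs) (simp_all add: one_VV X_VV)
  then show "WD \<subseteq> VV"
    unfolding WD_def by (intro curt_vs.span_minimal) (auto simp: VV_def curt_vs.subspace_span)
qed

lemma word_homog: "\<exists>a \<alpha>. word rs = homog a \<alpha>"
proof (induction rs)
  case Nil
  show ?case by (auto simp: curt_one_def)
next
  case (Cons r rs)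
  then obtain a \<alpha> where w: "word rs = homog a \<alpha>" by blast
  obtain g where g: "below \<alpha> g" "a = ev g"
    using W_lookup[OF word_W[of rs], of \<alpha>] by (auto simp: w lookup_homog)
  show ?case
  proof (cases "r < 0")
    case True
    then obtain s where r: "r = - int s - 1" by (rule neg_int_cases)
    show ?thesis unfolding word_simps w g(2) X_eq r curt_prod_homog[OF below_mx g(1)] by blast
  next
    case False
    then show ?thesis by (auto simp: curt_prod_nonneg intro!: exI[of _ 0])
  qed
qed

lemma WD_graded:
  assumes "A \<in> WD" shows "homog (Poly_Mapping.lookup A \<alpha>) \<alpha> \<in> WD"
  using assms unfolding WD_def
proof (induction rule: curt_vs.span_induct_alt)
  case base
  show ?case unfolding lookup_zero homog_0 by (rule curt_vs.span_zero)
next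
  case (step c x y)
  then obtain rs where x: "x = word rs" by blast
  obtain a \<beta> where w: "word rs = homog a \<beta>" using word_homog by blast
  have "homog (Poly_Mapping.lookup x \<alpha>) \<alpha> = (if \<alpha> = \<beta> then word rs else 0)"
    by (simp add: x w lookup_homog)
  then have "homog (Poly_Mapping.lookup x \<alpha>) \<alpha> \<in> curt_vs.span (range word)"
    using curt_vs.span_zero[of "range word"] curt_vs.span_base[of "word rs" "range word"] by simp
  with step show ?case
    unfolding lookup_add homog_add lookup_curt_smul homog_smul
    by (intro curt_vs.span_add curt_vs.span_scale)
qed

theorem q_vertex_algebra_VV: "q_vertex_algebra_of_currents VV"
  unfolding VV_eq_WD
proof (rule q_vertex_algebraI[OF WD_W subspace_WD _ WD_closed WD_graded])
  show "curt_one \<in> WD" using one_VV by (simp add: VV_eq_WD)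
qed

lemma X_in_VV: "X \<in> VV"
  using X_VV[OF one_VV, of "- 1"] by (simp add: curt_prod_one_right)

lemma VV_minimal:
  assumes U: "q_vertex_algebra_of_currents U" and X: "X \<in> U"
  shows "VV \<subseteq> U"
proof -
  interpret graded_nonlocal_q_vertex_algebra curt_smul U "curt_gr U" curt_prod curt_one
    using U by (simp add: q_vertex_algebra_of_currents_def)
  have XM: "XM m \<in> U" for m
    by (induction m) (simp_all add: vac_in XM_Suc md_in X)
  have "mono_prod ps \<in> U" for ps
    by (induction ps) (auto simp: vac_in md_in XM)
  then show ?thesis
    unfolding VV_def by (intro curt_vs.span_minimal V_subspace) auto
qed

end

section \<open>Lowest terms\<close>

text \<open>The sum of the points is additive under products and does not decrease under
  \<open>msigma\<close>, so lowest terms can be traced through \<open>mmul\<close>;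
  \<open>high\<close> describes the remainder.\<close>

definition low :: "int \<Rightarrow> nat multiset \<Rightarrow> model \<Rightarrow> bool" where
  "low k S f \<longleftrightarrow> Poly_Mapping.lookup f (k, S) \<noteq> 0 \<and>
    (\<forall>x\<in>Poly_Mapping.keys f. fst x = k \<and> size (snd x) = size S \<and> (snd x = S \<or> sum_mset S < sum_mset (snd x)))"

definition high :: "int \<Rightarrow> nat multiset \<Rightarrow> model \<Rightarrow> bool" where
  "high k S f \<longleftrightarrow>
    (\<forall>x\<in>Poly_Mapping.keys f. fst x = k \<and> size (snd x) = size S \<and> sum_mset S < sum_mset (snd x))"

lemma low_iff: "low k S f \<longleftrightarrow> (\<exists>c g. c \<noteq> 0 \<and> high k S g \<and> f = Poly_Mapping.single (k, S) c + g)"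
proof
  assume f: "low k S f"
  define c where "c = Poly_Mapping.lookup f (k, S)"
  define g where "g = f - Poly_Mapping.single (k, S) c"
  have "high k S g"
    unfolding high_def
  proof
    fix x assume "x \<in> Poly_Mapping.keys g"
    then have g: "Poly_Mapping.lookup g x \<noteq> 0" by (simp add: in_keys_iff)
    then have "x \<noteq> (k, S)" by (auto simp: g_def c_def lookup_minus)
    moreover from this g have "x \<in> Poly_Mapping.keys f"
      by (simp add: g_def lookup_minus lookup_single in_keys_iff)
    ultimately show "fst x = k \<and> size (snd x) = size S \<and> sum_mset S < sum_mset (snd x)"
      using f unfolding low_def by (metis prod.collapse)
  qed
  moreover have "c \<noteq> 0" using f by (simp add: low_def c_def)
  moreover have "f = Poly_Mapping.single (k, S) c + g" by (simp add: g_def)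
  ultimately show "\<exists>c g. c \<noteq> 0 \<and> high k S g \<and> f = Poly_Mapping.single (k, S) c + g" by blast
next
  assume "\<exists>c g. c \<noteq> 0 \<and> high k S g \<and> f = Poly_Mapping.single (k, S) c + g"
  then obtain c g where f: "c \<noteq> 0" "high k S g" "f = Poly_Mapping.single (k, S) c + g" by blast
  have "(k, S) \<notin> Poly_Mapping.keys g"
    using f(2) by (auto simp: high_def)
  then have "Poly_Mapping.lookup f (k, S) = c"
    by (simp add: f(3) lookup_add in_keys_iff)
  moreover have "Poly_Mapping.keys f \<subseteq> insert (k, S) (Poly_Mapping.keys g)"
    using keys_add[of "Poly_Mapping.single (k, S) c" g] unfolding f(3) by (auto split: if_splits)
  ultimately show "low k S f"
    using f(1,2) by (auto simp: low_def high_def)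
qed

lemma high_add: "high k S f \<Longrightarrow> high k S g \<Longrightarrow> high k S (f + g)"
  using keys_add[of f g] unfolding high_def by blast

lemma high_cst: "high k S f \<Longrightarrow> high k S (cst c * f)"
proof -
  assume f: "high k S f"
  have "Poly_Mapping.keys (cst c * f) \<subseteq> Poly_Mapping.keys f"
    unfolding smul_cst[symmetric] by (auto simp: in_keys_iff)
  with f show ?thesis unfolding high_def by blast
qed

lemma high_mult:
  assumes "\<And>x y. x \<in> Poly_Mapping.keys f \<Longrightarrow> y \<in> Poly_Mapping.keys g \<Longrightarrow> fst x + fst y = k \<and>
    size (snd x) + size (snd y) = size S \<and> sum_mset S < sum_mset (snd x) + sum_mset (snd y)"
  shows "high k S (f * g)"
  unfolding high_def
proof
  fix z assume z: "z \<in> Poly_Mapping.keys (f * g)"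
  obtain x y where "x \<in> Poly_Mapping.keys f" "y \<in> Poly_Mapping.keys g" "z = x + y"
    using subsetD[OF keys_mult z] by blast
  with assms[of x y] show "fst z = k \<and> size (snd z) = size S \<and> sum_mset S < sum_mset (snd z)"
    by simp
qed

lemma low_mult:
  assumes "low k S f" "low m T g" shows "low (k + m) (S + T) (f * g)"
proof -
  obtain c f' where f: "c \<noteq> 0" "high k S f'" "f = Poly_Mapping.single (k, S) c + f'"
    using assms(1) low_iff by blast
  obtain d g' where g: "d \<noteq> 0" "high m T g'" "g = Poly_Mapping.single (m, T) d + g'"
    using assms(2) low_iff by blast
  have "f * g = Poly_Mapping.single (k + m, S + T) (c * d) + (Poly_Mapping.single (k, S) c * g' + f' * g)"
    by (simp add: f(3) g(3) distrib_left distrib_right mult_single)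
  moreover have "high (k + m) (S + T) (Poly_Mapping.single (k, S) c * g')"
    using g(2) by (intro high_mult) (auto simp: high_def split: if_splits)
  moreover have "high (k + m) (S + T) (f' * g)"
  proof (rule high_mult)
    fix x y assume "x \<in> Poly_Mapping.keys f'" "y \<in> Poly_Mapping.keys g"
    with f(2) assms(2) show "fst x + fst y = k + m \<and> size (snd x) + size (snd y) = size (S + T) \<and>
        sum_mset (S + T) < sum_mset (snd x) + sum_mset (snd y)"
      by (fastforce simp: high_def low_def)
  qed
  ultimately show ?thesis
    unfolding low_iff using f(1) g(1) high_add by (metis mult_eq_0_iff)
qed

lemma sum_image_Suc: "sum_mset (image_mset Suc S) = sum_mset S + size S"
  by (induction S) simp_all

lemma high_msigma: "high k S f \<Longrightarrow> high k (image_mset Suc S) (msigma f)"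
  unfolding high_def by (auto elim!: keys_msigma simp: sum_image_Suc)

lemma low_msigma: "low k S f \<Longrightarrow> low k (image_mset Suc S) (msigma f)"
proof -
  assume "low k S f"
  then obtain c f' where f: "c \<noteq> 0" "high k S f'" "f = Poly_Mapping.single (k, S) c + f'"
    using low_iff by blast
  have "msigma f = Poly_Mapping.single (k, image_mset Suc S) (c * Q powi k) + msigma f'"
    by (simp add: f(3) rhom.add[OF rhom_msigma] msigma_single)
  moreover have "c * Q powi k \<noteq> 0" using f(1) by simp
  ultimately show ?thesis
    unfolding low_iff using high_msigma[OF f(2)] by blast
qed

lemma low_msig: "low k S f \<Longrightarrow> low k (image_mset (\<lambda>a. n + a) S) (msig n f)"
proof (induction n)
  case (Suc n)
  then show ?case using low_msigma[OF Suc.IH[OF Suc.prems]] by (simp add: image_mset.compositionality o_def)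
next
  case 0
  have "(\<lambda>a. 0 + a) = (id :: nat \<Rightarrow> nat)" by auto
  with 0 show ?case by simp
qed

text \<open>In \<open>msigma f - f\<close> the shift raises every sum by the number of points, which
  is positive; so \<open>- f\<close> supplies the lowest term, and \<open>zinv\<close> lowers the
  exponent of \<open>z\<close> by one.\<close>

lemma low_mderiv:
  assumes f: "low k S f" and S: "S \<noteq> {#}"
  shows "low (k - 1) S (mderiv f)"
proof -
  obtain c f' where f': "c \<noteq> 0" "high k S f'" "f = Poly_Mapping.single (k, S) c + f'"
    using f low_iff by blast
  define d where "d = inverse (Q - 1)"
  have d: "d \<noteq> 0" using Q_neq_1 by (simp add: d_def)
  have "size S > 0" using S by (simp add: nonempty_has_size)
  then have sg: "high k S (msigma f)"
    using low_msigma[OF f] by (auto simp: high_def low_def sum_image_Suc)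
  have z: "high (k - 1) S (zinv * g)" if "high k S g" for g
    by (rule high_mult) (use that in \<open>auto simp: high_def zinv_def\<close>)
  have "mderiv f = Poly_Mapping.single (k - 1, S) (- (d * c)) + (cst d * (zinv * msigma f) + cst (- d) * (zinv * f'))"
    by (simp add: mderiv_def d_def[symmetric] f'(3) right_diff_distrib distrib_left zinv_def mult_single cst_def single_uminus)
  moreover have "high (k - 1) S (cst d * (zinv * msigma f) + cst (- d) * (zinv * f'))"
    by (intro high_add high_cst z sg f')
  moreover have "- (d * c) \<noteq> 0" using d f' by simp
  ultimately show ?thesis unfolding low_iff by blast
qed

lemma low_cst: "low k S f \<Longrightarrow> c \<noteq> 0 \<Longrightarrow> low k S (cst c * f)"
  unfolding smul_cst[symmetric] by (auto simp: low_def in_keys_iff)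

lemma low_mdiv: "low k S f \<Longrightarrow> S \<noteq> {#} \<Longrightarrow> low (k - int n) S (mdiv n f)"
proof -
  assume f: "low k S f" "S \<noteq> {#}"
  have "low (k - int n) S ((mderiv ^^ n) f)"
  proof (induction n)
    case (Suc n)
    then show ?case using low_mderiv[OF Suc f(2)] by (simp add: algebra_simps)
  qed (simp add: f)
  then show ?thesis unfolding mdiv_def by (rule low_cst) simp
qed

section \<open>Multisets without repeated points\<close>

definition simple :: "model \<Rightarrow> bool" where
  "simple f \<longleftrightarrow> (\<forall>x\<in>Poly_Mapping.keys f. \<forall>a. count (snd x) a \<le> 1)"

lemma simple_add: "simple f \<Longrightarrow> simple g \<Longrightarrow> simple (f + g)"
  using keys_add[of f g] unfolding simple_def by blast

lemma simple_sum: "(\<And>i. i \<in> A \<Longrightarrow> simple (f i)) \<Longrightarrow> simple (sum f A)"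
  by (induction A rule: infinite_finite_induct) (auto intro: simple_add simp: simple_def[of 0])

lemma simple_uminus: "simple f \<Longrightarrow> simple (- f)"
  by (simp add: simple_def)

lemma simple_cst: "simple f \<Longrightarrow> simple (cst c * f)"
  unfolding smul_cst[symmetric] by (auto simp: simple_def in_keys_iff)

lemma simple_zinv: "simple f \<Longrightarrow> simple (zinv * f)"
  using keys_mult[of zinv f] unfolding simple_def by (fastforce simp: zinv_def)

lemma simple_msigma: "simple f \<Longrightarrow> simple (msigma f)"
  unfolding simple_def
proof (intro ballI allI)
  fix x a assume f: "\<forall>x\<in>Poly_Mapping.keys f. \<forall>a. count (snd x) a \<le> 1" and x: "x \<in> Poly_Mapping.keys (msigma f)"
  obtain y where y: "y \<in> Poly_Mapping.keys f" "x = (fst y, image_mset Suc (snd y))"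
    using x by (rule keys_msigma)
  have c: "count (image_mset Suc S) (Suc b) = count S b" for S b
    by (induction S) simp_all
  have "count (image_mset Suc S) 0 = 0" for S
    by (induction S) simp_all
  with f y c show "count (snd x) a \<le> 1" by (cases a) auto
qed

lemma simple_msig: "simple f \<Longrightarrow> simple (msig n f)"
  by (induction n) (simp_all add: simple_msigma)

lemma simple_mderiv: "simple f \<Longrightarrow> simple (mderiv f)"
  unfolding mderiv_def diff_conv_add_uminus
  by (intro simple_cst simple_zinv simple_add simple_uminus simple_msigma)

lemma simple_mdiv: "simple f \<Longrightarrow> simple (mdiv n f)"
proof -
  assume "simple f"
  then have "simple ((mderiv ^^ n) f)" by (induction n) (simp_all add: simple_mderiv)
  then show ?thesis unfolding mdiv_def by (rule simple_cst)
qed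

text \<open>A point below \<open>\<alpha>\<close> can only come from the first factor, any other
  point only from the second.\<close>

lemma simple_mult:
  assumes "below \<alpha> f" "above \<alpha> g" "simple f" "simple g" shows "simple (f * g)"
  unfolding simple_def
proof (intro ballI allI)
  fix z a assume z: "z \<in> Poly_Mapping.keys (f * g)"
  obtain x y where xy: "x \<in> Poly_Mapping.keys f" "y \<in> Poly_Mapping.keys g" "z = x + y"
    using subsetD[OF keys_mult z] by blast
  have "count (snd x) a = 0 \<or> count (snd y) a = 0"
  proof (cases "a < \<alpha>")
    case True
    have "a \<notin># snd y"
    proof
      assume "a \<in># snd y"
      then have "\<alpha> \<le> a" using assms(2) xy(2) unfolding above_def by blast
      with True show False by simp
    qed
    then show ?thesis by (simp add: not_in_iff)
  next
    case False
    have "a \<notin># snd x"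
    proof
      assume "a \<in># snd x"
      then have "a < \<alpha>" using assms(1) xy(1) unfolding below_def by blast
      with False show False by simp
    qed
    then show ?thesis by (simp add: not_in_iff)
  qed
  moreover have "count (snd x) a \<le> 1" "count (snd y) a \<le> 1"
    using assms(3,4) xy(1,2) by (auto simp: simple_def)
  ultimately show "count (snd z) a \<le> 1" by (auto simp: xy(3))
qed

section \<open>Monomials in the model\<close>

definition xmod :: "nat \<Rightarrow> model" where
  "xmod m = Poly_Mapping.single (0, mset [0..<m]) 1"

fun mmono :: "(nat \<times> int) list \<Rightarrow> model" where
  "mmono [] = 1"
| "mmono ((m, r) # ps) = mmul (nat (- r - 1)) m (xmod m) (mmono ps)"

text \<open>The power of \<open>t\<close> of a monomial; \<open>zdeg\<close> is its power of
  \<open>z\<close>, lowered by one for each derivative.\<close>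

fun wgt :: "(nat \<times> int) list \<Rightarrow> nat" where
  "wgt [] = 0"
| "wgt ((m, r) # ps) = m + wgt ps + nat (- r - 1)"

fun zdeg :: "(nat \<times> int) list \<Rightarrow> int" where
  "zdeg [] = 0"
| "zdeg ((m, r) # ps) = zdeg ps - int (nat (- r - 1))"

text \<open>
  The lowest term of a monomial has blocks of \<open>m\<^sub>1, m\<^sub>2, \<dots>\<close> consecutive points separated by gaps
  of length $-r_j-1\ge1$; hence it determines the monomial up to the last $r_k$, which is
  read off from the power of $z$.
\<close>

fun blocks :: "(nat \<times> int) list \<Rightarrow> nat list" where
  "blocks [] = []"
| "blocks ((m, r) # ps) = [0..<m] @ map (\<lambda>a. m + nat (- r - 1) + a) (blocks ps)"

lemma below_xmod: "below m (xmod m)"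
  unfolding xmod_def by (rule below_single) simp

lemma below_mmono: "below (wgt ps) (mmono ps)"
proof (induction ps rule: wgt.induct)
  case 1
  show ?case by simp
next
  case (2 m r ps)
  then show ?case using below_mmul[OF below_xmod] by simp
qed

lemma low_mmono: "admissible ps \<Longrightarrow> low (zdeg ps) (mset (blocks ps)) (mmono ps)"
proof (induction ps rule: wgt.induct)
  case 1
  show ?case by (simp add: low_def single_one[symmetric] zero_prod_def del: single_one)
next
  case (2 m r ps)
  define s where "s = nat (- r - 1)"
  have m: "m \<ge> 1" and ps: "admissible ps" using 2(2) by auto
  have "low 0 (mset [0..<m]) (xmod m)"
    by (simp add: low_def xmod_def)
  then have 1: "low (0 - int s) (mset [0..<m]) (mdiv s (xmod m))"
    by (rule low_mdiv) (use m in \<open>simp del: mset_upt\<close>)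
  have "low (zdeg ps) (image_mset (\<lambda>a. m + s + a) (mset (blocks ps))) (msig (m + s) (mmono ps))"
    using 2(1)[OF ps] by (rule low_msig)
  from low_mult[OF 1 this] show ?case
    by (simp add: mmul_def s_def[symmetric])
qed

lemma simple_mmono: "simple (mmono ps)"
proof (induction ps rule: wgt.induct)
  case 1
  show ?case by (simp add: simple_def single_one[symmetric] zero_prod_def del: single_one)
next
  case (2 m r ps)
  define s where "s = nat (- r - 1)"
  have "count (mset [0..<m]) a \<le> 1" for a
    using distinct_count_atmost_1[of "[0..<m]"] by simp
  then have "simple (xmod m)" by (simp add: simple_def xmod_def del: mset_upt)
  then show ?case
    using 2 unfolding mmono.simps mmul_def s_def[symmetric]
    by (intro simple_mult[OF below_mdiv[OF below_xmod] above_msig] simple_mdiv simple_msig)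
qed

lemma strict_sorted_blocks: "sorted_wrt (<) (blocks ps)"
  by (induction ps rule: wgt.induct) (auto simp: sorted_wrt_append sorted_wrt_map)

lemma blocks_hd: "admissible ps \<Longrightarrow> ps \<noteq> [] \<Longrightarrow> \<exists>bs. blocks ps = 0 # bs"
  by (cases ps rule: wgt.cases) (auto simp: upt_conv_Cons)

lemma blocks_nth:
  assumes "admissible ((m, r) # ps)" "m < length (blocks ((m, r) # ps))"
  shows "ps \<noteq> []" "blocks ((m, r) # ps) ! m = m + nat (- r - 1)"
proof -
  show "ps \<noteq> []" using assms(2) by auto
  then obtain bs where "blocks ps = 0 # bs" using assms(1) blocks_hd[of ps] by auto
  then show "blocks ((m, r) # ps) ! m = m + nat (- r - 1)"
    by (simp add: nth_append)
qed

text \<open>If \<open>m < m'\<close>, the entry at position \<open>m\<close> is still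
  \<open>m\<close> in the second list, whereas the first list has a gap of length
  \<open>-r - 1 \<ge> 1\<close> before that entry.\<close>

lemma blocks_le:
  assumes a: "admissible ((m, r) # ps)" "admissible ((m', r') # ps')"
    and eq: "blocks ((m, r) # ps) = blocks ((m', r') # ps')"
  shows "m' \<le> m"
proof (rule ccontr)
  assume "\<not> m' \<le> m"
  then have m: "m < m'" by simp
  have "blocks ((m', r') # ps') ! m = m" using m by (simp add: nth_append)
  moreover have "m < length (blocks ((m, r) # ps))"
    unfolding eq using m by simp
  then have "ps \<noteq> []" "blocks ((m, r) # ps) ! m = m + nat (- r - 1)"
    using blocks_nth[OF a(1)] by auto
  ultimately show False using a(1) eq by simp
qed

lemma blocks_inj:
  "admissible ps \<Longrightarrow> admissible ps' \<Longrightarrow> blocks ps = blocks ps' \<Longrightarrow> zdeg ps = zdeg ps' \<Longrightarrow> ps = ps'"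
proof (induction ps arbitrary: ps' rule: wgt.induct)
  case 1
  then show ?case using blocks_hd[of ps'] by (cases ps') auto
next
  case (2 m r ps)
  have "ps' \<noteq> []" using 2(2,4) by (auto simp: upt_conv_Cons)
  then obtain m' r' ps1 where ps': "ps' = (m', r') # ps1" by (metis list.exhaust prod.exhaust)
  have m: "m = m'"
    using blocks_le 2(2,3,4) unfolding ps' by (metis le_antisym)
  define s where "s = nat (- r - 1)"
  define s' where "s' = nat (- r' - 1)"
  have r: "r = - int s - 1" "r' = - int s' - 1"
    using 2(2,3) by (auto simp: ps' s_def s'_def split: if_splits)
  have rest: "map (\<lambda>a. m + s + a) (blocks ps) = map (\<lambda>a. m + s' + a) (blocks ps1)"
    using 2(4) by (simp add: ps' m s_def s'_def)
  have adm: "admissible ps" "admissible ps1" using 2(2,3) by (auto simp: ps')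
  show ?case
  \<comment> \<open>With no further block the points do not show the mode, and \<open>zdeg\<close>
    recovers it. Otherwise the entry after the first block is \<open>m + s\<close>, as the remaining
    blocks start at 0.\<close>
  proof (cases "ps = []")
    case True
    then have "ps1 = []" using rest blocks_hd[OF adm(2)] by (cases "ps1 = []") auto
    then show ?thesis using True 2(5) m r by (simp add: ps' s_def[symmetric] s'_def[symmetric])
  next
    case False
    then have "ps1 \<noteq> []" using rest blocks_hd[OF adm(1)] by auto
    then have "s = s'"
      using rest blocks_hd[OF adm(1) False] blocks_hd[OF adm(2)] by auto
    then have "blocks ps = blocks ps1" "zdeg ps = zdeg ps1"
      using rest 2(5) by (simp_all add: ps' s_def[symmetric] s'_def[symmetric] inj_map_eq_map inj_def)
    then have "ps = ps1" using 2(1) adm by blast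
    then show ?thesis using \<open>s = s'\<close> m r by (simp add: ps')
  qed
qed

section \<open>Colourings of the lowest terms\<close>

definition colour :: "nat \<Rightarrow> 'c::{finite, linorder}" where
  "colour k = sorted_list_of_set UNIV ! k"

lemma colour_less: "j < k \<Longrightarrow> k < CARD('c) \<Longrightarrow> (colour j :: 'c::{finite, linorder}) < colour k"
proof -
  assume jk: "j < k" "k < CARD('c)"
  have "sorted_wrt (<) (sorted_list_of_set (UNIV :: 'c set))"
    by (simp add: strict_sorted_iff)
  then show ?thesis
    unfolding colour_def by (rule sorted_wrt_nth_less) (use jk in auto)
qed

fun colouring :: "(nat \<times> int) list \<Rightarrow> ('c::{finite, linorder} \<times> nat) list" where
  "colouring [] = []"
| "colouring ((m, r) # ps) = map (\<lambda>j. (colour (m - 1 - j), j)) [0..<m] @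
    map (\<lambda>x. (fst x, m + nat (- r - 1) + snd x)) (colouring ps)"

lemma snd_colouring: "map snd (colouring ps :: ('c::{finite, linorder} \<times> nat) list) = blocks ps"
proof (induction ps rule: wgt.induct)
  case (2 m r ps)
  have "map (snd \<circ> (\<lambda>x. (fst x, m + nat (- r - 1) + snd x))) (colouring ps :: ('c \<times> nat) list) =
      map (\<lambda>a. m + nat (- r - 1) + a) (map snd (colouring ps :: ('c \<times> nat) list))" by (simp add: o_def)
  with 2 show ?case by (simp add: o_def)
qed simp

lemma cf_colouring:
  assumes "admissible ps" "\<forall>p\<in>set ps. fst p \<le> CARD('c)"
  shows "cf (colouring ps :: ('c::{finite, linorder} \<times> nat) list) \<noteq> 0"
proof (rule cf_neq_0)
  show "sorted_wrt (\<lambda>x x'. snd x < snd x' \<and> (snd x' = Suc (snd x) \<longrightarrow> fst x > fst x')) (colouring ps :: ('c \<times> nat) list)"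
    using assms
  proof (induction ps rule: wgt.induct)
    case (2 m r ps)
    have 1: "sorted_wrt (\<lambda>j j'. j < j' \<and> (j' = Suc j \<longrightarrow> (colour (m - 1 - j) :: 'c) > colour (m - 1 - j'))) [0..<m]"
    proof (rule sorted_wrt_mono_rel[OF _ sorted_wrt_upt])
      fix j j' assume "j \<in> set [0..<m]" "j' \<in> set [0..<m]" "j < j'"
      then show "j < j' \<and> (j' = Suc j \<longrightarrow> (colour (m - 1 - j) :: 'c) > colour (m - 1 - j'))"
        using 2(3) by (auto intro!: colour_less)
    qed
    \<comment> \<open>Neighbouring points never lie in different blocks: a further block forces
      \<open>r \<le> - 2\<close>, hence a gap.\<close>
    have nsuc: "m + nat (- r - 1) + a \<noteq> Suc j" if "(l, a) \<in> set (colouring ps :: ('c \<times> nat) list)" "j < m" for l a j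
    proof -
      have "ps \<noteq> []" using that(1) by auto
      then have "r \<le> - 2" using 2(2) by simp
      then show ?thesis using that(2) by simp
    qed
    show ?case
      using 1 2 nsuc by (auto simp: sorted_wrt_append sorted_wrt_map)
  qed simp
qed

section \<open>The basis\<close>

text \<open>The multiset lists its points in increasing order, and for separated multisets the
  concatenation is already sorted; so \<open>reg_prod_xprod\<close> supplies
  \<open>P_prod\<close>.\<close>

interpretation xp: current_family "\<lambda>S. xprod (sorted_list_of_multiset S) :: ('c::{finite, linorder} \<Rightarrow> fock) cur"
proof
  fix S T :: "nat multiset"
  show "(xprod (sorted_list_of_multiset S) :: ('c \<Rightarrow> fock) cur) \<in> currents" by simp
  show "xprod (sorted_list_of_multiset {#}) = (fls_const :: ('c \<Rightarrow> fock) vec \<Rightarrow> _)"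
    by (simp add: xprod_Nil)
  have "sorted_list_of_multiset (image_mset Suc S) = map Suc (sorted_list_of_multiset S)"
  proof -
    have "sorted (map Suc (sorted_list_of_multiset S))"
      by (simp add: sorted_map)
    then show ?thesis
      by (metis mset_map mset_sorted_list_of_multiset sorted_list_of_multiset_mset sorted_sort_id)
  qed
  then show "cur_dilate Q (xprod (sorted_list_of_multiset S)) =
      (xprod (sorted_list_of_multiset (image_mset Suc S)) :: ('c \<Rightarrow> fock) cur)"
    by (simp add: cur_dilate_xprod)
  assume ST: "\<And>a b. a \<in># S \<Longrightarrow> b \<in># T \<Longrightarrow> a < b"
  have "sorted (sorted_list_of_multiset S @ sorted_list_of_multiset T)"
    using ST by (auto simp: sorted_append less_imp_le)
  then have "sorted_list_of_multiset (S + T) = sorted_list_of_multiset S @ sorted_list_of_multiset T"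
    by (metis mset_append mset_sorted_list_of_multiset sorted_list_of_multiset_mset sorted_sort_id)
  moreover have "reg_prod (xprod (sorted_list_of_multiset S)) (xprod (sorted_list_of_multiset T))
      (xprod (sorted_list_of_multiset S @ sorted_list_of_multiset T) :: ('c \<Rightarrow> fock) cur)"
    by (rule reg_prod_xprod) (use ST in simp)
  ultimately show "reg_prod (xprod (sorted_list_of_multiset S)) (xprod (sorted_list_of_multiset T))
      (xprod (sorted_list_of_multiset (S + T)) :: ('c \<Rightarrow> fock) cur)"
    by (simp only:)
qed

context current_family
begin

text \<open>The product with \<open>X\<close> in mode \<open>-1\<close> takes no derivative: it
  moves the points \<open>0, ..., m - 1\<close> up by one and adds the point 0.\<close>

lemma XM_eq: "XM m = homog (ev (xmod m)) m"
proof (induction m)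
  case 0
  have "xmod 0 = 1" by (simp add: xmod_def zero_prod_def[symmetric] zero_multiset_def[symmetric])
  then show ?case by (simp add: curt_one_eq)
next
  case (Suc m)
  have "mset [0..<Suc m] = add_mset 0 (image_mset Suc (mset [0..<m]))"
    by (simp add: upt_conv_Cons map_Suc_upt[symmetric] del: upt_Suc mset_upt)
  then have "mmul 0 1 mx (xmod m) = xmod (Suc m)"
    by (simp add: mmul_def mdiv_def Qfact_def mx_def xmod_def msigma_single mult_single del: upt_Suc mset_upt)
  then show ?case
    using curt_prod_homog[OF below_mx below_xmod, of 0 m] by (simp add: XM_Suc Suc X_eq)
qed

lemma mono_eq: "admissible ps \<Longrightarrow> mono_prod ps = homog (ev (mmono ps)) (wgt ps)"
proof (induction ps rule: wgt.induct)
  case 1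
  show ?case by (simp add: curt_one_eq)
next
  case (2 m r ps)
  then have "r = - int (nat (- r - 1)) - 1" by (auto split: if_splits)
  with 2 show ?case
    using curt_prod_homog[OF below_xmod below_mmono, of "nat (- r - 1)" m ps] by (simp add: XM_eq)
qed

end

text \<open>The map \<open>ev\<close> is not injective, as products over long runs of points vanish;
  but \<open>xprod_independent\<close> kills every coefficient whose points admit a colouring with
  \<open>cf \<noteq> 0\<close>, and \<open>colouring ps\<close> is one.\<close>

lemma ev_coeff_zero:
  fixes ps :: "(nat \<times> int) list"
  assumes f: "simple f" and ev: "xp.ev f = (0 :: ('c::{finite, linorder} \<Rightarrow> fock) cur)"
    and adm: "admissible ps" "\<forall>p\<in>set ps. fst p \<le> CARD('c)"
  shows "Poly_Mapping.lookup f (k, mset (blocks ps)) = 0"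
proof (cases "(k, mset (blocks ps)) \<in> Poly_Mapping.keys f")
  case True
  define w :: "('c \<times> nat) list" where "w = colouring ps"
  have w: "map snd w = blocks ps" by (simp add: w_def snd_colouring)
  define A where "A = (\<lambda>x. (fst x, sorted_list_of_multiset (snd x))) ` Poly_Mapping.keys f"
  have inj: "inj_on (\<lambda>x. (fst x, sorted_list_of_multiset (snd x))) (Poly_Mapping.keys f)"
    by (rule inj_onI) (metis mset_sorted_list_of_multiset prod.collapse prod.inject)
  have sb: "sorted_list_of_multiset (mset (blocks ps)) = blocks ps"
  proof -
    have "sorted (blocks ps)" using strict_sorted_blocks[of ps] strict_sorted_iff by blast
    then show ?thesis unfolding sorted_list_of_multiset_mset by (rule sorted_sort_id)
  qed
  have "Poly_Mapping.lookup f (k, mset (map snd w)) = 0"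
  proof (rule xprod_independent[where A = A and f = "\<lambda>k as. Poly_Mapping.lookup f (k, mset as)"])
    show "finite A" by (simp add: A_def)
    show "(k, map snd w) \<in> A"
      unfolding A_def by (rule image_eqI[OF _ True]) (simp only: w sb fst_conv snd_conv)
    show "cf w \<noteq> 0" unfolding w_def by (rule cf_colouring[OF adm])
    show "(\<Sum>(k, as)\<in>A. cur_smul (Poly_Mapping.lookup f (k, mset as)) (cur_shift k (xprod as))) = (0 :: ('c \<Rightarrow> fock) cur)"
      unfolding A_def sum.reindex[OF inj] using ev by (simp add: xp.ev_eq o_def)
    fix k as assume "(k, as) \<in> A"
    then obtain x where x: "x \<in> Poly_Mapping.keys f" "as = sorted_list_of_multiset (snd x)"
      by (auto simp: A_def)
    have "count (mset as) a \<le> 1" for a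
      using f x by (simp add: simple_def)
    then have "count (mset as) a = (if a \<in> set as then 1 else 0)" for a
      using count_greater_zero_iff[of "mset as" a] by (simp add: le_Suc_eq le_antisym)
    then have "distinct as" by (simp add: distinct_count_atmost_1)
    then show "sorted_wrt (<) as"
      by (simp add: x strict_sorted_iff)
  qed
  then show ?thesis by (simp add: w)
qed (simp add: in_keys_iff)

lemma xp_X: "(xp.X :: ('c::{finite, linorder} \<Rightarrow> fock) curt) = homog x_cur 1"
proof -
  have "sorted_list_of_multiset {#0 :: nat#} = [0]" by simp
  then show ?thesis by (simp only: xp.X_def xprod_0)
qed

lemma V_c1_eq: "(V_c1 :: ('c::{finite, linorder} \<Rightarrow> fock) curt set) = xp.VV"
  unfolding V_c1_def xp_X[symmetric]
  by (rule Least_equality) (auto simp: xp.q_vertex_algebra_VV xp.X_in_VV dest: subsetD[OF xp.VV_minimal])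

lemma x_m_eq: "x_m m = (xp.XM m :: ('c::{finite, linorder} \<Rightarrow> fock) curt)"
  by (simp only: x_m_def xp.XM_def xp_X)

lemma monomial_eq: "monomial ps = (xp.mono_prod ps :: ('c::{finite, linorder} \<Rightarrow> fock) curt)"
  by (simp only: monomial_def xp.mono_prod_def x_m_eq)

definition basis_index :: "nat \<Rightarrow> (nat \<times> int) list set" where
  "basis_index c = {ps. admissible ps \<and> (\<forall>p\<in>set ps. fst p \<le> c)}"

lemma B_c1_eq: "(B_c1 :: ('c::{finite, linorder} \<Rightarrow> fock) curt set) = xp.mono_prod ` basis_index CARD('c)"
  unfolding B_c1_def monomial_eq basis_index_def admissible_iff all_set_conv_all_nth by blast

lemma XM_eq_0:
  assumes "CARD('c::{finite, linorder}) < m"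
  shows "(xp.XM m :: ('c \<Rightarrow> fock) curt) = 0"
proof -
  have "sorted_list_of_multiset (mset [0..<m]) = [0..<0 + m]"
    unfolding sorted_list_of_multiset_mset by (simp add: sorted_sort_id)
  then have "(xp.ev (xmod m) :: ('c \<Rightarrow> fock) cur) = cur_smul 1 (cur_shift 0 (xprod [0..<0 + m]))"
    by (simp only: xmod_def xp.ev_single)
  then show ?thesis
    unfolding xp.XM_eq xprod_eq_0[OF assms] by simp
qed

lemma mono_eq_0:
  assumes "\<exists>p\<in>set ps. CARD('c::{finite, linorder}) < fst p"
  shows "(xp.mono_prod ps :: ('c \<Rightarrow> fock) curt) = 0"
  using assms
proof (induction ps)
  case (Cons p ps)
  obtain m r where p: "p = (m, r)" by (cases p)
  from Cons.prems consider "CARD('c) < m" | "\<exists>p\<in>set ps. CARD('c) < fst p" by (auto simp: p)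
  then show ?case
  proof cases
    case 1
    then show ?thesis by (simp add: p XM_eq_0)
  next
    case 2
    then show ?thesis by (simp add: p Cons.IH)
  qed
qed simp

lemma span_B_c1: "curt_vs.span (B_c1 :: ('c::{finite, linorder} \<Rightarrow> fock) curt set) = V_c1"
proof
  show "curt_vs.span B_c1 \<subseteq> (V_c1 :: ('c \<Rightarrow> fock) curt set)"
    unfolding V_c1_eq B_c1_eq xp.VV_def basis_index_def by (intro curt_vs.span_mono) auto
  have "(xp.mono_prod ps :: ('c \<Rightarrow> fock) curt) \<in> curt_vs.span B_c1" if "admissible ps" for ps
  proof (cases "ps \<in> basis_index CARD('c)")
    case True
    then show ?thesis unfolding B_c1_eq by (intro curt_vs.span_base) blast
  next
    case False
    with that have "(xp.mono_prod ps :: ('c \<Rightarrow> fock) curt) = 0"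
      by (intro mono_eq_0) (auto simp: basis_index_def not_le)
    then show ?thesis by (simp only: curt_vs.span_zero)
  qed
  then show "(V_c1 :: ('c \<Rightarrow> fock) curt set) \<subseteq> curt_vs.span B_c1"
    unfolding V_c1_eq xp.VV_def by (intro curt_vs.span_minimal curt_vs.subspace_span) auto
qed

text \<open>Among the monomials with nonzero coefficient one is taken whose lowest sum of points is
  minimal. Its lowest term cannot cancel: another such monomial containing it would have a smaller
  lowest sum, or the same blocks and the same power of \<open>z\<close>, and then
  \<open>blocks_inj\<close> makes the two equal.\<close>

lemma independent_monomials:
  assumes A: "finite A" "A \<subseteq> basis_index CARD('c::{finite, linorder})"
    and zero: "(\<Sum>ps\<in>A. curt_smul (u ps) (xp.mono_prod ps)) = (0 :: ('c \<Rightarrow> fock) curt)"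
    and ps: "ps \<in> A"
  shows "u ps = 0"
proof (rule ccontr)
  assume "u ps \<noteq> 0"
  define h where "h ps = sum_list (blocks ps)" for ps
  define N where "N = {ps \<in> A. u ps \<noteq> 0}"
  define p where "p = arg_min_on h N"
  have N: "finite N" "N \<noteq> {}" using ps \<open>u ps \<noteq> 0\<close> A(1) by (auto simp: N_def)
  have p: "p \<in> A" "u p \<noteq> 0"
    using arg_min_if_finite(1)[OF N, of h] by (simp_all add: p_def N_def)
  have min: "h p \<le> h p'" if "p' \<in> A" "u p' \<noteq> 0" for p'
    using arg_min_if_finite(2)[OF N, of h] that by (auto simp: p_def N_def not_less)
  have adm: "admissible p'" "\<forall>x\<in>set p'. fst x \<le> CARD('c)" if "p' \<in> A" for p'
    using A(2) that by (auto simp: basis_index_def)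
  \<comment> \<open>Taking the component of weight \<open>wgt p\<close> in \<open>t\<close> turns
    the relation into the vanishing of \<open>ev\<close> on one element of the model.\<close>
  define A' where "A' = {p' \<in> A. wgt p' = wgt p}"
  define f where "f = (\<Sum>p'\<in>A'. cst (u p') * mmono p')"
  have "simple f"
    unfolding f_def by (intro simple_sum simple_cst simple_mmono)
  moreover have "xp.ev f = (0 :: ('c \<Rightarrow> fock) cur)"
  proof -
    have "(0 :: ('c \<Rightarrow> fock) cur) = Poly_Mapping.lookup (\<Sum>p'\<in>A. curt_smul (u p') (xp.mono_prod p')) (wgt p)"
      unfolding zero by (rule lookup_zero[symmetric])
    also have "\<dots> = (\<Sum>p'\<in>A. if wgt p' = wgt p then cur_smul (u p') (xp.ev (mmono p')) else 0)"
      unfolding lookup_sum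
      by (rule sum.cong) (simp_all only: lookup_curt_smul xp.mono_eq[OF adm(1)] lookup_homog when_def if_distrib[of "cur_smul _"] cur_smul_0 refl)
    also have "\<dots> = (\<Sum>p'\<in>A'. cur_smul (u p') (xp.ev (mmono p')))"
      unfolding A'_def by (rule sum.inter_filter[OF A(1), symmetric])
    also have "\<dots> = xp.ev f"
      by (simp only: f_def xp.ev_sum xp.ev_cst)
    finally show ?thesis ..
  qed
  ultimately have "Poly_Mapping.lookup f (zdeg p, mset (blocks p)) = 0"
    by (rule ev_coeff_zero) (use adm p in auto)
  moreover have "Poly_Mapping.lookup f (zdeg p, mset (blocks p)) =
      (\<Sum>p'\<in>A'. if p' = p then u p * Poly_Mapping.lookup (mmono p) (zdeg p, mset (blocks p)) else 0)"
    unfolding f_def lookup_sum smul_cst[symmetric] lookup_smul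
  proof (rule sum.cong)
    fix p' assume "p' \<in> A'"
    then have p': "p' \<in> A" by (simp add: A'_def)
    have l: "low (zdeg p') (mset (blocks p')) (mmono p')"
      by (rule low_mmono) (rule adm(1)[OF p'])
    have "u p' * Poly_Mapping.lookup (mmono p') (zdeg p, mset (blocks p)) = 0" if "p' \<noteq> p"
    proof (rule ccontr)
      assume "u p' * Poly_Mapping.lookup (mmono p') (zdeg p, mset (blocks p)) \<noteq> 0"
      then have u: "u p' \<noteq> 0" and k: "(zdeg p, mset (blocks p)) \<in> Poly_Mapping.keys (mmono p')"
        by (auto simp: in_keys_iff)
      have z: "zdeg p = zdeg p'" "mset (blocks p) = mset (blocks p') \<or> h p' < h p"
        using l k by (force simp: low_def h_def sum_mset_sum_list)+
      with min[OF p' u] have "mset (blocks p) = mset (blocks p')" by simp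
      then have "blocks p = blocks p'"
        using strict_sorted_blocks[of p] strict_sorted_blocks[of p']
        by (metis sorted_list_of_multiset_mset sorted_sort_id strict_sorted_iff)
      then have "p = p'"
        using adm p(1) p' z by (intro blocks_inj) auto
      with that show False by simp
    qed
    then show "u p' * Poly_Mapping.lookup (mmono p') (zdeg p, mset (blocks p)) =
      (if p' = p then u p * Poly_Mapping.lookup (mmono p) (zdeg p, mset (blocks p)) else 0)" by auto
  qed simp
  moreover have "finite A'" "p \<in> A'" using A(1) p by (auto simp: A'_def)
  moreover have "Poly_Mapping.lookup (mmono p) (zdeg p, mset (blocks p)) \<noteq> 0"
    using low_mmono[OF adm(1)[OF p(1)]] by (simp add: low_def)
  ultimately show False using p by simp
qed

theorem theorem3p10:
  fixes c :: nat
  assumes "1 \<le> c" and "CARD('c::{finite, linorder}) = c"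
  shows "is_basis_of curt_smul (B_c1 :: ('c \<Rightarrow> fock) curt set) V_c1"
proof -
  have "\<not> curt_vs.dependent (B_c1 :: ('c \<Rightarrow> fock) curt set)"
  proof
    assume "curt_vs.dependent (B_c1 :: ('c \<Rightarrow> fock) curt set)"
    then obtain t u v where t: "finite t" "t \<subseteq> (B_c1 :: ('c \<Rightarrow> fock) curt set)"
      "(\<Sum>v\<in>t. curt_smul (u v) v) = 0" "v \<in> t" "u v \<noteq> 0"
      unfolding curt_vs.dependent_explicit by blast
    have "t \<subseteq> xp.mono_prod ` basis_index CARD('c)" using t(2) unfolding B_c1_eq .
    \<comment> \<open>One index list is chosen for every element of \<open>t\<close>, so that a
      relation between elements of the set \<open>B_c1\<close> becomes one indexed by lists.\<close>
    then have "\<exists>A. A \<subseteq> basis_index CARD('c) \<and> inj_on (xp.mono_prod :: _ \<Rightarrow> ('c \<Rightarrow> fock) curt) A \<and> t = xp.mono_prod ` A"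
      by (rule iffD1[OF subset_image_inj])
    then obtain A where A: "A \<subseteq> basis_index CARD('c)" "inj_on (xp.mono_prod :: _ \<Rightarrow> ('c \<Rightarrow> fock) curt) A" "t = xp.mono_prod ` A"
      by (elim exE conjE)
    have fin: "finite A" using t(1) unfolding A(3) by (rule finite_imageD[OF _ A(2)])
    have "(\<Sum>ps\<in>A. curt_smul (u (xp.mono_prod ps :: ('c \<Rightarrow> fock) curt)) (xp.mono_prod ps)) = (0 :: ('c \<Rightarrow> fock) curt)"
      using t(3) unfolding A(3) sum.reindex[OF A(2)] by (simp only: o_def)
    then have zero: "u (xp.mono_prod ps :: ('c \<Rightarrow> fock) curt) = 0" if "ps \<in> A" for ps
      by (rule independent_monomials[OF fin A(1) _ that])
    from t(4) obtain ps where ps: "ps \<in> A" "v = xp.mono_prod ps" unfolding A(3) by (elim imageE)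
    from t(5) zero[OF ps(1)] show False unfolding ps(2) by (rule notE)
  qed
  then show ?thesis
    by (simp add: is_basis_of_def span_B_c1)
qed

end
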